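(* Let $p$ be an odd prime and let $r\in\mathbb{Z}_p^\times$ be an element that is not a root of unity. Let $G_r=\overline{\{r^k:k\in\mathbb{Z}\}}\subseteq\mathbb{Z}_p^\times$ and let $\gamma:\mathbb{Z}_p^\times/G_r\to\mathbb{Z}_p^\times$ be a section of the quotient map $\mathbb{Z}_p^\times\to\mathbb{Z}_p^\times/G_r$. Then the following assignments on generators define a faithful representation $$\pi:A_r\to B\big(\ell^2(\mathbb{Z}\times\mathbb{Z}_{\geq 0}\times\mathbb{Z}_p^\times/G_r)\big):$$ $V_r\mapsto v_r$, where $v_r\phi(k,L,xG_r)=\phi(k-1,L,xG_r)$, and $M_f\mapsto\mathcal{M}_f$ for $f\in C(\mathbb{Z}_p)$, where $\mathcal{M}_f\phi(k,L,xG_r)=f\big(r^kp^L\cdot\gamma(xG_r)\big)\,\phi(k,L,xG_r)$.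
   Context: $\mathbb{Z}_p$ is the ring of $p$-adic integers and $\mathbb{Z}_p^\times$ its group of units (the elements of $p$-adic norm $1$). For $r\in\mathbb{Z}_p^\times$, let $\alpha_r:C(\mathbb{Z}_p)\to C(\mathbb{Z}_p)$ be $(\alpha_rf)(x)=f(x/r)$. The algebra $A_r=C(\mathbb{Z}_p)\rtimes_{\alpha_r}\mathbb{N}$ is the universal unital C$^*$-algebra generated by a (unital) copy $\{M_f:f\in C(\mathbb{Z}_p)\}$ of $C(\mathbb{Z}_p)$ and an element $V_r$ satisfying $V_r^*V_r=I$ and $V_rM_fV_r^*=M_{\alpha_r(f)}$ for all $f\in C(\mathbb{Z}_p)$. $\mathbb{Z}_p^\times/G_r$ is used as an index set (as a set, with $\ell^2$ taken with respect to counting measure). *)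

theory Defs
  imports
    "HOL-Analysis.Analysis"
    "HOL-Algebra.Coset"
    "HOL-Algebra.Module"
    "HOL-Library.Poly_Mapping"
    "HOL-Computational_Algebra.Primes"
begin

section \<open>The ring of p-adic integers\<close>

text \<open>
  The \<open>p\<close>-adic integers are realised as the inverse limit of the rings \<open>\<int>/p\<^sup>n\<int>\<close>: an element is
  the sequence of its residues \<open>x n \<in> {0..<p\<^sup>n}\<close>.  The type of integer sequences carries the product
  topology of the discrete topologies on the factors (the topology of \<^typ>\<open>nat \<Rightarrow> int\<close> provided by
  \<^theory>\<open>HOL-Analysis.Function_Topology\<close>); on the inverse limit this is the \<open>p\<close>-adic topology, since
  \<open>\<bar>x - y\<bar> \<le> p\<^sup>-\<^sup>n\<close> means exactly that \<open>x\<close> and \<open>y\<close> have the same residues up to index \<open>n\<close>.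
\<close>

type_synonym padic_seq = "nat \<Rightarrow> int"

definition padic_of_int :: "nat \<Rightarrow> int \<Rightarrow> padic_seq" where
  "padic_of_int p z = (\<lambda>n. z mod int p ^ n)"

definition padic :: "nat \<Rightarrow> padic_seq ring" where
  "padic p =
    \<lparr> carrier = {x. \<forall>n. 0 \<le> x n \<and> x n < int p ^ n \<and> x (Suc n) mod int p ^ n = x n},
      mult = (\<lambda>x y n. (x n * y n) mod int p ^ n),
      one = padic_of_int p 1,
      zero = padic_of_int p 0,
      add = (\<lambda>x y n. (x n + y n) mod int p ^ n) \<rparr>"

abbreviation padic_units :: "nat \<Rightarrow> padic_seq monoid" where
  "padic_units p \<equiv> units_of (padic p)"

definition orbit_closure :: "nat \<Rightarrow> padic_seq \<Rightarrow> padic_seq set" where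
  "orbit_closure p r =
    closure {r [^]\<^bsub>padic_units p\<^esub> k | k :: int. True} \<inter> carrier (padic_units p)"

text \<open>
  Continuous functions on the \<open>p\<close>-adic integers are represented by their extension by zero to the
  ambient sequence type, so that equality on the \<open>p\<close>-adic integers is equality.
\<close>

definition cont_padic :: "nat \<Rightarrow> (padic_seq \<Rightarrow> complex) set" where
  "cont_padic p =
    {f. continuous_on (carrier (padic p)) f \<and> (\<forall>x. x \<notin> carrier (padic p) \<longrightarrow> f x = 0)}"

definition dilate :: "nat \<Rightarrow> padic_seq \<Rightarrow> (padic_seq \<Rightarrow> complex) \<Rightarrow> padic_seq \<Rightarrow> complex" where
  "dilate p r f =
    (\<lambda>x. if x \<in> carrier (padic p) then f (x \<otimes>\<^bsub>padic p\<^esub> inv\<^bsub>padic p\<^esub> r) else 0)"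


section \<open>Complex *-algebras as structures\<close>

record 'a star_algebra = "(complex, 'a) module" +
  star :: "'a \<Rightarrow> 'a"
  alg_norm :: "'a \<Rightarrow> real"

definition star_hom ::
    "('a, 'm) star_algebra_scheme \<Rightarrow> ('b, 'n) star_algebra_scheme \<Rightarrow> ('a \<Rightarrow> 'b) set" where
  "star_hom A B =
    {h \<in> ring_hom A B.
      (\<forall>c. \<forall>x\<in>carrier A. h (c \<odot>\<^bsub>A\<^esub> x) = c \<odot>\<^bsub>B\<^esub> h x) \<and>
      (\<forall>x\<in>carrier A. h (star A x) = star B (h x))}"


section \<open>Universal unital C*-algebras given by generators and relations\<close>

subsection \<open>The free unital *-algebra\<close>

text \<open>
  The free unital *-algebra on a set of generators is the monoid algebra over \<open>\<complex>\<close> of the free monoid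
  of words in the generators and their formal adjoints.  The product of the monoid algebra is the one
  of \<^theory>\<open>HOL-Library.Poly_Mapping\<close>, which expects the monoid to be written additively.
\<close>

datatype 'g letter = Gen 'g | Adj 'g

datatype 'g word = Word (letters: "'g letter list")

instantiation word :: (type) monoid_add
begin

definition zero_word :: "'a word" where "0 = Word []"

definition plus_word :: "'a word \<Rightarrow> 'a word \<Rightarrow> 'a word" where
  "u + v = Word (letters u @ letters v)"

instance by standard (simp_all add: zero_word_def plus_word_def)

end

type_synonym 'g free_alg = "'g word \<Rightarrow>\<^sub>0 complex"

primrec adj_letter :: "'g letter \<Rightarrow> 'g letter" where
  "adj_letter (Gen g) = Adj g"
| "adj_letter (Adj g) = Gen g"

definition adj_word :: "'g word \<Rightarrow> 'g word" where
  "adj_word w = Word (rev (map adj_letter (letters w)))"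

definition fgen :: "'g \<Rightarrow> 'g free_alg" where
  "fgen g = Poly_Mapping.single (Word [Gen g]) 1"

definition fscale :: "complex \<Rightarrow> 'g free_alg \<Rightarrow> 'g free_alg" where
  "fscale c x = Poly_Mapping.single 0 c * x"

definition fstar :: "'g free_alg \<Rightarrow> 'g free_alg" where
  "fstar x =
    (\<Sum>w\<in>Poly_Mapping.keys x. Poly_Mapping.single (adj_word w) (cnj (Poly_Mapping.lookup x w)))"

definition free_carrier :: "'g set \<Rightarrow> 'g free_alg set" where
  "free_carrier G =
    {x. \<forall>w\<in>Poly_Mapping.keys x. set (letters w) \<subseteq> Gen ` G \<union> Adj ` G}"

subsection \<open>The universal C*-seminorm\<close>

definition cstar_seminorm :: "'g set \<Rightarrow> ('g free_alg \<Rightarrow> real) \<Rightarrow> bool" where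
  "cstar_seminorm G \<rho> \<longleftrightarrow>
    (\<forall>x\<in>free_carrier G. 0 \<le> \<rho> x) \<and>
    (\<forall>x\<in>free_carrier G. \<forall>y\<in>free_carrier G. \<rho> (x + y) \<le> \<rho> x + \<rho> y) \<and>
    (\<forall>c. \<forall>x\<in>free_carrier G. \<rho> (fscale c x) = cmod c * \<rho> x) \<and>
    (\<forall>x\<in>free_carrier G. \<forall>y\<in>free_carrier G. \<rho> (x * y) \<le> \<rho> x * \<rho> y) \<and>
    (\<forall>x\<in>free_carrier G. \<rho> (fstar x * x) = (\<rho> x)\<^sup>2)"

text \<open>
  A relation is an element \<open>y\<close> of the free *-algebra, read as \<open>y = 0\<close>.  Families in a C*-algebra
  that are indexed by the generators and satisfy the relations correspond to C*-seminorms vanishing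
  on the relations.  The supremum of these seminorms is the universal one; it is finite when each
  generator is bounded uniformly in all of them, as is the case for the relations used below.
\<close>

definition univ_seminorm :: "'g set \<Rightarrow> 'g free_alg set \<Rightarrow> 'g free_alg \<Rightarrow> real" where
  "univ_seminorm G R x = (SUP \<rho>\<in>{\<rho>. cstar_seminorm G \<rho> \<and> (\<forall>y\<in>R. \<rho> y = 0)}. \<rho> x)"

subsection \<open>The Hausdorff completion\<close>

definition univ_cauchy :: "'g set \<Rightarrow> 'g free_alg set \<Rightarrow> (nat \<Rightarrow> 'g free_alg) set" where
  "univ_cauchy G R =
    {X. (\<forall>n. X n \<in> free_carrier G) \<and>
        (\<forall>e>0. \<exists>N. \<forall>m\<ge>N. \<forall>n\<ge>N. univ_seminorm G R (X m - X n) < e)}"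

definition univ_rel ::
    "'g set \<Rightarrow> 'g free_alg set \<Rightarrow> ((nat \<Rightarrow> 'g free_alg) \<times> (nat \<Rightarrow> 'g free_alg)) set" where
  "univ_rel G R =
    {(X, Y). X \<in> univ_cauchy G R \<and> Y \<in> univ_cauchy G R \<and>
             (\<lambda>n. univ_seminorm G R (X n - Y n)) \<longlonglongrightarrow> 0}"

definition univ_emb :: "'g set \<Rightarrow> 'g free_alg set \<Rightarrow> 'g free_alg \<Rightarrow> (nat \<Rightarrow> 'g free_alg) set" where
  "univ_emb G R x = univ_rel G R `` {\<lambda>n. x}"

definition univ_cstar ::
    "'g set \<Rightarrow> 'g free_alg set \<Rightarrow> (nat \<Rightarrow> 'g free_alg) set star_algebra" where
  "univ_cstar G R =
    \<lparr> carrier = univ_cauchy G R // univ_rel G R,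
      mult = (\<lambda>a b. \<Union>X\<in>a. \<Union>Y\<in>b. univ_rel G R `` {\<lambda>n. X n * Y n}),
      one = univ_emb G R 1,
      zero = univ_emb G R 0,
      add = (\<lambda>a b. \<Union>X\<in>a. \<Union>Y\<in>b. univ_rel G R `` {\<lambda>n. X n + Y n}),
      smult = (\<lambda>c a. \<Union>X\<in>a. univ_rel G R `` {\<lambda>n. fscale c (X n)}),
      star = (\<lambda>a. \<Union>X\<in>a. univ_rel G R `` {\<lambda>n. fstar (X n)}),
      alg_norm = (\<lambda>a. the_elem ((\<lambda>X. lim (\<lambda>n. univ_seminorm G R (X n))) ` a)) \<rparr>"


section \<open>The semigroup crossed product\<close>

datatype crossed_gen = GenM "padic_seq \<Rightarrow> complex" | GenV

definition crossed_gens :: "nat \<Rightarrow> crossed_gen set" where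
  "crossed_gens p = insert GenV (GenM ` cont_padic p)"

text \<open>
  The first five families of relations say that \<open>f \<mapsto> M\<^sub>f\<close> is a unital *-homomorphism; the constant
  function \<open>1\<close> is the indicator function of the \<open>p\<close>-adic integers.
\<close>

definition crossed_rels :: "nat \<Rightarrow> padic_seq \<Rightarrow> crossed_gen free_alg set" where
  "crossed_rels p r =
    {fgen (GenM (\<lambda>x. f x + g x)) - (fgen (GenM f) + fgen (GenM g)) | f g.
        f \<in> cont_padic p \<and> g \<in> cont_padic p} \<union>
    {fgen (GenM (\<lambda>x. c * f x)) - fscale c (fgen (GenM f)) | c f. f \<in> cont_padic p} \<union>
    {fgen (GenM (\<lambda>x. f x * g x)) - fgen (GenM f) * fgen (GenM g) | f g.
        f \<in> cont_padic p \<and> g \<in> cont_padic p} \<union>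
    {fgen (GenM (\<lambda>x. cnj (f x))) - fstar (fgen (GenM f)) | f. f \<in> cont_padic p} \<union>
    {fgen (GenM (indicator (carrier (padic p)))) - 1} \<union>
    {fstar (fgen GenV) * fgen GenV - 1} \<union>
    {fgen GenV * fgen (GenM f) * fstar (fgen GenV) - fgen (GenM (dilate p r f)) | f.
        f \<in> cont_padic p}"

definition crossed_alg ::
    "nat \<Rightarrow> padic_seq \<Rightarrow> (nat \<Rightarrow> crossed_gen free_alg) set star_algebra" where
  "crossed_alg p r = univ_cstar (crossed_gens p) (crossed_rels p r)"

definition crossed_V :: "nat \<Rightarrow> padic_seq \<Rightarrow> (nat \<Rightarrow> crossed_gen free_alg) set" where
  "crossed_V p r = univ_emb (crossed_gens p) (crossed_rels p r) (fgen GenV)"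

definition crossed_M ::
    "nat \<Rightarrow> padic_seq \<Rightarrow> (padic_seq \<Rightarrow> complex) \<Rightarrow> (nat \<Rightarrow> crossed_gen free_alg) set" where
  "crossed_M p r f = univ_emb (crossed_gens p) (crossed_rels p r) (fgen (GenM f))"


section \<open>Bounded operators on a space of square-summable families\<close>

definition ell2 :: "'i set \<Rightarrow> ('i \<Rightarrow> complex) set" where
  "ell2 I = {\<phi>. (\<forall>i. i \<notin> I \<longrightarrow> \<phi> i = 0) \<and> (\<lambda>i. (cmod (\<phi> i))\<^sup>2) summable_on I}"

definition ell2_inner :: "'i set \<Rightarrow> ('i \<Rightarrow> complex) \<Rightarrow> ('i \<Rightarrow> complex) \<Rightarrow> complex" where
  "ell2_inner I \<phi> \<psi> = (\<Sum>\<^sub>\<infinity>i\<in>I. \<phi> i * cnj (\<psi> i))"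

definition ell2_norm :: "'i set \<Rightarrow> ('i \<Rightarrow> complex) \<Rightarrow> real" where
  "ell2_norm I \<phi> = sqrt (\<Sum>\<^sub>\<infinity>i\<in>I. (cmod (\<phi> i))\<^sup>2)"

definition bounded_ops :: "'i set \<Rightarrow> (('i \<Rightarrow> complex) \<Rightarrow> ('i \<Rightarrow> complex)) set" where
  "bounded_ops I =
    {T \<in> ell2 I \<rightarrow>\<^sub>E ell2 I.
      (\<forall>\<phi>\<in>ell2 I. \<forall>\<psi>\<in>ell2 I. T (\<lambda>i. \<phi> i + \<psi> i) = (\<lambda>i. T \<phi> i + T \<psi> i)) \<and>
      (\<forall>c. \<forall>\<phi>\<in>ell2 I. T (\<lambda>i. c * \<phi> i) = (\<lambda>i. c * T \<phi> i)) \<and>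
      (\<exists>C. \<forall>\<phi>\<in>ell2 I. ell2_norm I (T \<phi>) \<le> C * ell2_norm I \<phi>)}"

definition hilbert_adjoint ::
    "'i set \<Rightarrow> (('i \<Rightarrow> complex) \<Rightarrow> ('i \<Rightarrow> complex)) \<Rightarrow> ('i \<Rightarrow> complex) \<Rightarrow> ('i \<Rightarrow> complex)" where
  "hilbert_adjoint I T =
    (THE S. S \<in> bounded_ops I \<and>
      (\<forall>\<phi>\<in>ell2 I. \<forall>\<psi>\<in>ell2 I. ell2_inner I (T \<phi>) \<psi> = ell2_inner I \<phi> (S \<psi>)))"

definition bounded_op_alg :: "'i set \<Rightarrow> (('i \<Rightarrow> complex) \<Rightarrow> ('i \<Rightarrow> complex)) star_algebra" where
  "bounded_op_alg I =
    \<lparr> carrier = bounded_ops I,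
      mult = (\<lambda>S T. \<lambda>\<phi>\<in>ell2 I. S (T \<phi>)),
      one = (\<lambda>\<phi>\<in>ell2 I. \<phi>),
      zero = (\<lambda>\<phi>\<in>ell2 I. \<lambda>i. 0),
      add = (\<lambda>S T. \<lambda>\<phi>\<in>ell2 I. \<lambda>i. S \<phi> i + T \<phi> i),
      smult = (\<lambda>c T. \<lambda>\<phi>\<in>ell2 I. \<lambda>i. c * T \<phi> i),
      star = hilbert_adjoint I,
      alg_norm = (\<lambda>T. SUP \<phi>\<in>{\<phi> \<in> ell2 I. ell2_norm I \<phi> \<le> 1}. ell2_norm I (T \<phi>)) \<rparr>"


section \<open>The operators of the representation\<close>

type_synonym orbit_index = "int \<times> nat \<times> padic_seq set"

definition orbit_indices :: "nat \<Rightarrow> padic_seq \<Rightarrow> orbit_index set" where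
  "orbit_indices p r = UNIV \<times> UNIV \<times> carrier (padic_units p Mod orbit_closure p r)"

definition shift_op ::
    "nat \<Rightarrow> padic_seq \<Rightarrow> (orbit_index \<Rightarrow> complex) \<Rightarrow> (orbit_index \<Rightarrow> complex)" where
  "shift_op p r = (\<lambda>\<phi>\<in>ell2 (orbit_indices p r). \<lambda>(k, L, c). \<phi> (k - 1, L, c))"

definition orbit_point ::
    "nat \<Rightarrow> padic_seq \<Rightarrow> (padic_seq set \<Rightarrow> padic_seq) \<Rightarrow> orbit_index \<Rightarrow> padic_seq" where
  "orbit_point p r \<gamma> =
    (\<lambda>(k, L, c). r [^]\<^bsub>padic_units p\<^esub> k \<otimes>\<^bsub>padic p\<^esub>
       padic_of_int p (int p) [^]\<^bsub>padic p\<^esub> L \<otimes>\<^bsub>padic p\<^esub> \<gamma> c)"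

definition mult_op ::
    "nat \<Rightarrow> padic_seq \<Rightarrow> (padic_seq set \<Rightarrow> padic_seq) \<Rightarrow> (padic_seq \<Rightarrow> complex) \<Rightarrow>
     (orbit_index \<Rightarrow> complex) \<Rightarrow> (orbit_index \<Rightarrow> complex)" where
  "mult_op p r \<gamma> f =
    (\<lambda>\<phi>\<in>ell2 (orbit_indices p r). \<lambda>i. f (orbit_point p r \<gamma> i) * \<phi> i)"

end

theory Submission
  imports Defs "HOL-Number_Theory.Cong"
begin

text \<open>
  The relation \<open>V M\<^sub>f V\<^sup>* = M\<^bsub>\<alpha>(f)\<^esub>\<close> for \<open>f = 1\<close> makes \<open>V\<close> unitary, so modulo the relations every element
  of the free *-algebra of degree at most \<open>N\<close> is a sum of \<open>2N + 1\<close> terms \<open>M\<^bsub>f(n)\<^esub> V\<^sup>n\<close>, and every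
  C*-seminorm of it is at most \<open>2(2N + 1) max \<parallel>f(n)\<parallel>\<close>.  The values of the \<open>f(n)\<close> on the orbit points
  \<open>r\<^sup>k p\<^sup>L \<gamma>(c)\<close> are matrix coefficients in the orbit representation, and these points are dense, so
  \<open>\<parallel>f(n)\<parallel>\<close> is at most the norm of the element in the representation.  Applying the resulting bound,
  which is linear in \<open>N\<close>, to the powers of \<open>x\<^sup>* x\<close> and taking roots, one finds that the norm of the
  representation dominates every C*-seminorm; hence it is the universal one, and the extension to the
  completion is isometric.  A *-homomorphism into bounded operators is automatically bounded, because
  \<open>1 - a\<^sup>* a\<close> has a self-adjoint square root when \<open>\<parallel>a\<parallel>\<close> is small; this gives uniqueness.
\<close>


section \<open>Square-summable families\<close>

text \<open>What must be excluded is that some C*-seminorm vanishing on the relations sees more than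
  the orbit representation does, as with full and reduced norms of crossed products. No conditional
  expectation is used; the linear growth of the number of powers of V with the degree is the form in
  which amenability of the integers enters. The coordinate k of the index set records the power of
  V, so different powers send one basis vector to different basis vectors, and the coefficient
  functions can be read off one exponent at a time. Finiteness of the universal seminorm and its
  C*-axioms are results of the comparison: the supremum is a maximum, attained at the
  representation. In the uniqueness part a competing homomorphism satisfies only algebraic
  conditions, so agreement on the dense image of the free algebra does not extend by continuity
  before boundedness is known. The square root is therefore built by an explicit iteration on Cauchy
  sequences.\<close>

lemma ell2_outside: "\<phi> \<in> ell2 I \<Longrightarrow> i \<notin> I \<Longrightarrow> \<phi> i = 0"
  by (simp add: ell2_def)

lemma ell2_norm_nonneg [simp]: "0 \<le> ell2_norm I \<phi>"
  by (simp add: ell2_norm_def infsum_nonneg)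

lemma ell2_norm_sq: "(ell2_norm I \<phi>)\<^sup>2 = (\<Sum>\<^sub>\<infinity>i\<in>I. (cmod (\<phi> i))\<^sup>2)"
  by (simp add: ell2_norm_def infsum_nonneg)

lemma ell2_finite_sum_le:
  assumes "\<phi> \<in> ell2 I" "finite F" "F \<subseteq> I"
  shows "(\<Sum>i\<in>F. (cmod (\<phi> i))\<^sup>2) \<le> (ell2_norm I \<phi>)\<^sup>2"
  unfolding ell2_norm_sq using assms by (intro finite_sum_le_infsum) (auto simp: ell2_def)

lemma ell2_L2_set_le:
  assumes "\<phi> \<in> ell2 I" "finite F" "F \<subseteq> I"
  shows "L2_set (\<lambda>i. cmod (\<phi> i)) F \<le> ell2_norm I \<phi>"
  unfolding L2_set_def using ell2_finite_sum_le[OF assms] by (simp add: real_le_lsqrt)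

text \<open>A uniform bound on finite subfamilies yields membership and the norm bound together, so
  the finite inequalities for \<open>L2_set\<close> carry over to \<open>ell2\<close> with no
  separate argument about infinite sums.\<close>

lemma ell2_memI:
  assumes "\<And>i. i \<notin> I \<Longrightarrow> \<phi> i = 0" "0 \<le> C"
    and "\<And>F. finite F \<Longrightarrow> F \<subseteq> I \<Longrightarrow> L2_set (\<lambda>i. cmod (\<phi> i)) F \<le> C"
  shows ell2_memI_mem: "\<phi> \<in> ell2 I" and ell2_norm_leI: "ell2_norm I \<phi> \<le> C"
proof -
  have fin: "(\<Sum>i\<in>F. (cmod (\<phi> i))\<^sup>2) \<le> C\<^sup>2" if "finite F" "F \<subseteq> I" for F
    using assms(3)[OF that] unfolding L2_set_def by (simp add: sqrt_le_D)
  have sm: "(\<lambda>i. (cmod (\<phi> i))\<^sup>2) summable_on I"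
    by (rule nonneg_bdd_above_summable_on) (auto intro!: bdd_aboveI[of _ "C\<^sup>2"] fin)
  then show "\<phi> \<in> ell2 I" using assms(1) by (simp add: ell2_def)
  have "(\<Sum>\<^sub>\<infinity>i\<in>I. (cmod (\<phi> i))\<^sup>2) \<le> C\<^sup>2"
    by (rule infsum_le_finite_sums[OF sm]) (auto intro: fin)
  then show "ell2_norm I \<phi> \<le> C" using assms(2) unfolding ell2_norm_def
    by (simp add: real_le_lsqrt)
qed

lemma ell2_add:
  assumes "\<phi> \<in> ell2 I" "\<psi> \<in> ell2 I"
  shows ell2_add_mem: "(\<lambda>i. \<phi> i + \<psi> i) \<in> ell2 I"
    and ell2_norm_triangle: "ell2_norm I (\<lambda>i. \<phi> i + \<psi> i) \<le> ell2_norm I \<phi> + ell2_norm I \<psi>"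
proof -
  have *: "L2_set (\<lambda>i. cmod (\<phi> i + \<psi> i)) F \<le> ell2_norm I \<phi> + ell2_norm I \<psi>"
    if F: "finite F" "F \<subseteq> I" for F
  proof -
    have "L2_set (\<lambda>i. cmod (\<phi> i + \<psi> i)) F \<le> L2_set (\<lambda>i. cmod (\<phi> i) + cmod (\<psi> i)) F"
      by (rule L2_set_mono) (auto intro: norm_triangle_ineq)
    also have "\<dots> \<le> L2_set (\<lambda>i. cmod (\<phi> i)) F + L2_set (\<lambda>i. cmod (\<psi> i)) F"
      by (rule L2_set_triangle_ineq)
    also have "\<dots> \<le> ell2_norm I \<phi> + ell2_norm I \<psi>"
      using assms F by (intro add_mono ell2_L2_set_le)
    finally show ?thesis .
  qed
  show "(\<lambda>i. \<phi> i + \<psi> i) \<in> ell2 I"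
    by (rule ell2_memI_mem[OF _ _ *]) (use assms in \<open>auto simp: ell2_outside\<close>)
  show "ell2_norm I (\<lambda>i. \<phi> i + \<psi> i) \<le> ell2_norm I \<phi> + ell2_norm I \<psi>"
    by (rule ell2_norm_leI[OF _ _ *]) (use assms in \<open>auto simp: ell2_outside\<close>)
qed

lemma ell2_dominated:
  assumes "\<phi> \<in> ell2 I" "\<And>i. i \<notin> I \<Longrightarrow> \<psi> i = 0" "0 \<le> c"
    and "\<And>i. i \<in> I \<Longrightarrow> cmod (\<psi> i) \<le> c * cmod (\<phi> i)"
  shows ell2_dominated_mem: "\<psi> \<in> ell2 I"
    and ell2_dominated_norm: "ell2_norm I \<psi> \<le> c * ell2_norm I \<phi>"
proof -
  have *: "L2_set (\<lambda>i. cmod (\<psi> i)) F \<le> c * ell2_norm I \<phi>"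
    if F: "finite F" "F \<subseteq> I" for F
  proof -
    have "L2_set (\<lambda>i. cmod (\<psi> i)) F \<le> L2_set (\<lambda>i. c * cmod (\<phi> i)) F"
      by (rule L2_set_mono) (use assms F in auto)
    also have "\<dots> = c * L2_set (\<lambda>i. cmod (\<phi> i)) F"
      using assms by (simp add: L2_set_right_distrib)
    also have "\<dots> \<le> c * ell2_norm I \<phi>"
      using assms F by (intro mult_left_mono ell2_L2_set_le)
    finally show ?thesis .
  qed
  show "\<psi> \<in> ell2 I"
    by (rule ell2_memI_mem[OF _ _ *]) (use assms in auto)
  show "ell2_norm I \<psi> \<le> c * ell2_norm I \<phi>"
    by (rule ell2_norm_leI[OF _ _ *]) (use assms in auto)
qed

lemma ell2_scale_mem: "\<phi> \<in> ell2 I \<Longrightarrow> (\<lambda>i. c * \<phi> i) \<in> ell2 I"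
  by (rule ell2_dominated_mem[where c="cmod c"]) (auto simp: ell2_outside norm_mult)

lemma ell2_norm_scale: "ell2_norm I (\<lambda>i. c * \<phi> i) = cmod c * ell2_norm I \<phi>"
  by (simp add: ell2_norm_def norm_mult power_mult_distrib infsum_cmult_right' real_sqrt_mult)

lemma ell2_zero_mem [simp]: "(\<lambda>i. 0) \<in> ell2 I"
  by (simp add: ell2_def)

lemma ell2_norm_zero [simp]: "ell2_norm I (\<lambda>i. 0) = 0"
  by (simp add: ell2_norm_def)

lemma ell2_diff_mem:
  assumes "\<phi> \<in> ell2 I" "\<psi> \<in> ell2 I"
  shows "(\<lambda>i. \<phi> i - \<psi> i) \<in> ell2 I"
  using ell2_add_mem[OF assms(1) ell2_scale_mem[OF assms(2), of "-1"]] by simp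

lemma ell2_norm_minus_commute: "ell2_norm I (\<lambda>i. \<phi> i - \<psi> i) = ell2_norm I (\<lambda>i. \<psi> i - \<phi> i)"
  by (simp add: ell2_norm_def norm_minus_commute)

lemma ell2_norm_triangle_diff:
  assumes "\<phi> \<in> ell2 I" "\<psi> \<in> ell2 I" "\<xi> \<in> ell2 I"
  shows "ell2_norm I (\<lambda>i. \<phi> i - \<xi> i)
    \<le> ell2_norm I (\<lambda>i. \<phi> i - \<psi> i) + ell2_norm I (\<lambda>i. \<psi> i - \<xi> i)"
  using ell2_norm_triangle[OF ell2_diff_mem[OF assms(1,2)] ell2_diff_mem[OF assms(2,3)]] by simp

lemma ell2_sum_mem:
  assumes "\<And>a. a \<in> A \<Longrightarrow> \<phi> a \<in> ell2 I"
  shows "(\<lambda>i. \<Sum>a\<in>A. \<phi> a i) \<in> ell2 I"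
  using assms
proof (induction A rule: infinite_finite_induct)
  case (insert x F)
  then have "(\<lambda>i. \<phi> x i + (\<Sum>a\<in>F. \<phi> a i)) \<in> ell2 I" by (intro ell2_add_mem) auto
  then show ?case using insert by simp
qed auto

lemma ell2_coord_le:
  assumes "\<phi> \<in> ell2 I" shows "cmod (\<phi> i) \<le> ell2_norm I \<phi>"
proof (cases "i \<in> I")
  case True
  then show ?thesis using ell2_L2_set_le[OF assms, of "{i}"] by simp
qed (simp add: ell2_outside[OF assms])

lemma ell2_norm_eq_0:
  assumes "\<phi> \<in> ell2 I" "ell2_norm I \<phi> = 0" shows "\<phi> = (\<lambda>i. 0)"
  using ell2_coord_le[OF assms(1)] assms(2) by auto

text \<open>Fatou for counting measure: every finite part of the limit obeys the same bound.
  Coordinatewise convergence suffices, and that is what the completeness proof for operators has at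
  hand.\<close>

lemma ell2_lim:
  assumes "\<And>n. \<phi> n \<in> ell2 I" "\<And>n. ell2_norm I (\<phi> n) \<le> C" "\<And>i. (\<lambda>n. \<phi> n i) \<longlonglongrightarrow> \<psi> i"
  shows ell2_lim_mem: "\<psi> \<in> ell2 I" and ell2_lim_norm: "ell2_norm I \<psi> \<le> C"
proof -
  have C: "0 \<le> C" using assms(2)[of 0] ell2_norm_nonneg[of I "\<phi> 0"] by linarith
  have *: "L2_set (\<lambda>i. cmod (\<psi> i)) F \<le> C" if F: "finite F" "F \<subseteq> I" for F
  proof (rule LIMSEQ_le_const2)
    show "(\<lambda>n. L2_set (\<lambda>i. cmod (\<phi> n i)) F) \<longlonglongrightarrow> L2_set (\<lambda>i. cmod (\<psi> i)) F"
      unfolding L2_set_def by (intro tendsto_intros assms(3))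
    show "\<exists>N. \<forall>n\<ge>N. L2_set (\<lambda>i. cmod (\<phi> n i)) F \<le> C"
      using ell2_L2_set_le[OF assms(1) F] assms(2) order_trans by blast
  qed
  have 0: "\<psi> i = 0" if "i \<notin> I" for i
    using assms(3)[of i] ell2_outside[OF assms(1) that] by (simp add: LIMSEQ_const_iff)
  show "\<psi> \<in> ell2 I" by (rule ell2_memI_mem[OF 0 C *])
  show "ell2_norm I \<psi> \<le> C" by (rule ell2_norm_leI[OF 0 C *])
qed

section \<open>Cauchy-Schwarz and the inner product\<close>

lemma ell2_inner_abs_summable:
  assumes "\<phi> \<in> ell2 I" "\<psi> \<in> ell2 I"
  shows "(\<lambda>i. cmod (\<phi> i * cnj (\<psi> i))) summable_on I"
    and "cmod (ell2_inner I \<phi> \<psi>) \<le> ell2_norm I \<phi> * ell2_norm I \<psi>"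
proof -
  have *: "(\<Sum>i\<in>F. cmod (\<phi> i * cnj (\<psi> i))) \<le> ell2_norm I \<phi> * ell2_norm I \<psi>"
    if F: "finite F" "F \<subseteq> I" for F
  proof -
    have "(\<Sum>i\<in>F. cmod (\<phi> i * cnj (\<psi> i))) = (\<Sum>i\<in>F. \<bar>cmod (\<phi> i)\<bar> * \<bar>cmod (\<psi> i)\<bar>)"
      by (simp add: norm_mult)
    also have "\<dots> \<le> L2_set (\<lambda>i. cmod (\<phi> i)) F * L2_set (\<lambda>i. cmod (\<psi> i)) F"
      by (rule L2_set_mult_ineq)
    also have "\<dots> \<le> ell2_norm I \<phi> * ell2_norm I \<psi>"
      using assms F by (intro mult_mono ell2_L2_set_le) auto
    finally show ?thesis .
  qed
  show sm: "(\<lambda>i. cmod (\<phi> i * cnj (\<psi> i))) summable_on I"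
    by (rule nonneg_bdd_above_summable_on)
      (auto intro!: bdd_aboveI[of _ "ell2_norm I \<phi> * ell2_norm I \<psi>"] *)
  have "cmod (ell2_inner I \<phi> \<psi>) \<le> (\<Sum>\<^sub>\<infinity>i\<in>I. cmod (\<phi> i * cnj (\<psi> i)))"
    unfolding ell2_inner_def by (rule norm_infsum_bound[OF sm])
  also have "\<dots> \<le> ell2_norm I \<phi> * ell2_norm I \<psi>"
    by (rule infsum_le_finite_sums[OF sm *])
  finally show "cmod (ell2_inner I \<phi> \<psi>) \<le> ell2_norm I \<phi> * ell2_norm I \<psi>" .
qed

lemmas ell2_Cauchy_Schwarz = ell2_inner_abs_summable(2)

lemma ell2_inner_summable:
  assumes "\<phi> \<in> ell2 I" "\<psi> \<in> ell2 I"
  shows "(\<lambda>i. \<phi> i * cnj (\<psi> i)) summable_on I"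
  using ell2_inner_abs_summable(1)[OF assms] by (rule abs_summable_summable)

lemma ell2_inner_add_left:
  assumes "\<phi> \<in> ell2 I" "\<psi> \<in> ell2 I" "\<xi> \<in> ell2 I"
  shows "ell2_inner I (\<lambda>i. \<phi> i + \<psi> i) \<xi> = ell2_inner I \<phi> \<xi> + ell2_inner I \<psi> \<xi>"
  unfolding ell2_inner_def distrib_right
  by (intro infsum_add ell2_inner_summable assms)

lemma ell2_inner_scale_left: "ell2_inner I (\<lambda>i. c * \<phi> i) \<xi> = c * ell2_inner I \<phi> \<xi>"
  unfolding ell2_inner_def mult.assoc by (rule infsum_cmult_right')

lemma ell2_inner_commute: "ell2_inner I \<phi> \<psi> = cnj (ell2_inner I \<psi> \<phi>)"
  by (simp only: ell2_inner_def infsum_cnj[symmetric] complex_cnj_mult complex_cnj_cnj mult.commute)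

lemma ell2_inner_add_right:
  assumes "\<phi> \<in> ell2 I" "\<psi> \<in> ell2 I" "\<xi> \<in> ell2 I"
  shows "ell2_inner I \<xi> (\<lambda>i. \<phi> i + \<psi> i) = ell2_inner I \<xi> \<phi> + ell2_inner I \<xi> \<psi>"
  unfolding ell2_inner_commute[of I \<xi>] ell2_inner_add_left[OF assms] by simp

lemma ell2_inner_scale_right: "ell2_inner I \<xi> (\<lambda>i. c * \<phi> i) = cnj c * ell2_inner I \<xi> \<phi>"
  unfolding ell2_inner_commute[of I \<xi>] ell2_inner_scale_left by simp

lemma ell2_inner_zero_left [simp]: "ell2_inner I (\<lambda>i. 0) \<psi> = 0"
  by (simp add: ell2_inner_def)

lemma ell2_inner_diff_left:
  assumes "\<phi> \<in> ell2 I" "\<psi> \<in> ell2 I" "\<xi> \<in> ell2 I"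
  shows "ell2_inner I (\<lambda>i. \<phi> i - \<psi> i) \<xi> = ell2_inner I \<phi> \<xi> - ell2_inner I \<psi> \<xi>"
  using ell2_inner_add_left[OF assms(1) ell2_scale_mem[OF assms(2), of "-1"] assms(3)]
    ell2_inner_scale_left[of I "-1" \<psi> \<xi>] by simp

lemma ell2_inner_diff_right:
  assumes "\<phi> \<in> ell2 I" "\<psi> \<in> ell2 I" "\<xi> \<in> ell2 I"
  shows "ell2_inner I \<xi> (\<lambda>i. \<phi> i - \<psi> i) = ell2_inner I \<xi> \<phi> - ell2_inner I \<xi> \<psi>"
  unfolding ell2_inner_commute[of I \<xi>] ell2_inner_diff_left[OF assms] by simp

lemma ell2_inner_sum_left:
  assumes "\<And>a. a \<in> A \<Longrightarrow> \<phi> a \<in> ell2 I" "\<xi> \<in> ell2 I"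
  shows "ell2_inner I (\<lambda>i. \<Sum>a\<in>A. \<phi> a i) \<xi> = (\<Sum>a\<in>A. ell2_inner I (\<phi> a) \<xi>)"
  using assms
proof (induction A rule: infinite_finite_induct)
  case (insert x F)
  then show ?case
    using ell2_inner_add_left[of "\<phi> x" I "\<lambda>i. \<Sum>a\<in>F. \<phi> a i" \<xi>] by (simp add: ell2_sum_mem)
qed auto

lemma ell2_inner_self:
  assumes "\<phi> \<in> ell2 I"
  shows "ell2_inner I \<phi> \<phi> = complex_of_real ((ell2_norm I \<phi>)\<^sup>2)"
proof -
  have "((\<lambda>i. (cmod (\<phi> i))\<^sup>2) has_sum (ell2_norm I \<phi>)\<^sup>2) I"
    unfolding ell2_norm_sq using assms by (intro has_sum_infsum) (simp add: ell2_def)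
  then have "((\<lambda>i. complex_of_real ((cmod (\<phi> i))\<^sup>2)) has_sum complex_of_real ((ell2_norm I \<phi>)\<^sup>2)) I"
    by (rule has_sum_bounded_linear[OF bounded_linear_of_real])
  then show ?thesis
    unfolding ell2_inner_def complex_norm_square by (rule infsumI)
qed

lemma ell2_eqI_inner:
  assumes "\<phi> \<in> ell2 I" "\<psi> \<in> ell2 I" "\<And>\<xi>. \<xi> \<in> ell2 I \<Longrightarrow> ell2_inner I \<xi> \<phi> = ell2_inner I \<xi> \<psi>"
  shows "\<phi> = \<psi>"
proof -
  let ?d = "\<lambda>i. \<phi> i - \<psi> i"
  have d: "?d \<in> ell2 I" by (rule ell2_diff_mem[OF assms(1,2)])
  have "ell2_inner I ?d ?d = 0"
    using ell2_inner_diff_right[OF assms(1,2) d] assms(3)[OF d] by simp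
  then have "?d = (\<lambda>i. 0)" by (intro ell2_norm_eq_0[OF d]) (simp add: ell2_inner_self[OF d])
  then show ?thesis by (simp add: fun_eq_iff)
qed

definition ell2_unit :: "'i \<Rightarrow> 'i \<Rightarrow> complex" where
  "ell2_unit i = (\<lambda>j. if j = i then 1 else 0)"

lemma ell2_unit_mem:
  assumes "i \<in> I" shows "ell2_unit i \<in> ell2 I"
proof -
  have "(\<lambda>j. (cmod (ell2_unit i j))\<^sup>2) summable_on {i} \<longleftrightarrow> (\<lambda>j. (cmod (ell2_unit i j))\<^sup>2) summable_on I"
    using assms by (intro summable_on_cong_neutral) (auto simp: ell2_unit_def)
  then show ?thesis using assms by (auto simp: ell2_def ell2_unit_def)
qed

lemma ell2_norm_unit:
  assumes "i \<in> I" shows "ell2_norm I (ell2_unit i) = 1"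
proof -
  have "(ell2_norm I (ell2_unit i))\<^sup>2 = (\<Sum>\<^sub>\<infinity>j\<in>{i}. 1)"
    unfolding ell2_norm_sq
    using assms by (intro infsum_cong_neutral) (auto simp: ell2_unit_def)
  then have "(ell2_norm I (ell2_unit i))\<^sup>2 = 1" by simp
  then show ?thesis
    using ell2_norm_nonneg[of I "ell2_unit i"] by (simp add: power2_eq_1_iff)
qed

section \<open>Bounded operators\<close>

text \<open>The predicate applies to arbitrary functions and includes invariance of
  \<open>ell2 I\<close>, so it covers differences and composites that are not extensional. The
  clause \<open>0 \<le> C\<close> keeps the set of bounds bounded below even when
  \<open>ell2 I\<close> contains only zero.\<close>

definition op_bound :: "'i set \<Rightarrow> (('i \<Rightarrow> complex) \<Rightarrow> 'i \<Rightarrow> complex) \<Rightarrow> real \<Rightarrow> bool" where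
  "op_bound I T C \<longleftrightarrow> 0 \<le> C \<and> (\<forall>\<phi>\<in>ell2 I. T \<phi> \<in> ell2 I \<and> ell2_norm I (T \<phi>) \<le> C * ell2_norm I \<phi>)"

definition op_norm :: "'i set \<Rightarrow> (('i \<Rightarrow> complex) \<Rightarrow> 'i \<Rightarrow> complex) \<Rightarrow> real" where
  "op_norm I T = Inf {C. op_bound I T C}"

lemma op_boundI:
  "0 \<le> C \<Longrightarrow> (\<And>\<phi>. \<phi> \<in> ell2 I \<Longrightarrow> T \<phi> \<in> ell2 I) \<Longrightarrow>
   (\<And>\<phi>. \<phi> \<in> ell2 I \<Longrightarrow> ell2_norm I (T \<phi>) \<le> C * ell2_norm I \<phi>) \<Longrightarrow> op_bound I T C"
  by (simp add: op_bound_def)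

lemma op_boundD:
  assumes "op_bound I T C"
  shows op_bound_nonneg: "0 \<le> C"
    and op_bound_mem: "\<And>\<phi>. \<phi> \<in> ell2 I \<Longrightarrow> T \<phi> \<in> ell2 I"
    and op_bound_le: "\<And>\<phi>. \<phi> \<in> ell2 I \<Longrightarrow> ell2_norm I (T \<phi>) \<le> C * ell2_norm I \<phi>"
  using assms by (auto simp: op_bound_def)

lemma op_norm_le: "op_bound I T C \<Longrightarrow> op_norm I T \<le> C"
  unfolding op_norm_def by (intro cInf_lower bdd_belowI[of _ 0]) (auto simp: op_bound_def)

text \<open>The infimum is attained: for each vector of nonzero norm the inequality is a lower bound
  on the admissible constants. The given bound makes the set of constants nonempty.\<close>

lemma op_bound_op_norm:
  assumes "op_bound I T C" shows "op_bound I T (op_norm I T)"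
proof (rule op_boundI)
  show "0 \<le> op_norm I T"
    unfolding op_norm_def using assms by (intro cInf_greatest) (auto simp: op_bound_def)
  fix \<phi> assume \<phi>: "\<phi> \<in> ell2 I"
  then show mem: "T \<phi> \<in> ell2 I" using assms by (rule op_bound_mem[rotated])
  show "ell2_norm I (T \<phi>) \<le> op_norm I T * ell2_norm I \<phi>"
  proof (cases "ell2_norm I \<phi> = 0")
    case True
    then show ?thesis using op_bound_le[OF assms \<phi>] by simp
  next
    case False
    then have pos: "0 < ell2_norm I \<phi>" using ell2_norm_nonneg[of I \<phi>] by linarith
    have "ell2_norm I (T \<phi>) / ell2_norm I \<phi> \<le> op_norm I T"
      unfolding op_norm_def
    proof (rule cInf_greatest)
      fix D assume "D \<in> {C. op_bound I T C}"
      then show "ell2_norm I (T \<phi>) / ell2_norm I \<phi> \<le> D"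
        using op_bound_le[of I T D \<phi>] \<phi> pos by (simp add: divide_le_eq)
    qed (use assms in blast)
    then show ?thesis using pos by (simp add: divide_le_eq)
  qed
qed

lemma op_bound_cong:
  assumes "op_bound I T C" "\<And>\<phi>. \<phi> \<in> ell2 I \<Longrightarrow> T \<phi> = S \<phi>"
  shows "op_bound I S C"
  using assms by (auto simp: op_bound_def)

lemma op_norm_cong:
  assumes "\<And>\<phi>. \<phi> \<in> ell2 I \<Longrightarrow> T \<phi> = S \<phi>"
  shows "op_norm I T = op_norm I S"
  unfolding op_norm_def op_bound_def using assms by simp

lemma op_bound_add:
  assumes "op_bound I S C" "op_bound I T D"
  shows "op_bound I (\<lambda>\<phi> i. S \<phi> i + T \<phi> i) (C + D)"
proof (rule op_boundI)
  show "0 \<le> C + D" using assms by (simp add: op_bound_def)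
  fix \<phi> assume \<phi>: "\<phi> \<in> ell2 I"
  have S: "S \<phi> \<in> ell2 I" and T: "T \<phi> \<in> ell2 I" using assms \<phi> by (auto dest: op_bound_mem)
  show "(\<lambda>i. S \<phi> i + T \<phi> i) \<in> ell2 I" by (rule ell2_add_mem[OF S T])
  show "ell2_norm I (\<lambda>i. S \<phi> i + T \<phi> i) \<le> (C + D) * ell2_norm I \<phi>"
    using ell2_norm_triangle[OF S T] op_bound_le[OF assms(1) \<phi>] op_bound_le[OF assms(2) \<phi>]
    by (simp add: algebra_simps)
qed

lemma op_bound_scale:
  assumes "op_bound I T D"
  shows "op_bound I (\<lambda>\<phi> i. c * T \<phi> i) (cmod c * D)"
  using assms
  by (auto simp: op_bound_def ell2_scale_mem ell2_norm_scale mult.assoc intro!: mult_left_mono)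

lemma op_bound_comp:
  assumes "op_bound I S C" "op_bound I T D"
  shows "op_bound I (\<lambda>\<phi>. S (T \<phi>)) (C * D)"
proof (rule op_boundI)
  show "0 \<le> C * D" using assms by (simp add: op_bound_def)
  fix \<phi> assume \<phi>: "\<phi> \<in> ell2 I"
  have T: "T \<phi> \<in> ell2 I" using assms \<phi> by (auto dest: op_bound_mem)
  then show "S (T \<phi>) \<in> ell2 I" using assms by (auto dest: op_bound_mem)
  have "ell2_norm I (S (T \<phi>)) \<le> C * ell2_norm I (T \<phi>)" by (rule op_bound_le[OF assms(1) T])
  also have "\<dots> \<le> C * (D * ell2_norm I \<phi>)"
    using assms \<phi> by (intro mult_left_mono) (auto simp: op_bound_def)
  finally show "ell2_norm I (S (T \<phi>)) \<le> C * D * ell2_norm I \<phi>" by simp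
qed

text \<open>The adjoint is a parameter rather than \<open>hilbert_adjoint\<close>, so that the
  representation of a formal adjoint can take its place. Cauchy-Schwarz on the inner product of
  \<open>T (S \<psi>)\<close> with \<open>\<psi>\<close> bounds \<open>S\<close> by the norm of
  \<open>T\<close>; on that of \<open>\<phi>\<close> with \<open>S (T \<phi>)\<close> it bounds the
  square of the norm of \<open>T\<close>.\<close>

lemma op_norm_cstar:
  assumes T: "op_bound I T C" and S: "op_bound I S D"
    and adj: "\<And>\<phi> \<psi>. \<phi> \<in> ell2 I \<Longrightarrow> \<psi> \<in> ell2 I \<Longrightarrow> ell2_inner I (T \<phi>) \<psi> = ell2_inner I \<phi> (S \<psi>)"
  shows "op_norm I (\<lambda>\<phi>. S (T \<phi>)) = (op_norm I T)\<^sup>2"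
proof (rule antisym)
  note Tn = op_bound_op_norm[OF T]
  have Sn: "op_bound I S (op_norm I T)"
  proof (rule op_boundI)
    show "0 \<le> op_norm I T" using Tn by (rule op_bound_nonneg)
    fix \<psi> assume \<psi>: "\<psi> \<in> ell2 I"
    show mem: "S \<psi> \<in> ell2 I" using S \<psi> by (rule op_bound_mem)
    have "(ell2_norm I (S \<psi>))\<^sup>2 = cmod (ell2_inner I (T (S \<psi>)) \<psi>)"
      using adj[OF mem \<psi>] ell2_inner_self[OF mem] by (simp add: norm_power)
    also have "\<dots> \<le> ell2_norm I (T (S \<psi>)) * ell2_norm I \<psi>"
      by (rule ell2_Cauchy_Schwarz[OF op_bound_mem[OF T mem] \<psi>])
    also have "\<dots> \<le> op_norm I T * ell2_norm I (S \<psi>) * ell2_norm I \<psi>"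
      by (intro mult_right_mono op_bound_le[OF Tn mem]) simp
    finally have "ell2_norm I (S \<psi>) * ell2_norm I (S \<psi>)
        \<le> ell2_norm I (S \<psi>) * (op_norm I T * ell2_norm I \<psi>)"
      by (simp add: power2_eq_square mult_ac)
    then show "ell2_norm I (S \<psi>) \<le> op_norm I T * ell2_norm I \<psi>"
      using ell2_norm_nonneg[of I "S \<psi>"] ell2_norm_nonneg[of I "\<psi>"] op_bound_nonneg[OF Tn]
      by (cases "ell2_norm I (S \<psi>) = 0") (auto simp: mult_le_cancel_left)
  qed
  show "op_norm I (\<lambda>\<phi>. S (T \<phi>)) \<le> (op_norm I T)\<^sup>2"
    using op_norm_le[OF op_bound_comp[OF Sn Tn]] by (simp add: power2_eq_square)
  note STn = op_bound_op_norm[OF op_bound_comp[OF Sn Tn]]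
  define k where "k = op_norm I (\<lambda>\<phi>. S (T \<phi>))"
  have k: "0 \<le> k" unfolding k_def by (rule op_bound_nonneg[OF STn])
  have "op_bound I T (sqrt k)"
  proof (rule op_boundI)
    show "0 \<le> sqrt k" using k by simp
    fix \<phi> assume \<phi>: "\<phi> \<in> ell2 I"
    show mem: "T \<phi> \<in> ell2 I" using T \<phi> by (rule op_bound_mem)
    have "(ell2_norm I (T \<phi>))\<^sup>2 = cmod (ell2_inner I \<phi> (S (T \<phi>)))"
      using adj[OF \<phi> mem, symmetric] ell2_inner_self[OF mem] by (simp add: norm_power)
    also have "\<dots> \<le> ell2_norm I \<phi> * ell2_norm I (S (T \<phi>))"
      by (rule ell2_Cauchy_Schwarz[OF \<phi> op_bound_mem[OF S mem]])
    also have "\<dots> \<le> ell2_norm I \<phi> * (k * ell2_norm I \<phi>)"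
      unfolding k_def by (intro mult_left_mono op_bound_le[OF STn \<phi>]) simp
    also have "\<dots> = (sqrt k * ell2_norm I \<phi>)\<^sup>2"
      using k by (simp add: power2_eq_square)
    finally show "ell2_norm I (T \<phi>) \<le> sqrt k * ell2_norm I \<phi>"
      by (rule power2_le_imp_le) (use k in simp)
  qed
  from op_norm_le[OF this] have "(op_norm I T)\<^sup>2 \<le> (sqrt k)\<^sup>2"
    by (rule power_mono) (rule op_bound_nonneg[OF Tn])
  then show "(op_norm I T)\<^sup>2 \<le> op_norm I (\<lambda>\<phi>. S (T \<phi>))" using k by (simp add: k_def)
qed

section \<open>Bounded linear operators and their adjoints\<close>

lemma bounded_ops_bound:
  assumes "T \<in> bounded_ops I" obtains C where "op_bound I T C"
proof -
  from assms obtain C where C: "\<forall>\<phi>\<in>ell2 I. ell2_norm I (T \<phi>) \<le> C * ell2_norm I \<phi>"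
    and m: "T \<in> ell2 I \<rightarrow>\<^sub>E ell2 I"
    by (auto simp: bounded_ops_def)
  have "op_bound I T \<bar>C\<bar>"
  proof (rule op_boundI)
    fix \<phi> assume \<phi>: "\<phi> \<in> ell2 I"
    then show "T \<phi> \<in> ell2 I" using m by auto
    have "ell2_norm I (T \<phi>) \<le> C * ell2_norm I \<phi>" using C \<phi> by simp
    also have "\<dots> \<le> \<bar>C\<bar> * ell2_norm I \<phi>" by (intro mult_right_mono) auto
    finally show "ell2_norm I (T \<phi>) \<le> \<bar>C\<bar> * ell2_norm I \<phi>" .
  qed simp
  then show thesis by (rule that)
qed

lemma bounded_opsD:
  assumes "T \<in> bounded_ops I"
  shows bounded_ops_mem: "\<And>\<phi>. \<phi> \<in> ell2 I \<Longrightarrow> T \<phi> \<in> ell2 I"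
    and bounded_ops_add: "\<And>\<phi> \<psi>. \<phi> \<in> ell2 I \<Longrightarrow> \<psi> \<in> ell2 I \<Longrightarrow> T (\<lambda>i. \<phi> i + \<psi> i) = (\<lambda>i. T \<phi> i + T \<psi> i)"
    and bounded_ops_scale: "\<And>\<phi> c. \<phi> \<in> ell2 I \<Longrightarrow> T (\<lambda>i. c * \<phi> i) = (\<lambda>i. c * T \<phi> i)"
    and bounded_ops_ext: "T \<in> extensional (ell2 I)"
  using assms unfolding bounded_ops_def by (auto simp: PiE_def)

lemma bounded_ops_diff:
  assumes "T \<in> bounded_ops I" "\<phi> \<in> ell2 I" "\<psi> \<in> ell2 I"
  shows "T (\<lambda>i. \<phi> i - \<psi> i) = (\<lambda>i. T \<phi> i - T \<psi> i)"
  using bounded_ops_add[OF assms(1,2) ell2_scale_mem[OF assms(3), of "-1"]]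
    bounded_ops_scale[OF assms(1,3), of "-1"] by simp

lemma bounded_ops_zero:
  assumes "T \<in> bounded_ops I" shows "T (\<lambda>i. 0) = (\<lambda>i. 0)"
  using bounded_ops_scale[OF assms ell2_zero_mem, of 0] by simp

lemma bounded_ops_sum:
  assumes "T \<in> bounded_ops I" "\<And>a. a \<in> A \<Longrightarrow> \<phi> a \<in> ell2 I"
  shows "T (\<lambda>i. \<Sum>a\<in>A. \<phi> a i) = (\<lambda>i. \<Sum>a\<in>A. T (\<phi> a) i)"
  using assms(2)
proof (induction A rule: infinite_finite_induct)
  case (insert x F)
  then show ?case
    using bounded_ops_add[OF assms(1), of "\<phi> x" "\<lambda>i. \<Sum>a\<in>F. \<phi> a i"] by (simp add: ell2_sum_mem)
qed (auto simp: bounded_ops_zero[OF assms(1)])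

lemma bounded_opsI:
  assumes "op_bound I T C" "T \<in> extensional (ell2 I)"
    and "\<And>\<phi> \<psi>. \<phi> \<in> ell2 I \<Longrightarrow> \<psi> \<in> ell2 I \<Longrightarrow> T (\<lambda>i. \<phi> i + \<psi> i) = (\<lambda>i. T \<phi> i + T \<psi> i)"
    and "\<And>\<phi> c. \<phi> \<in> ell2 I \<Longrightarrow> T (\<lambda>i. c * \<phi> i) = (\<lambda>i. c * T \<phi> i)"
  shows "T \<in> bounded_ops I"
  unfolding bounded_ops_def using assms by (auto simp: PiE_def op_bound_def)

lemma bounded_ops_eqI:
  assumes "S \<in> bounded_ops I" "T \<in> bounded_ops I" "\<And>\<phi>. \<phi> \<in> ell2 I \<Longrightarrow> S \<phi> = T \<phi>"
  shows "S = T"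
  using bounded_ops_ext[OF assms(1)] bounded_ops_ext[OF assms(2)] assms(3) by (rule extensionalityI)

text \<open>The adjoint is written down by its matrix: coordinate \<open>i\<close> of the image of a
  vector is its inner product with \<open>T (ell2_unit i)\<close>. What remains is that these
  coordinates are square summable and that the adjoint identity passes from truncated vectors to all
  vectors.\<close>

lemma bounded_op_adjoint_exists:
  assumes T: "T \<in> bounded_ops I"
  obtains S where "S \<in> bounded_ops I"
    "\<And>\<phi> \<psi>. \<phi> \<in> ell2 I \<Longrightarrow> \<psi> \<in> ell2 I \<Longrightarrow> ell2_inner I (T \<phi>) \<psi> = ell2_inner I \<phi> (S \<psi>)"
proof -
  obtain C where C: "op_bound I T C" using bounded_ops_bound[OF T] .
  define S0 where "S0 = (\<lambda>\<psi> i. if i \<in> I then ell2_inner I \<psi> (T (ell2_unit i)) else 0)"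
  define cut where "cut = (\<lambda>(\<phi>::'a \<Rightarrow> complex) F i. \<Sum>j\<in>F. \<phi> j * ell2_unit j i)"
  have cut_mem: "cut \<phi> F \<in> ell2 I" if "F \<subseteq> I" for \<phi> F
    unfolding cut_def using that by (intro ell2_sum_mem ell2_scale_mem ell2_unit_mem) auto
  have cut_eq: "cut \<phi> F i = (if i \<in> F then \<phi> i else 0)" if "finite F" for \<phi> F i
    unfolding cut_def ell2_unit_def using that by (simp add: if_distrib cong: if_cong)
  have inner_cut: "ell2_inner I (T (cut \<phi> F)) \<psi> = (\<Sum>j\<in>F. \<phi> j * cnj (S0 \<psi> j))"
    if F: "F \<subseteq> I" and \<psi>: "\<psi> \<in> ell2 I" for \<phi> \<psi> F
  proof -
    have "T (cut \<phi> F) = (\<lambda>i. \<Sum>j\<in>F. T (\<lambda>i. \<phi> j * ell2_unit j i) i)"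
      unfolding cut_def using F by (intro bounded_ops_sum[OF T] ell2_scale_mem ell2_unit_mem) auto
    also have "\<dots> = (\<lambda>i. \<Sum>j\<in>F. \<phi> j * T (ell2_unit j) i)"
      using F by (intro ext sum.cong) (auto simp: bounded_ops_scale[OF T] ell2_unit_mem)
    finally have "ell2_inner I (T (cut \<phi> F)) \<psi> = (\<Sum>j\<in>F. ell2_inner I (\<lambda>i. \<phi> j * T (ell2_unit j) i) \<psi>)"
      using F \<psi> by (auto intro!: ell2_inner_sum_left ell2_scale_mem bounded_ops_mem[OF T] ell2_unit_mem)
    also have "\<dots> = (\<Sum>j\<in>F. \<phi> j * cnj (S0 \<psi> j))"
      using F by (intro sum.cong)
        (auto simp: ell2_inner_scale_left S0_def simp flip: ell2_inner_commute)
    finally show ?thesis .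
  qed
  \<comment> \<open>Test \<open>T\<close> on the truncation of \<open>S0 \<psi>\<close> itself: the
    inner product becomes the square of the partial norm \<open>a\<close>, and one factor
    \<open>a\<close> cancels against Cauchy-Schwarz.\<close>
  have fin: "L2_set (\<lambda>i. cmod (S0 \<psi> i)) F \<le> C * ell2_norm I \<psi>"
    if F: "finite F" "F \<subseteq> I" and \<psi>: "\<psi> \<in> ell2 I" for \<psi> F
  proof -
    define a where "a = L2_set (\<lambda>i. cmod (S0 \<psi> i)) F"
    have a0: "0 \<le> a" by (simp add: a_def)
    have a2: "a\<^sup>2 = (\<Sum>j\<in>F. (cmod (S0 \<psi> j))\<^sup>2)" by (simp add: a_def L2_set_def sum_nonneg)
    have "(ell2_norm I (cut (S0 \<psi>) F))\<^sup>2 = (\<Sum>\<^sub>\<infinity>j\<in>F. (cmod (S0 \<psi> j))\<^sup>2)"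
      unfolding ell2_norm_sq using F by (intro infsum_cong_neutral) (auto simp: cut_eq)
    also have "\<dots> = a\<^sup>2" using F a2 by simp
    finally have na: "ell2_norm I (cut (S0 \<psi>) F) = a"
      using a0 by (simp add: power2_eq_iff_nonneg)
    have "complex_of_real (a\<^sup>2) = ell2_inner I (T (cut (S0 \<psi>) F)) \<psi>"
      unfolding inner_cut[OF F(2) \<psi>] a2 by (simp add: complex_norm_square del: of_real_power)
    then have "a\<^sup>2 = cmod (ell2_inner I (T (cut (S0 \<psi>) F)) \<psi>)"
      by (metis norm_of_real abs_of_nonneg zero_le_power2)
    also have "\<dots> \<le> ell2_norm I (T (cut (S0 \<psi>) F)) * ell2_norm I \<psi>"
      by (intro ell2_Cauchy_Schwarz bounded_ops_mem[OF T] cut_mem F \<psi>)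
    also have "\<dots> \<le> C * a * ell2_norm I \<psi>"
      using op_bound_le[OF C cut_mem[OF F(2)]] na by (metis ell2_norm_nonneg mult_right_mono)
    finally have "a * a \<le> a * (C * ell2_norm I \<psi>)" by (simp add: power2_eq_square mult_ac)
    then show ?thesis
      using a0 op_bound_nonneg[OF C] ell2_norm_nonneg[of I \<psi>] unfolding a_def[symmetric]
      by (cases "a = 0") (auto simp: mult_le_cancel_left)
  qed
  have S0b: "op_bound I S0 C"
  proof (rule op_boundI)
    fix \<psi> assume \<psi>: "\<psi> \<in> ell2 I"
    have 0: "0 \<le> C * ell2_norm I \<psi>" using op_bound_nonneg[OF C] by simp
    show "S0 \<psi> \<in> ell2 I" by (rule ell2_memI_mem[OF _ 0 fin]) (auto simp: S0_def \<psi>)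
    show "ell2_norm I (S0 \<psi>) \<le> C * ell2_norm I \<psi>"
      by (rule ell2_norm_leI[OF _ 0 fin]) (auto simp: S0_def \<psi>)
  qed (rule op_bound_nonneg[OF C])
  have adj: "ell2_inner I (T \<phi>) \<psi> = ell2_inner I \<phi> (S0 \<psi>)"
    if \<phi>: "\<phi> \<in> ell2 I" and \<psi>: "\<psi> \<in> ell2 I" for \<phi> \<psi>
  proof (rule tendsto_unique)
    let ?f = "\<lambda>F. \<Sum>j\<in>F. \<phi> j * cnj (S0 \<psi> j)"
    show "finite_subsets_at_top I \<noteq> bot" by simp
    show "(?f \<longlongrightarrow> ell2_inner I \<phi> (S0 \<psi>)) (finite_subsets_at_top I)"
      unfolding ell2_inner_def
      by (intro infsum_tendsto ell2_inner_summable \<phi> op_bound_mem[OF S0b] \<psi>)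
    \<comment> \<open>The square of the norm of the tail outside \<open>F\<close> is the total minus
      the finite part; it controls the error made by truncating \<open>\<phi>\<close> to
      \<open>F\<close>.\<close>
    have "((\<lambda>F. \<Sum>j\<in>F. (cmod (\<phi> j))\<^sup>2) \<longlongrightarrow> (ell2_norm I \<phi>)\<^sup>2) (finite_subsets_at_top I)"
      unfolding ell2_norm_sq using \<phi> by (intro infsum_tendsto) (auto simp: ell2_def)
    then have "((\<lambda>F. C * sqrt ((ell2_norm I \<phi>)\<^sup>2 - (\<Sum>j\<in>F. (cmod (\<phi> j))\<^sup>2)) * ell2_norm I \<psi>)
        \<longlongrightarrow> C * sqrt ((ell2_norm I \<phi>)\<^sup>2 - (ell2_norm I \<phi>)\<^sup>2) * ell2_norm I \<psi>) (finite_subsets_at_top I)"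
      by (intro tendsto_intros)
    then have null: "((\<lambda>F. C * sqrt ((ell2_norm I \<phi>)\<^sup>2 - (\<Sum>j\<in>F. (cmod (\<phi> j))\<^sup>2)) * ell2_norm I \<psi>)
        \<longlongrightarrow> 0) (finite_subsets_at_top I)" by simp
    have "((\<lambda>F. ?f F - ell2_inner I (T \<phi>) \<psi>) \<longlongrightarrow> 0) (finite_subsets_at_top I)"
    proof (rule Lim_null_comparison[OF _ null], rule eventually_finite_subsets_at_top_weakI)
      fix F assume F: "finite F" "F \<subseteq> I"
      let ?d = "\<lambda>i. \<phi> i - cut \<phi> F i"
      have d: "?d \<in> ell2 I" by (rule ell2_diff_mem[OF \<phi> cut_mem[OF F(2)]])
      have sm: "(\<lambda>i. (cmod (\<phi> i))\<^sup>2) summable_on I" using \<phi> by (simp add: ell2_def)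
      have "(ell2_norm I ?d)\<^sup>2 = (\<Sum>\<^sub>\<infinity>i\<in>I-F. (cmod (\<phi> i))\<^sup>2)"
        unfolding ell2_norm_sq using F by (intro infsum_cong_neutral) (auto simp: cut_eq)
      also have "\<dots> = (ell2_norm I \<phi>)\<^sup>2 - (\<Sum>j\<in>F. (cmod (\<phi> j))\<^sup>2)"
        unfolding ell2_norm_sq using F sm by (subst infsum_Diff) auto
      finally have nd: "ell2_norm I ?d = sqrt ((ell2_norm I \<phi>)\<^sup>2 - (\<Sum>j\<in>F. (cmod (\<phi> j))\<^sup>2))"
        by (metis real_sqrt_unique ell2_norm_nonneg)
      have "?f F - ell2_inner I (T \<phi>) \<psi> = - ell2_inner I (T ?d) \<psi>"
        unfolding bounded_ops_diff[OF T \<phi> cut_mem[OF F(2)]] inner_cut[OF F(2) \<psi>, symmetric]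
        by (subst ell2_inner_diff_left) (auto intro!: bounded_ops_mem[OF T] \<phi> \<psi> cut_mem F)
      then have "norm (?f F - ell2_inner I (T \<phi>) \<psi>) \<le> ell2_norm I (T ?d) * ell2_norm I \<psi>"
        using ell2_Cauchy_Schwarz[OF bounded_ops_mem[OF T d] \<psi>] by simp
      also have "\<dots> \<le> C * ell2_norm I ?d * ell2_norm I \<psi>"
        by (intro mult_right_mono op_bound_le[OF C d]) simp
      finally show "norm (?f F - ell2_inner I (T \<phi>) \<psi>)
          \<le> C * sqrt ((ell2_norm I \<phi>)\<^sup>2 - (\<Sum>j\<in>F. (cmod (\<phi> j))\<^sup>2)) * ell2_norm I \<psi>"
        unfolding nd .
    qed
    then show "(?f \<longlongrightarrow> ell2_inner I (T \<phi>) \<psi>) (finite_subsets_at_top I)" by (rule LIM_zero_cancel)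
  qed
  define S where "S = restrict S0 (ell2 I)"
  have "S \<in> bounded_ops I"
  proof (rule bounded_opsI)
    show "op_bound I S C" using S0b by (rule op_bound_cong) (simp add: S_def)
    show "S \<in> extensional (ell2 I)" by (simp add: S_def)
    show "S (\<lambda>i. \<phi> i + \<psi> i) = (\<lambda>i. S \<phi> i + S \<psi> i)" if "\<phi> \<in> ell2 I" "\<psi> \<in> ell2 I" for \<phi> \<psi>
      using that by (auto simp: S_def S0_def ell2_add_mem ell2_inner_add_left bounded_ops_mem[OF T] ell2_unit_mem)
    show "S (\<lambda>i. c * \<phi> i) = (\<lambda>i. c * S \<phi> i)" if "\<phi> \<in> ell2 I" for \<phi> c
      using that by (auto simp: S_def S0_def ell2_scale_mem ell2_inner_scale_left)
  qed
  then show thesis by (rule that) (simp add: adj S_def)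
qed

text \<open>The definite description denotes because inner products with all of
  \<open>ell2 I\<close> separate vectors, so at most one bounded operator satisfies the adjoint
  identity.\<close>

lemma hilbert_adjoint_eqI:
  assumes S: "S \<in> bounded_ops I"
    and adj: "\<And>\<phi> \<psi>. \<phi> \<in> ell2 I \<Longrightarrow> \<psi> \<in> ell2 I \<Longrightarrow> ell2_inner I (T \<phi>) \<psi> = ell2_inner I \<phi> (S \<psi>)"
  shows "hilbert_adjoint I T = S"
  unfolding hilbert_adjoint_def
proof (rule the_equality)
  fix S' assume S': "S' \<in> bounded_ops I \<and>
    (\<forall>\<phi>\<in>ell2 I. \<forall>\<psi>\<in>ell2 I. ell2_inner I (T \<phi>) \<psi> = ell2_inner I \<phi> (S' \<psi>))"
  show "S' = S"
  proof (rule bounded_ops_eqI[OF _ S])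
    fix \<psi> assume \<psi>: "\<psi> \<in> ell2 I"
    show "S' \<psi> = S \<psi>"
    proof (rule ell2_eqI_inner[of _ I])
      show "S' \<psi> \<in> ell2 I" "S \<psi> \<in> ell2 I" using S S' \<psi> by (auto intro: bounded_ops_mem)
      show "ell2_inner I \<xi> (S' \<psi>) = ell2_inner I \<xi> (S \<psi>)" if "\<xi> \<in> ell2 I" for \<xi>
        using S' adj[OF that \<psi>] that \<psi> by simp
    qed
  qed (use S' in simp)
qed (use assms in auto)

lemma hilbert_adjoint:
  assumes "T \<in> bounded_ops I" "\<phi> \<in> ell2 I" "\<psi> \<in> ell2 I"
  shows "ell2_inner I (T \<phi>) \<psi> = ell2_inner I \<phi> (hilbert_adjoint I T \<psi>)"
proof -
  obtain S where "S \<in> bounded_ops I"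
    "\<And>\<phi> \<psi>. \<phi> \<in> ell2 I \<Longrightarrow> \<psi> \<in> ell2 I \<Longrightarrow> ell2_inner I (T \<phi>) \<psi> = ell2_inner I \<phi> (S \<psi>)"
    using bounded_op_adjoint_exists[OF assms(1)] by blast
  with hilbert_adjoint_eqI[OF this] assms show ?thesis by simp
qed

text \<open>Norm convergence is expressed through bounds on pointwise differences, since these need
  not be extensional and so need not lie in \<open>bounded_ops I\<close>.\<close>

definition op_lim ::
    "'i set \<Rightarrow> (nat \<Rightarrow> ('i \<Rightarrow> complex) \<Rightarrow> 'i \<Rightarrow> complex) \<Rightarrow> (('i \<Rightarrow> complex) \<Rightarrow> 'i \<Rightarrow> complex) \<Rightarrow> bool" where
  "op_lim I T S \<longleftrightarrow> (\<forall>e>0. \<exists>N. \<forall>n\<ge>N. op_bound I (\<lambda>\<phi> i. T n \<phi> i - S \<phi> i) e)"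

text \<open>Joint continuity of evaluation covers the limits of products as well.\<close>

lemma op_lim_apply:
  assumes lim: "op_lim I T S" and S: "S \<in> bounded_ops I" and T: "\<And>n. T n \<in> bounded_ops I"
    and \<phi>n: "\<And>n. \<phi> n \<in> ell2 I" and \<psi>: "\<psi> \<in> ell2 I"
    and conv: "(\<lambda>n. ell2_norm I (\<lambda>i. \<phi> n i - \<psi> i)) \<longlonglongrightarrow> 0"
  shows "(\<lambda>n. ell2_norm I (\<lambda>i. T n (\<phi> n) i - S \<psi> i)) \<longlonglongrightarrow> 0"
proof (rule LIMSEQ_I)
  fix e :: real assume e: "0 < e"
  obtain C where C: "op_bound I S C" using bounded_ops_bound[OF S] .
  have C0: "0 \<le> C" by (rule op_bound_nonneg[OF C])
  \<comment> \<open>The cap 1 bounds the norms of \<open>\<phi> n\<close> by that of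
    \<open>\<psi>\<close> plus 1; the quotient then leaves at most \<open>e / 2\<close> for the two
    error terms together.\<close>
  define d where "d = min 1 (e / (2 * (C + ell2_norm I \<psi> + 2)))"
  have pos: "0 < C + ell2_norm I \<psi> + 2" using C0 ell2_norm_nonneg[of I \<psi>] by linarith
  have d: "0 < d" "d \<le> 1" using e pos by (auto simp: d_def)
  have "d \<le> e / (2 * (C + ell2_norm I \<psi> + 2))" by (simp add: d_def)
  then have "d * (2 * (C + ell2_norm I \<psi> + 2)) \<le> e" using pos by (simp add: pos_le_divide_eq)
  then have de: "d * (C + ell2_norm I \<psi> + 2) \<le> e / 2" by (simp add: algebra_simps)
  obtain N1 where N1: "\<And>n. n \<ge> N1 \<Longrightarrow> op_bound I (\<lambda>\<phi> i. T n \<phi> i - S \<phi> i) d"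
    using lim d unfolding op_lim_def by blast
  obtain N2 where N2: "\<And>n. n \<ge> N2 \<Longrightarrow> ell2_norm I (\<lambda>i. \<phi> n i - \<psi> i) < d"
    using LIMSEQ_D[OF conv d(1)] by auto
  show "\<exists>N. \<forall>n\<ge>N. norm (ell2_norm I (\<lambda>i. T n (\<phi> n) i - S \<psi> i) - 0) < e"
  proof (intro exI allI impI)
    fix n assume n: "n \<ge> max N1 N2"
    have df: "(\<lambda>i. \<phi> n i - \<psi> i) \<in> ell2 I" by (rule ell2_diff_mem[OF \<phi>n \<psi>])
    have "ell2_norm I (\<phi> n) \<le> ell2_norm I \<psi> + ell2_norm I (\<lambda>i. \<phi> n i - \<psi> i)"
      using ell2_norm_triangle[OF \<psi> df] by simp
    then have b: "ell2_norm I (\<phi> n) \<le> ell2_norm I \<psi> + 1" using N2[of n] n d by simp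
    have "ell2_norm I (\<lambda>i. T n (\<phi> n) i - S \<psi> i)
        \<le> ell2_norm I (\<lambda>i. T n (\<phi> n) i - S (\<phi> n) i) + ell2_norm I (\<lambda>i. S (\<phi> n) i - S \<psi> i)"
      by (intro ell2_norm_triangle_diff bounded_ops_mem[OF T] bounded_ops_mem[OF S] \<phi>n \<psi>)
    also have "\<dots> \<le> d * ell2_norm I (\<phi> n) + C * ell2_norm I (\<lambda>i. \<phi> n i - \<psi> i)"
      using op_bound_le[OF N1 \<phi>n, of n] n op_bound_le[OF C df] bounded_ops_diff[OF S \<phi>n \<psi>]
      by (intro add_mono) auto
    also have "\<dots> \<le> d * (ell2_norm I \<psi> + 1) + C * d"
      using b d C0 N2[of n] n by (intro add_mono mult_left_mono) auto
    also have "\<dots> \<le> d * (C + ell2_norm I \<psi> + 2)" using d by (simp add: algebra_simps)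
    also have "\<dots> < e" using de e by linarith
    finally show "norm (ell2_norm I (\<lambda>i. T n (\<phi> n) i - S \<psi> i) - 0) < e" by simp
  qed
qed

lemma ell2_norm_conv_coord:
  assumes "\<And>n. \<phi> n \<in> ell2 I" "\<psi> \<in> ell2 I" "(\<lambda>n. ell2_norm I (\<lambda>i. \<phi> n i - \<psi> i)) \<longlonglongrightarrow> 0"
  shows "(\<lambda>n. \<phi> n i) \<longlonglongrightarrow> \<psi> i"
proof -
  have "(\<lambda>n. \<phi> n i - \<psi> i) \<longlonglongrightarrow> 0"
    by (rule Lim_null_comparison[OF always_eventually assms(3)])
      (use ell2_coord_le[OF ell2_diff_mem[OF assms(1,2)]] in blast)
  then show ?thesis by (rule LIM_zero_cancel)
qed

lemma op_lim_coord:
  assumes "op_lim I T S" "S \<in> bounded_ops I" "\<And>n. T n \<in> bounded_ops I" "\<phi> \<in> ell2 I"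
  shows "(\<lambda>n. T n \<phi> i) \<longlonglongrightarrow> S \<phi> i"
  by (rule ell2_norm_conv_coord[OF bounded_ops_mem[OF assms(3,4)] bounded_ops_mem[OF assms(2,4)]],
      rule op_lim_apply[OF assms(1-3) assms(4,4)]) simp

lemma bounded_ops_complete:
  assumes T: "\<And>n. T n \<in> bounded_ops I"
    and cau: "\<And>e. e > 0 \<Longrightarrow> \<exists>N. \<forall>m\<ge>N. \<forall>n\<ge>N. op_bound I (\<lambda>\<phi> i. T m \<phi> i - T n \<phi> i) e"
  obtains S where "S \<in> bounded_ops I" "op_lim I T S"
proof -
  have conv: "convergent (\<lambda>n. T n \<phi> i)" if \<phi>: "\<phi> \<in> ell2 I" for \<phi> i
  proof (rule Cauchy_convergent, rule CauchyI)
    fix e :: real assume e: "0 < e"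
    define d where "d = e / (ell2_norm I \<phi> + 1)"
    have p: "0 < ell2_norm I \<phi> + 1" using ell2_norm_nonneg[of I \<phi>] by linarith
    have d: "0 < d" using e p by (simp add: d_def)
    obtain N where N: "\<And>m n. m \<ge> N \<Longrightarrow> n \<ge> N \<Longrightarrow> op_bound I (\<lambda>\<phi> i. T m \<phi> i - T n \<phi> i) d"
      using cau[OF d] by blast
    have "norm (T m \<phi> i - T n \<phi> i) < e" if "m \<ge> N" "n \<ge> N" for m n
    proof -
      note b = N[OF that]
      have "norm (T m \<phi> i - T n \<phi> i) \<le> ell2_norm I (\<lambda>i. T m \<phi> i - T n \<phi> i)"
        by (rule ell2_coord_le[OF op_bound_mem[OF b \<phi>]])
      also have "\<dots> \<le> d * ell2_norm I \<phi>" by (rule op_bound_le[OF b \<phi>])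
      also have "\<dots> < d * (ell2_norm I \<phi> + 1)" using d by simp
      also have "\<dots> = e" using p by (simp add: d_def)
      finally show ?thesis .
    qed
    then show "\<exists>N. \<forall>m\<ge>N. \<forall>n\<ge>N. norm (T m \<phi> i - T n \<phi> i) < e" by blast
  qed
  define S where "S = (\<lambda>\<phi>\<in>ell2 I. \<lambda>i. lim (\<lambda>n. T n \<phi> i))"
  have Slim: "(\<lambda>n. T n \<phi> i) \<longlonglongrightarrow> S \<phi> i" if "\<phi> \<in> ell2 I" for \<phi> i
    using conv[OF that] that by (simp add: S_def convergent_LIMSEQ_iff)
  \<comment> \<open>The limit in \<open>m\<close> is taken inside a bound valid only for
    \<open>m \<ge> N\<close>, hence the shifted index \<open>m + N\<close>.\<close>
  have key: "op_bound I (\<lambda>\<phi> i. T n \<phi> i - S \<phi> i) e"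
    if e: "0 \<le> e" and N: "\<And>m. m \<ge> N \<Longrightarrow> op_bound I (\<lambda>\<phi> i. T n \<phi> i - T m \<phi> i) e" for e n N
  proof (rule op_boundI[OF e])
    fix \<phi> assume \<phi>: "\<phi> \<in> ell2 I"
    let ?f = "\<lambda>m i. T n \<phi> i - T (m + N) \<phi> i"
    have 1: "?f m \<in> ell2 I" for m using op_bound_mem[OF N \<phi>, of "m + N"] by simp
    have 2: "ell2_norm I (?f m) \<le> e * ell2_norm I \<phi>" for m using op_bound_le[OF N \<phi>, of "m + N"] by simp
    have 3: "(\<lambda>m. ?f m i) \<longlonglongrightarrow> T n \<phi> i - S \<phi> i" for i
      by (intro tendsto_intros LIMSEQ_ignore_initial_segment Slim \<phi>)
    show "(\<lambda>i. T n \<phi> i - S \<phi> i) \<in> ell2 I" by (rule ell2_lim_mem[OF 1 2 3])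
    show "ell2_norm I (\<lambda>i. T n \<phi> i - S \<phi> i) \<le> e * ell2_norm I \<phi>" by (rule ell2_lim_norm[OF 1 2 3])
  qed
  have lim: "op_lim I T S"
    unfolding op_lim_def
  proof (intro allI impI)
    fix e :: real assume e: "0 < e"
    obtain N where "\<And>m n. m \<ge> N \<Longrightarrow> n \<ge> N \<Longrightarrow> op_bound I (\<lambda>\<phi> i. T m \<phi> i - T n \<phi> i) e"
      using cau[OF e] by blast
    then have "\<forall>n\<ge>N. op_bound I (\<lambda>\<phi> i. T n \<phi> i - S \<phi> i) e"
      using e by (intro allI impI key[of e N]) auto
    then show "\<exists>N. \<forall>n\<ge>N. op_bound I (\<lambda>\<phi> i. T n \<phi> i - S \<phi> i) e" ..
  qed
  then obtain N where N: "op_bound I (\<lambda>\<phi> i. T N \<phi> i - S \<phi> i) 1"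
    unfolding op_lim_def by (metis order_refl zero_less_one)
  obtain C where C: "op_bound I (T N) C" using bounded_ops_bound[OF T] .
  have "S \<in> bounded_ops I"
  proof (rule bounded_opsI)
    show "op_bound I S (C + cmod (-1) * 1)"
      by (rule op_bound_cong[OF op_bound_add[OF C op_bound_scale[OF N, of "-1"]]]) simp
    show "S \<in> extensional (ell2 I)" by (simp add: S_def)
    fix \<phi> assume \<phi>: "\<phi> \<in> ell2 I"
    show "S (\<lambda>i. c * \<phi> i) = (\<lambda>i. c * S \<phi> i)" for c
    proof
      fix i
      have "(\<lambda>n. T n (\<lambda>i. c * \<phi> i) i) \<longlonglongrightarrow> c * S \<phi> i"
        unfolding bounded_ops_scale[OF T \<phi>] by (intro tendsto_intros Slim \<phi>)
      with Slim[OF ell2_scale_mem[OF \<phi>], of c i] show "S (\<lambda>i. c * \<phi> i) i = c * S \<phi> i"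
        by (rule LIMSEQ_unique)
    qed
    fix \<psi> assume \<psi>: "\<psi> \<in> ell2 I"
    show "S (\<lambda>i. \<phi> i + \<psi> i) = (\<lambda>i. S \<phi> i + S \<psi> i)"
    proof
      fix i
      have "(\<lambda>n. T n (\<lambda>i. \<phi> i + \<psi> i) i) \<longlonglongrightarrow> S \<phi> i + S \<psi> i"
        unfolding bounded_ops_add[OF T \<phi> \<psi>] by (intro tendsto_intros Slim \<phi> \<psi>)
      with Slim[OF ell2_add_mem[OF \<phi> \<psi>], of i] show "S (\<lambda>i. \<phi> i + \<psi> i) i = S \<phi> i + S \<psi> i"
        by (rule LIMSEQ_unique)
    qed
  qed
  then show thesis using lim by (rule that)
qed

section \<open>The free *-algebra and C*-seminorms\<close>

lemma adj_letter_adj_letter [simp]: "adj_letter (adj_letter l) = l"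
  by (cases l) auto

lemma adj_word_adj_word [simp]: "adj_word (adj_word w) = w"
  by (simp add: adj_word_def rev_map comp_def)

lemma adj_word_eq_iff: "adj_word v = w \<longleftrightarrow> v = adj_word w"
  by (metis adj_word_adj_word)

lemma adj_word_plus: "adj_word (u + v) = adj_word v + adj_word u"
  by (simp add: adj_word_def plus_word_def)

lemma adj_word_zero [simp]: "adj_word 0 = 0"
  by (simp add: adj_word_def zero_word_def)

lemma letters_plus [simp]: "letters (u + v) = letters u @ letters v"
  by (simp add: plus_word_def)

lemma letters_zero [simp]: "letters 0 = []"
  by (simp add: zero_word_def)

lemma poly_mapping_sum_single:
  "x = (\<Sum>w\<in>Poly_Mapping.keys x. Poly_Mapping.single w (Poly_Mapping.lookup x w))"
  by (rule poly_mapping_eqI)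
    (simp add: lookup_sum lookup_single when_def in_keys_iff)

lemma free_alg_induct [case_names zero single add]:
  fixes x :: "'g free_alg"
  assumes "P 0" "\<And>w c. P (Poly_Mapping.single w c)" "\<And>x y. P x \<Longrightarrow> P y \<Longrightarrow> P (x + y)"
  shows "P x"
proof -
  have "P (\<Sum>w\<in>A. Poly_Mapping.single w (Poly_Mapping.lookup x w))" for A
    by (induction A rule: infinite_finite_induct) (auto intro: assms)
  then show ?thesis by (subst poly_mapping_sum_single)
qed

lemma lookup_fscale [simp]: "Poly_Mapping.lookup (fscale c x) w = c * Poly_Mapping.lookup x w"
  by (simp add: fscale_def when_def Poly_Mapping.map.rep_eq flip: mult_map_scale_conv_mult)

lemma fscale_mult_left: "fscale c x * y = fscale c (x * y)"
  by (simp add: fscale_def mult.assoc)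

lemma fscale_diff: "fscale c (x - y) = fscale c x - fscale c y"
  by (simp add: fscale_def right_diff_distrib)

lemma fscale_minus_one: "fscale (- 1) x = - x"
  by (rule poly_mapping_eqI) simp

lemma fscale_zero [simp]: "fscale 0 x = 0"
  by (rule poly_mapping_eqI) simp

lemma fscale_one [simp]: "fscale 1 x = x"
  by (rule poly_mapping_eqI) simp

lemma fscale_fscale [simp]: "fscale c (fscale d x) = fscale (c * d) x"
  by (rule poly_mapping_eqI) simp

lemma fscale_single: "fscale c (Poly_Mapping.single w d) = Poly_Mapping.single w (c * d)"
  by (simp add: fscale_def mult_single)

lemma lookup_fstar [simp]:
  "Poly_Mapping.lookup (fstar x) w = cnj (Poly_Mapping.lookup x (adj_word w))"
proof -
  have "Poly_Mapping.lookup (fstar x) w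
      = (\<Sum>v\<in>Poly_Mapping.keys x. if v = adj_word w then cnj (Poly_Mapping.lookup x v) else 0)"
    by (simp add: fstar_def lookup_sum lookup_single when_def adj_word_eq_iff)
  then show ?thesis by (simp add: in_keys_iff)
qed

lemma fstar_add: "fstar (x + y) = fstar x + fstar y"
  by (rule poly_mapping_eqI) (simp add: lookup_add)

lemma fstar_diff: "fstar (x - y) = fstar x - fstar y"
  by (rule poly_mapping_eqI) (simp add: lookup_minus)

lemma fstar_zero [simp]: "fstar 0 = 0"
  by (rule poly_mapping_eqI) simp

lemma fstar_fstar [simp]: "fstar (fstar x) = x"
  by (rule poly_mapping_eqI) simp

lemma fstar_fscale: "fstar (fscale c x) = fscale (cnj c) (fstar x)"
  by (rule poly_mapping_eqI) simp

lemma fstar_single: "fstar (Poly_Mapping.single w c) = Poly_Mapping.single (adj_word w) (cnj c)"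
  by (rule poly_mapping_eqI) (simp add: lookup_single when_def, metis adj_word_adj_word)

lemma fstar_one [simp]: "fstar 1 = 1"
  using fstar_single[of 0 1] by simp

lemma fstar_mult: "fstar (x * y) = fstar y * fstar x"
proof (induction x rule: free_alg_induct)
  case (single w c)
  show ?case
    by (induction y rule: free_alg_induct)
      (auto simp: mult_single fstar_single adj_word_plus distrib_left distrib_right fstar_add mult.commute)
qed (auto simp: distrib_left distrib_right fstar_add)

lemma fstar_power: "fstar (x ^ n) = fstar x ^ n"
  by (induction n) (auto simp: fstar_mult power_commutes)

lemma fstar_fgen: "fstar (fgen g) = Poly_Mapping.single (Word [Adj g]) 1"
  by (simp add: fgen_def fstar_single adj_word_def)

lemma keys_fstar: "Poly_Mapping.keys (fstar x) = adj_word ` Poly_Mapping.keys x"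
proof (intro equalityI subsetI)
  fix w assume "w \<in> Poly_Mapping.keys (fstar x)"
  then have "adj_word w \<in> Poly_Mapping.keys x" by (simp add: in_keys_iff)
  then show "w \<in> adj_word ` Poly_Mapping.keys x" by (metis adj_word_adj_word image_eqI)
qed (auto simp: in_keys_iff)

lemma keys_uminus: "Poly_Mapping.keys (- x :: 'g free_alg) = Poly_Mapping.keys x"
  by (auto simp: in_keys_iff)

lemma keys_mult_free:
  fixes x y :: "'g free_alg"
  shows "w \<in> Poly_Mapping.keys (x * y) \<Longrightarrow>
    \<exists>u\<in>Poly_Mapping.keys x. \<exists>v\<in>Poly_Mapping.keys y. w = u + v"
  using keys_mult[of x y] by blast

lemma free_carrier_zero [simp]: "0 \<in> free_carrier G"
  by (simp add: free_carrier_def)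

lemma free_carrier_one [simp]: "1 \<in> free_carrier G"
  by (simp add: free_carrier_def)

lemma free_carrier_fgen [simp]: "g \<in> G \<Longrightarrow> fgen g \<in> free_carrier G"
  by (simp add: free_carrier_def fgen_def)

lemma free_carrier_add [simp]:
  "x \<in> free_carrier G \<Longrightarrow> y \<in> free_carrier G \<Longrightarrow> x + y \<in> free_carrier G"
  using keys_add[of x y] by (auto simp: free_carrier_def)

lemma free_carrier_uminus [simp]: "x \<in> free_carrier G \<Longrightarrow> - x \<in> free_carrier G"
  by (simp add: free_carrier_def keys_uminus)

lemma free_carrier_diff [simp]:
  "x \<in> free_carrier G \<Longrightarrow> y \<in> free_carrier G \<Longrightarrow> x - y \<in> free_carrier G"
  using free_carrier_add[of x G "- y"] by simp

lemma free_carrier_fscale [simp]: "x \<in> free_carrier G \<Longrightarrow> fscale c x \<in> free_carrier G"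
  by (auto simp: free_carrier_def in_keys_iff)

lemma free_carrier_mult [simp]:
  "x \<in> free_carrier G \<Longrightarrow> y \<in> free_carrier G \<Longrightarrow> x * y \<in> free_carrier G"
  unfolding free_carrier_def
  by (auto dest!: keys_mult_free) blast+

lemma free_carrier_fstar [simp]: "x \<in> free_carrier G \<Longrightarrow> fstar x \<in> free_carrier G"
  by (auto simp: free_carrier_def keys_fstar adj_word_def dest!: bspec subsetD)

lemma free_carrier_power [simp]: "x \<in> free_carrier G \<Longrightarrow> x ^ n \<in> free_carrier G"
  by (induction n) auto

lemma free_carrier_sum:
  "(\<And>a. a \<in> A \<Longrightarrow> f a \<in> free_carrier G) \<Longrightarrow> (\<Sum>a\<in>A. f a) \<in> free_carrier G"
  by (induction A rule: infinite_finite_induct) auto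

lemma free_carrier_single:
  "set (letters w) \<subseteq> Gen ` G \<union> Adj ` G \<Longrightarrow> Poly_Mapping.single w c \<in> free_carrier G"
  by (simp add: free_carrier_def)

lemma single_Cons:
  "Poly_Mapping.single (Word (l # ls)) (1::complex) = Poly_Mapping.single (Word [l]) 1 * Poly_Mapping.single (Word ls) 1"
  by (simp add: mult_single plus_word_def)

lemma single_Nil: "Poly_Mapping.single (Word []) (1::complex) = 1"
  unfolding zero_word_def[symmetric] by (rule single_one)

text \<open>Reduces statements about representations and homomorphisms to generators. Closure under
  \<open>fstar\<close> supplies the adjoint letters, and 0 is reached by scaling 1 with 0.\<close>

lemma free_carrier_induct [consumes 1, case_names one fgen add mult fscale fstar]:
  assumes "x \<in> free_carrier G" "P 1" "\<And>g. g \<in> G \<Longrightarrow> P (fgen g)"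
    and add: "\<And>x y. x \<in> free_carrier G \<Longrightarrow> y \<in> free_carrier G \<Longrightarrow> P x \<Longrightarrow> P y \<Longrightarrow> P (x + y)"
    and mult: "\<And>x y. x \<in> free_carrier G \<Longrightarrow> y \<in> free_carrier G \<Longrightarrow> P x \<Longrightarrow> P y \<Longrightarrow> P (x * y)"
    and fscale: "\<And>c x. x \<in> free_carrier G \<Longrightarrow> P x \<Longrightarrow> P (fscale c x)"
    and fstar: "\<And>x. x \<in> free_carrier G \<Longrightarrow> P x \<Longrightarrow> P (fstar x)"
  shows "P x"
proof -
  have letter: "P (Poly_Mapping.single (Word [l]) 1)" if "l \<in> Gen ` G \<union> Adj ` G" for l
    using that assms(3) fstar[of "fgen _"] by (auto simp: fgen_def[symmetric] fstar_fgen[symmetric])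
  have word: "P (Poly_Mapping.single (Word ls) 1)" if "set ls \<subseteq> Gen ` G \<union> Adj ` G" for ls
    using that
  proof (induction ls)
    case Nil
    then show ?case using assms(2) by (simp only: single_Nil)
  next
    case (Cons l ls)
    then show ?case
      by (subst single_Cons) (intro mult letter free_carrier_single, auto)
  qed
  have word: "P (Poly_Mapping.single w c)" if "set (letters w) \<subseteq> Gen ` G \<union> Adj ` G" for w c
  proof -
    have "P (fscale c (Poly_Mapping.single (Word (letters w)) 1))"
      using that by (intro fscale word free_carrier_single) auto
    then show ?thesis by (simp add: fscale_single)
  qed
  have zero: "P 0" using fscale[of 1 0] assms(2) by simp
  have "P (\<Sum>w\<in>A. Poly_Mapping.single w (Poly_Mapping.lookup x w))" if "A \<subseteq> Poly_Mapping.keys x" for A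
    using finite_subset[OF that finite_keys] that
  proof (induction A)
    case (insert w A)
    then show ?case using assms(1)
      by (auto intro!: add word free_carrier_sum free_carrier_single simp: free_carrier_def)
  qed (simp add: zero)
  then show ?thesis by (subst poly_mapping_sum_single) simp
qed

section \<open>Word length as degree\<close>

definition degree_le :: "nat \<Rightarrow> 'g free_alg \<Rightarrow> bool" where
  "degree_le N x \<longleftrightarrow> (\<forall>w\<in>Poly_Mapping.keys x. length (letters w) \<le> N)"

lemma degree_le_mult: "degree_le M x \<Longrightarrow> degree_le N y \<Longrightarrow> degree_le (M + N) (x * y)"
  unfolding degree_le_def by (auto dest!: keys_mult_free intro!: add_mono)

lemma degree_le_one: "degree_le 0 1"
  by (simp add: degree_le_def)

lemma degree_le_power: "degree_le M x \<Longrightarrow> degree_le (n * M) (x ^ n)"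
  by (induction n) (auto simp: degree_le_one intro: degree_le_mult)

lemma degree_le_exists: "\<exists>N. degree_le N x"
  unfolding degree_le_def
  by (rule exI[of _ "Max ((\<lambda>w. length (letters w)) ` Poly_Mapping.keys x)"]) auto

section \<open>Consequences of the axioms of a C*-seminorm\<close>

locale cstar_seminorm_on =
  fixes G :: "'g set" and \<rho> :: "'g free_alg \<Rightarrow> real"
  assumes seminorm: "cstar_seminorm G \<rho>"
begin

lemma nonneg [simp]: "x \<in> free_carrier G \<Longrightarrow> 0 \<le> \<rho> x"
  and triangle: "x \<in> free_carrier G \<Longrightarrow> y \<in> free_carrier G \<Longrightarrow> \<rho> (x + y) \<le> \<rho> x + \<rho> y"
  and scale: "x \<in> free_carrier G \<Longrightarrow> \<rho> (fscale c x) = cmod c * \<rho> x"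
  and submult: "x \<in> free_carrier G \<Longrightarrow> y \<in> free_carrier G \<Longrightarrow> \<rho> (x * y) \<le> \<rho> x * \<rho> y"
  and cstar: "x \<in> free_carrier G \<Longrightarrow> \<rho> (fstar x * x) = (\<rho> x)\<^sup>2"
  using seminorm by (auto simp: cstar_seminorm_def)

lemma zero [simp]: "\<rho> 0 = 0"
  using scale[of 1 0] by simp

lemma minus [simp]: "x \<in> free_carrier G \<Longrightarrow> \<rho> (- x) = \<rho> x"
  using scale[of x "-1"] by (simp add: fscale_minus_one)

lemma minus_commute: "x \<in> free_carrier G \<Longrightarrow> y \<in> free_carrier G \<Longrightarrow> \<rho> (x - y) = \<rho> (y - x)"
  using minus[of "x - y"] by simp

lemma triangle_diff:
  "x \<in> free_carrier G \<Longrightarrow> y \<in> free_carrier G \<Longrightarrow> z \<in> free_carrier G \<Longrightarrow>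
   \<rho> (x - z) \<le> \<rho> (x - y) + \<rho> (y - z)"
  using triangle[of "x - y" "y - z"] by simp

lemma sum_le:
  "(\<And>a. a \<in> A \<Longrightarrow> f a \<in> free_carrier G) \<Longrightarrow> \<rho> (\<Sum>a\<in>A. f a) \<le> (\<Sum>a\<in>A. \<rho> (f a))"
proof (induction A rule: infinite_finite_induct)
  case (insert x F)
  then show ?case
    using triangle[of "f x" "sum f F"] free_carrier_sum[of F f G] by (auto intro: order_trans)
qed auto

lemma one_le: "\<rho> 1 \<le> 1"
proof -
  have "\<rho> 1 = (\<rho> 1)\<^sup>2" using cstar[of 1] by simp
  then have "\<rho> 1 * \<rho> 1 = \<rho> 1" by (simp add: power2_eq_square)
  then show ?thesis using mult_cancel_right1 by fastforce
qed

text \<open>Isometry of the involution is not among the axioms of \<open>cstar_seminorm\<close>; it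
  comes from cancelling \<open>\<rho> x\<close> in the C*-identity combined with
  submultiplicativity.\<close>

lemma fstar_le: assumes "x \<in> free_carrier G" shows "\<rho> x \<le> \<rho> (fstar x)"
proof -
  have "\<rho> x * \<rho> x \<le> \<rho> (fstar x) * \<rho> x"
    using cstar[OF assms] submult[of "fstar x" x] assms by (simp add: power2_eq_square)
  then show ?thesis using nonneg[OF assms] nonneg[OF free_carrier_fstar[OF assms]]
    by (cases "\<rho> x = 0") auto
qed

lemma star [simp]: assumes "x \<in> free_carrier G" shows "\<rho> (fstar x) = \<rho> x"
  using fstar_le[OF assms] fstar_le[OF free_carrier_fstar[OF assms]] by simp

lemma mult_diff_le:
  assumes "x \<in> free_carrier G" "y \<in> free_carrier G" "x' \<in> free_carrier G" "y' \<in> free_carrier G"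
  shows "\<rho> (x * y - x' * y') \<le> \<rho> x * \<rho> (y - y') + \<rho> (x - x') * \<rho> y'"
proof -
  have "x * y - x' * y' = x * (y - y') + (x - x') * y'" by (simp add: algebra_simps)
  then have "\<rho> (x * y - x' * y') \<le> \<rho> (x * (y - y')) + \<rho> ((x - x') * y')"
    using triangle[of "x * (y - y')" "(x - x') * y'"] assms by simp
  also have "\<dots> \<le> \<rho> x * \<rho> (y - y') + \<rho> (x - x') * \<rho> y'"
    using assms by (intro add_mono submult) auto
  finally show ?thesis .
qed

text \<open>Each squaring is one use of the C*-identity, which applies because powers of
  \<open>z\<close> are self-adjoint. This is why the exponents are powers of two.\<close>

lemma selfadjoint_power:
  assumes "z \<in> free_carrier G" "fstar z = z"
  shows "\<rho> (z ^ 2 ^ m) = \<rho> z ^ 2 ^ m"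
proof (induction m)
  case (Suc m)
  have "\<rho> (z ^ 2 ^ Suc m) = \<rho> (fstar (z ^ 2 ^ m) * z ^ 2 ^ m)"
    using assms by (simp add: fstar_power power_mult power2_eq_square mult.commute flip: power_add mult_2)
  also have "\<dots> = (\<rho> z ^ 2 ^ m)\<^sup>2" using cstar[of "z ^ 2 ^ m"] assms Suc by simp
  also have "\<dots> = \<rho> z ^ 2 ^ Suc m" by (simp add: power_mult[symmetric] mult.commute)
  finally show ?case .
qed simp

end

text \<open>Taking \<open>2\<^sup>m\<close>-th roots removes any factor that grows polynomially with the degree.\<close>

lemma cstar_seminorm_le_of_linear_bound:
  assumes \<rho>: "cstar_seminorm G \<rho>" and \<sigma>: "cstar_seminorm G \<sigma>"
    and le: "\<And>N x. x \<in> free_carrier G \<Longrightarrow> degree_le N x \<Longrightarrow> \<rho> x \<le> K * (2 * real N + 1) * \<sigma> x"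
    and x: "x \<in> free_carrier G"
  shows "\<rho> x \<le> \<sigma> x"
proof -
  interpret r: cstar_seminorm_on G \<rho> by standard fact
  interpret s: cstar_seminorm_on G \<sigma> by standard fact
  define z where "z = fstar x * x"
  have z: "z \<in> free_carrier G" "fstar z = z" using x by (auto simp: z_def fstar_mult)
  obtain D where D: "degree_le D z" using degree_le_exists by blast
  have *: "\<rho> z ^ 2 ^ m \<le> K * (2 * real (2 ^ m * D) + 1) * \<sigma> z ^ 2 ^ m" for m
    using le[OF free_carrier_power[OF z(1)] degree_le_power[OF D], of "2 ^ m"]
    by (simp only: r.selfadjoint_power[OF z] s.selfadjoint_power[OF z])
  have "\<rho> z \<le> \<sigma> z"
  proof (rule ccontr)
    assume "\<not> \<rho> z \<le> \<sigma> z"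
    then have lt: "\<sigma> z < \<rho> z" by simp
    have pos: "0 < \<rho> z" using lt s.nonneg[OF z(1)] by linarith
    \<comment> \<open>If the claim failed, this ratio would be below 1, and \<open>q ^ 2 ^ m\<close>
      would beat the linear growth in the degree although the product stays at least 1.\<close>
    define q where "q = \<sigma> z / \<rho> z"
    have q: "0 \<le> q" "q < 1" using lt pos s.nonneg[OF z(1)] by (auto simp: q_def)
    have "(\<lambda>n. 2 * K * real D * (of_nat n * q ^ n) + K * q ^ n) \<longlonglongrightarrow> 2 * K * real D * 0 + K * 0"
      using q by (intro tendsto_intros powser_times_n_limit_0 LIMSEQ_power_zero) auto
    then have lim0: "(\<lambda>n. K * (2 * real (n * D) + 1) * q ^ n) \<longlonglongrightarrow> 0"
      by (simp add: algebra_simps)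
    have "strict_mono (\<lambda>m. 2 ^ m :: nat)" by (rule strict_monoI_Suc) simp
    from LIMSEQ_subseq_LIMSEQ[OF lim0 this]
    have lim: "(\<lambda>m. K * (2 * real (2 ^ m * D) + 1) * q ^ 2 ^ m) \<longlonglongrightarrow> 0"
      by (simp only: comp_def)
    have "1 \<le> K * (2 * real (2 ^ m * D) + 1) * q ^ 2 ^ m" for m
      using *[of m] pos by (simp add: q_def power_divide pos_le_divide_eq)
    then have "1 \<le> (0::real)" by (intro LIMSEQ_le_const[OF lim]) blast
    then show False by simp
  qed
  then have "(\<rho> x)\<^sup>2 \<le> (\<sigma> x)\<^sup>2" using r.cstar[OF x] s.cstar[OF x] by (simp add: z_def)
  then show ?thesis by (rule power2_le_imp_le) (rule s.nonneg[OF x])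
qed

section \<open>The p-adic integers and the orbit points\<close>

lemma padic_memD:
  assumes "x \<in> carrier (padic p)"
  shows padic_nonneg: "0 \<le> x n" and padic_less: "x n < int p ^ n" and padic_Suc: "x (Suc n) mod int p ^ n = x n"
  using assms by (auto simp: padic_def)

lemma padic_mod_le:
  assumes "x \<in> carrier (padic p)" "m \<le> n"
  shows "x n mod int p ^ m = x m"
  using assms(2)
proof (induction n rule: dec_induct)
  case base
  show ?case using padic_nonneg[OF assms(1)] padic_less[OF assms(1)] by (simp add: mod_pos_pos_trivial)
next
  case (step n)
  have "x (Suc n) mod int p ^ m = x (Suc n) mod int p ^ n mod int p ^ m"
    using step by (simp add: mod_mod_cancel le_imp_power_dvd)
  then show ?case using step padic_Suc[OF assms(1)] by simp
qed

lemma padic_mod_self: "x \<in> carrier (padic p) \<Longrightarrow> x n mod int p ^ n = x n"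
  by (rule padic_mod_le) auto

lemma padic_eq_le:
  assumes "x \<in> carrier (padic p)" "y \<in> carrier (padic p)" "x n = y n" "m \<le> n"
  shows "x m = y m"
  using padic_mod_le[OF assms(1,4)] padic_mod_le[OF assms(2,4)] assms(3) by simp

lemma padic_mult: "x \<otimes>\<^bsub>padic p\<^esub> y = (\<lambda>n. (x n * y n) mod int p ^ n)"
  by (simp add: padic_def)

lemma padic_one: "\<one>\<^bsub>padic p\<^esub> = padic_of_int p 1"
  by (simp add: padic_def)

lemma continuous_on_int_fun: "continuous_on S (f :: int \<Rightarrow> 'a::topological_space)"
  by (auto simp: continuous_on_open_invariant intro!: exI[of _ "f -` _"] open_discrete)

context
  fixes p :: nat
  assumes p: "0 < p"
begin

lemma padic_memI:
  assumes "\<And>n. [a (Suc n) = a n] (mod int p ^ n)"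
  shows "(\<lambda>n. a n mod int p ^ n) \<in> carrier (padic p)"
proof -
  have "a (Suc n) mod int p ^ Suc n mod int p ^ n = a n mod int p ^ n" for n
    using assms[of n] by (simp add: mod_mod_cancel cong_def)
  then show ?thesis using p by (simp add: padic_def)
qed

lemma padic_of_int_mem: "padic_of_int p z \<in> carrier (padic p)"
  unfolding padic_of_int_def by (rule padic_memI) simp

lemma padic_mult_mem:
  assumes "x \<in> carrier (padic p)" "y \<in> carrier (padic p)"
  shows "x \<otimes>\<^bsub>padic p\<^esub> y \<in> carrier (padic p)"
  unfolding padic_mult
proof (rule padic_memI, rule cong_mult)
  fix n
  show "[x (Suc n) = x n] (mod int p ^ n)" "[y (Suc n) = y n] (mod int p ^ n)"
    using padic_Suc padic_mod_self assms by (auto simp: cong_def)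
qed

lemma padic_comm_monoid: "comm_monoid (padic p)"
proof
  fix x y z assume xyz: "x \<in> carrier (padic p)" "y \<in> carrier (padic p)" "z \<in> carrier (padic p)"
  show "x \<otimes>\<^bsub>padic p\<^esub> y \<in> carrier (padic p)" using xyz(1,2) by (rule padic_mult_mem)
  show "x \<otimes>\<^bsub>padic p\<^esub> y = y \<otimes>\<^bsub>padic p\<^esub> x" by (simp add: padic_mult mult.commute)
  show "x \<otimes>\<^bsub>padic p\<^esub> y \<otimes>\<^bsub>padic p\<^esub> z = x \<otimes>\<^bsub>padic p\<^esub> (y \<otimes>\<^bsub>padic p\<^esub> z)"
    by (simp add: padic_mult mod_mult_left_eq mod_mult_right_eq mult.assoc)
  show "\<one>\<^bsub>padic p\<^esub> \<otimes>\<^bsub>padic p\<^esub> x = x" "x \<otimes>\<^bsub>padic p\<^esub> \<one>\<^bsub>padic p\<^esub> = x"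
    using padic_mod_self[OF xyz(1)]
    by (auto simp: padic_mult padic_one padic_of_int_def mod_mult_left_eq mod_mult_right_eq)
qed (auto simp: padic_one padic_of_int_mem)

text \<open>The inverse limit is cut out of a product of finite sets by closed conditions, so
  Tychonoff applies.\<close>

lemma compact_padic: "compact (carrier (padic p))"
proof -
  let ?B = "\<lambda>n. {0..<int p ^ n}"
  have "compact (Pi\<^sub>E UNIV ?B)"
    using compactin_PiE[of "\<lambda>_::nat. euclidean :: int topology" UNIV ?B]
    by (simp add: euclidean_product_topology compactin_euclidean_iff finite_imp_compact)
  moreover have "carrier (padic p) = Pi\<^sub>E UNIV ?B \<inter> (\<Inter>n. {x. x (Suc n) mod int p ^ n = x n})"
    by (auto simp: padic_def PiE_def Pi_def)
  moreover have "closed (\<Inter>n. {x :: nat \<Rightarrow> int. x (Suc n) mod int p ^ n = x n})"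
  proof (intro closed_INT ballI closed_Collect_eq)
    fix n
    have "continuous_on UNIV ((\<lambda>z. z mod int p ^ n) \<circ> (\<lambda>x :: nat \<Rightarrow> int. x (Suc n)))"
      by (intro continuous_on_compose continuous_on_product_coordinates continuous_on_int_fun)
    then show "continuous_on UNIV (\<lambda>x :: nat \<Rightarrow> int. x (Suc n) mod int p ^ n)" by (simp add: comp_def)
  qed (rule continuous_on_product_coordinates)
  ultimately show ?thesis by (auto intro: compact_Int_closed)
qed

lemma continuous_on_padic_mult:
  "continuous_on (carrier (padic p)) (\<lambda>x. x \<otimes>\<^bsub>padic p\<^esub> s)"
  unfolding padic_mult
proof (rule continuous_on_coordinatewise_then_product)
  fix n
  have "continuous_on (carrier (padic p)) ((\<lambda>z. (z * s n) mod int p ^ n) \<circ> (\<lambda>x. x n))"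
    by (intro continuous_on_compose continuous_on_subset[OF continuous_on_product_coordinates]
        continuous_on_int_fun) auto
  then show "continuous_on (carrier (padic p)) (\<lambda>x. (x n * s n) mod int p ^ n)" by (simp add: comp_def)
qed

text \<open>An inverse of \<open>z\<close> exists at every level, and cancelling \<open>z\<close>
  shows that the one at level n + 1 reduces to the one at level n; the choices therefore fit
  together to an element of the inverse limit.\<close>

lemma padic_of_int_unit:
  assumes "coprime z (int p)"
  shows "padic_of_int p z \<in> carrier (padic_units p)"
proof -
  interpret comm_monoid "padic p" by (rule padic_comm_monoid)
  have "\<exists>y. [z * y = 1] (mod int p ^ n)" for n
    using assms by (intro cong_solve_coprime_int) simp
  then obtain y where y: "\<And>n. [z * y n = 1] (mod int p ^ n)" by metis
  have "[y (Suc n) = y n] (mod int p ^ n)" for n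
  proof -
    have "[z * y (Suc n) = z * y n] (mod int p ^ n)"
      using cong_dvd_modulus[OF y[of "Suc n"], of "int p ^ n"] y[of n]
      by (metis cong_sym cong_trans dvd_triv_right power_Suc)
    then show ?thesis using assms by (simp add: cong_mult_lcancel)
  qed
  then have m: "(\<lambda>n. y n mod int p ^ n) \<in> carrier (padic p)" by (rule padic_memI)
  have e: "padic_of_int p z \<otimes>\<^bsub>padic p\<^esub> (\<lambda>n. y n mod int p ^ n) = \<one>\<^bsub>padic p\<^esub>"
    using y by (auto simp: padic_mult padic_one padic_of_int_def mod_mult_eq cong_def)
  moreover from e have "(\<lambda>n. y n mod int p ^ n) \<otimes>\<^bsub>padic p\<^esub> padic_of_int p z = \<one>\<^bsub>padic p\<^esub>"
    by (simp add: padic_mult mult.commute)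
  ultimately have "padic_of_int p z \<in> Units (padic p)"
    using m padic_of_int_mem unfolding Units_def by blast
  then show ?thesis by (simp add: units_of_carrier)
qed

end

lemma padic_int_factor:
  assumes "prime p" "0 < (z::int)"
  obtains L u where "z = int p ^ L * u" "coprime u (int p)"
proof -
  have "prime (int p)" using assms by simp
  then have "\<not> is_unit (int p)" by (simp add: prime_int_iff)
  obtain u where u: "z = int p ^ multiplicity (int p) z * u" "\<not> int p dvd u"
    using multiplicity_decompose'[of z "int p"] assms \<open>\<not> is_unit (int p)\<close> by auto
  have "coprime u (int p)"
    using u(2) \<open>prime (int p)\<close> by (metis coprime_commute prime_imp_coprime)
  with u(1) show thesis by (rule that)
qed

section \<open>Orbit points and their density\<close>

locale orbit_section =
  fixes p :: nat and r :: padic_seq and \<gamma> :: "padic_seq set \<Rightarrow> padic_seq"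
  assumes prime: "prime p"
    and r_unit: "r \<in> carrier (padic_units p)"
    and section_mem: "\<gamma> \<in> carrier (padic_units p Mod orbit_closure p r) \<rightarrow> carrier (padic_units p)"
    and section_coset: "\<And>c. c \<in> carrier (padic_units p Mod orbit_closure p r) \<Longrightarrow>
      orbit_closure p r #>\<^bsub>padic_units p\<^esub> \<gamma> c = c"
begin

abbreviation "Zp \<equiv> carrier (padic p)"
abbreviation "Idx \<equiv> orbit_indices p r"
abbreviation "pt \<equiv> orbit_point p r \<gamma>"
abbreviation "s \<equiv> inv\<^bsub>padic p\<^esub> r"

lemma p_pos: "0 < p"
  using prime by (simp add: prime_gt_0_nat)

sublocale Z: comm_monoid "padic p"
  by (rule padic_comm_monoid[OF p_pos])

sublocale U: comm_group "padic_units p"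
  by (rule Z.units_comm_group)

lemma units_mem: "x \<in> carrier (padic_units p) \<Longrightarrow> x \<in> Zp"
  by (simp add: units_of_carrier Z.Units_closed)

lemma r_mem [simp]: "r \<in> Zp"
  by (rule units_mem[OF r_unit])

lemma r_Units [simp]: "r \<in> Units (padic p)"
  using r_unit by (simp add: units_of_carrier)

lemma rpow_mem: "r [^]\<^bsub>padic_units p\<^esub> (k::int) \<in> carrier (padic_units p)"
  by (rule U.int_pow_closed[OF r_unit])

text \<open>Powers are formed in the group of units, while \<open>dilate\<close> divides in the
  ring. This identity joins the two and makes a shift of \<open>k\<close> a division by
  \<open>r\<close>.\<close>

lemma rpow_shift: "r [^]\<^bsub>padic_units p\<^esub> (k - 1 :: int) = r [^]\<^bsub>padic_units p\<^esub> k \<otimes>\<^bsub>padic p\<^esub> s"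
proof -
  have "r [^]\<^bsub>padic_units p\<^esub> (k - 1) = r [^]\<^bsub>padic_units p\<^esub> k \<otimes>\<^bsub>padic_units p\<^esub> inv\<^bsub>padic_units p\<^esub> r"
    using U.int_pow_diff[OF r_unit, of k 1] U.int_pow_1[OF r_unit] by simp
  then show ?thesis by (simp add: units_of_mult Z.units_of_inv)
qed

lemma point_mem:
  assumes "i \<in> Idx" shows "pt i \<in> Zp"
  using assms section_mem units_mem rpow_mem padic_of_int_mem[OF p_pos]
  by (auto simp: orbit_indices_def orbit_point_def Pi_iff split: prod.splits)

lemma point_shift:
  assumes "(k, L, c) \<in> Idx"
  shows "pt (k - 1, L, c) = pt (k, L, c) \<otimes>\<^bsub>padic p\<^esub> s"
proof -
  let ?a = "r [^]\<^bsub>padic_units p\<^esub> k" and ?b = "padic_of_int p (int p) [^]\<^bsub>padic p\<^esub> L"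
  have a: "?a \<in> Zp" by (rule units_mem[OF rpow_mem])
  have b: "?b \<in> Zp" using padic_of_int_mem[OF p_pos] by simp
  have c: "\<gamma> c \<in> Zp" using assms section_mem units_mem by (auto simp: orbit_indices_def)
  show ?thesis
    using a b c by (simp add: orbit_point_def rpow_shift Z.m_ac)
qed

lemma padic_of_int_pow:
  "padic_of_int p z [^]\<^bsub>padic p\<^esub> (L::nat) = padic_of_int p (z ^ L)"
  by (induction L) (auto simp: padic_one padic_mult padic_of_int_def mod_mult_eq mult.commute)

lemma one_mem_orbit_closure: "\<one>\<^bsub>padic_units p\<^esub> \<in> orbit_closure p r"
proof -
  have "\<one>\<^bsub>padic_units p\<^esub> = r [^]\<^bsub>padic_units p\<^esub> (0::int)" by simp
  then have "\<one>\<^bsub>padic_units p\<^esub> \<in> {r [^]\<^bsub>padic_units p\<^esub> k | k :: int. True}"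
    unfolding mem_Collect_eq by (intro exI[of _ 0] conjI TrueI)
  from subsetD[OF closure_subset this] show ?thesis
    unfolding orbit_closure_def using U.one_closed by (rule IntI)
qed

text \<open>Prescribing one residue defines an open set, so a point of the closure shares its
  residue at level \<open>n\<close> with some power of \<open>r\<close>.\<close>

lemma orbit_closure_approx:
  assumes "h \<in> orbit_closure p r"
  obtains k :: int where "(r [^]\<^bsub>padic_units p\<^esub> k) n = h n"
proof -
  let ?A = "{y :: padic_seq. y n \<in> {h n}}"
  have "open ?A"
    using open_vimage[OF open_discrete[of "{h n}"] continuous_on_product_coordinates[of n]]
    by (simp add: vimage_def)
  moreover have "h \<in> ?A" "h \<in> closure {r [^]\<^bsub>padic_units p\<^esub> k | k :: int. True}"
    using assms by (auto simp: orbit_closure_def)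
  ultimately obtain y where "y \<in> {r [^]\<^bsub>padic_units p\<^esub> k | k :: int. True}" "y \<in> ?A"
    unfolding closure_iff_nhds_not_empty by (metis (no_types, lifting) disjoint_iff subset_refl)
  then show thesis using that by auto
qed

lemma coset_mem:
  "u \<in> carrier (padic_units p) \<Longrightarrow>
   orbit_closure p r #>\<^bsub>padic_units p\<^esub> u \<in> carrier (padic_units p Mod orbit_closure p r)"
  by (auto simp: FactGroup_def RCOSETS_def)

lemma coset_section:
  assumes u: "u \<in> carrier (padic_units p)"
  obtains h where "h \<in> orbit_closure p r"
    "u = h \<otimes>\<^bsub>padic p\<^esub> \<gamma> (orbit_closure p r #>\<^bsub>padic_units p\<^esub> u)"
proof -
  let ?c = "orbit_closure p r #>\<^bsub>padic_units p\<^esub> u"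
  have "\<one>\<^bsub>padic_units p\<^esub> \<otimes>\<^bsub>padic_units p\<^esub> u \<in> ?c"
    unfolding r_coset_def using one_mem_orbit_closure by blast
  then have "u \<in> orbit_closure p r #>\<^bsub>padic_units p\<^esub> \<gamma> ?c"
    using section_coset[OF coset_mem[OF u]] u by simp
  then show thesis using that by (auto simp: r_coset_def units_of_mult)
qed

text \<open>Only the integer \<open>x n\<close> has to be matched. If nonzero, it is a power of
  \<open>p\<close> times a number prime to \<open>p\<close>; that unit is the representative of its
  coset times an element of the orbit closure, and the latter agrees at level \<open>n\<close> with
  a power of \<open>r\<close>.\<close>

lemma point_dense:
  assumes x: "x \<in> Zp"
  obtains i where "i \<in> Idx" "pt i n = x n"
proof (cases "x n = 0")
  case True
  \<comment> \<open>The \<open>n\<close>-th power of \<open>p\<close> annihilates the residue at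
    level \<open>n\<close> for any coset; the trivial one is taken.\<close>
  let ?c = "orbit_closure p r #>\<^bsub>padic_units p\<^esub> \<one>\<^bsub>padic_units p\<^esub>"
  have "(0, n, ?c) \<in> Idx"
    using coset_mem[OF U.one_closed] by (simp add: orbit_indices_def)
  moreover have "pt (0, n, ?c) n = x n"
    unfolding orbit_point_def padic_of_int_pow
    by (simp add: padic_mult padic_of_int_def True mult.commute[of _ "_ mod _"] mod_simps)
  ultimately show thesis by (rule that)
next
  case False
  then have "0 < x n" using padic_nonneg[OF x, of n] by simp
  then obtain L u where u: "x n = int p ^ L * u" "coprime u (int p)"
    by (rule padic_int_factor[OF prime])
  note u' = padic_of_int_unit[OF p_pos u(2)]
  let ?c = "orbit_closure p r #>\<^bsub>padic_units p\<^esub> padic_of_int p u"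
  obtain h where h: "h \<in> orbit_closure p r" "padic_of_int p u = h \<otimes>\<^bsub>padic p\<^esub> \<gamma> ?c"
    by (rule coset_section[OF u'])
  obtain k where k: "(r [^]\<^bsub>padic_units p\<^esub> (k::int)) n = h n" by (rule orbit_closure_approx[OF h(1)])
  have hu: "(h n * \<gamma> ?c n) mod int p ^ n = u mod int p ^ n"
    using fun_cong[OF h(2), of n] by (simp add: padic_mult padic_of_int_def)
  have "pt (k, L, ?c) n = (h n * int p ^ L mod int p ^ n * \<gamma> ?c n) mod int p ^ n"
    unfolding orbit_point_def padic_of_int_pow
    by (simp add: padic_mult padic_of_int_def k mod_simps)
  also have "\<dots> = (int p ^ L * (h n * \<gamma> ?c n)) mod int p ^ n"
    by (simp add: mod_mult_left_eq mult_ac)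
  also have "\<dots> = (int p ^ L * u) mod int p ^ n"
    using hu by (metis mod_mult_right_eq)
  also have "\<dots> = x n" using padic_mod_self[OF x, of n] u(1) by metis
  finally have "pt (k, L, ?c) n = x n" .
  moreover have "(k, L, ?c) \<in> Idx" using coset_mem[OF u'] by (simp add: orbit_indices_def)
  ultimately show thesis by (rule that[rotated])
qed

lemma cont_padic_bound_of_points:
  assumes f: "f \<in> cont_padic p" and le: "\<And>i. i \<in> Idx \<Longrightarrow> cmod (f (pt i)) \<le> C"
    and x: "x \<in> Zp"
  shows "cmod (f x) \<le> C"
proof -
  have "\<forall>n. \<exists>i. i \<in> Idx \<and> pt i n = x n" using point_dense[OF x] by metis
  then obtain i where i: "\<And>n. i n \<in> Idx" "\<And>n. pt (i n) n = x n" by metis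
  \<comment> \<open>Agreement at level \<open>n\<close> forces agreement at all lower levels, so
    every fixed coordinate of the sequence of points is eventually constant.\<close>
  have eq: "pt (i n) m = x m" if "m \<le> n" for m n
    by (rule padic_eq_le[OF point_mem[OF i(1)] x i(2) that])
  have lim: "(\<lambda>n. pt (i n)) \<longlonglongrightarrow> x"
  proof -
    have "(\<lambda>n. pt (i n) m) \<longlonglongrightarrow> x m" for m
      by (rule tendsto_eventually) (auto simp: eventually_sequentially intro!: exI[of _ m] eq)
    then have "limitin (product_topology (\<lambda>_. euclidean) UNIV) (\<lambda>n. pt (i n)) x sequentially"
      by (simp add: limitin_componentwise)
    then show ?thesis by (simp add: euclidean_product_topology)
  qed
  have "(\<lambda>n. f (pt (i n))) \<longlonglongrightarrow> f x"
    using f x lim point_mem[OF i(1)]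
    by (intro continuous_on_tendsto_compose[of Zp f]) (auto simp: cont_padic_def)
  then have "(\<lambda>n. cmod (f (pt (i n)))) \<longlonglongrightarrow> cmod (f x)" by (rule tendsto_norm)
  then show ?thesis by (rule LIMSEQ_le_const2) (use le i in auto)
qed

lemma cont_padic_bounded:
  assumes "f \<in> cont_padic p"
  obtains C where "0 \<le> C" "\<And>x. cmod (f x) \<le> C"
proof -
  have "bounded (f ` Zp)"
    using assms compact_padic[OF p_pos]
    by (intro compact_imp_bounded compact_continuous_image) (auto simp: cont_padic_def)
  then obtain C where C: "\<And>x. x \<in> Zp \<Longrightarrow> cmod (f x) \<le> C" unfolding bounded_iff by blast
  have "0 \<le> C" using C[OF r_mem] norm_ge_zero order_trans by blast
  moreover have "cmod (f x) \<le> C" for x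
    using C[of x] assms \<open>0 \<le> C\<close> by (cases "x \<in> Zp") (auto simp: cont_padic_def)
  ultimately show thesis by (rule that)
qed

section \<open>Closure properties of the continuous functions, and dilation\<close>

lemma cont_padic_add: "f \<in> cont_padic p \<Longrightarrow> g \<in> cont_padic p \<Longrightarrow> (\<lambda>x. f x + g x) \<in> cont_padic p"
  by (auto simp: cont_padic_def intro!: continuous_intros)

lemma cont_padic_mult: "f \<in> cont_padic p \<Longrightarrow> g \<in> cont_padic p \<Longrightarrow> (\<lambda>x. f x * g x) \<in> cont_padic p"
  by (auto simp: cont_padic_def intro!: continuous_intros)

lemma cont_padic_scale: "f \<in> cont_padic p \<Longrightarrow> (\<lambda>x. c * f x) \<in> cont_padic p"
  by (auto simp: cont_padic_def intro!: continuous_intros)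

lemma cont_padic_cnj: "f \<in> cont_padic p \<Longrightarrow> (\<lambda>x. cnj (f x)) \<in> cont_padic p"
  by (auto simp: cont_padic_def intro!: continuous_intros)

lemma cont_padic_indicator: "indicator Zp \<in> cont_padic p"
proof -
  have "continuous_on Zp (\<lambda>x. 1 :: complex)" by simp
  then have "continuous_on Zp (indicator Zp :: _ \<Rightarrow> complex)"
    by (rule continuous_on_eq) simp
  then show ?thesis by (simp add: cont_padic_def)
qed

lemma cont_padic_zero: "(\<lambda>x. 0) \<in> cont_padic p"
  by (simp add: cont_padic_def)

lemma cont_padic_sum: "(\<And>a. a \<in> A \<Longrightarrow> f a \<in> cont_padic p) \<Longrightarrow> (\<lambda>x. \<Sum>a\<in>A. f a x) \<in> cont_padic p"
proof (induction A rule: infinite_finite_induct)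
  case (insert a A)
  then have "(\<lambda>x. f a x + (\<Sum>b\<in>A. f b x)) \<in> cont_padic p" by (intro cont_padic_add) simp_all
  then show ?case using insert by simp
qed (simp_all add: cont_padic_zero)

lemma cont_padic_dilate:
  assumes f: "f \<in> cont_padic p" and t: "t \<in> Units (padic p)"
  shows "dilate p t f \<in> cont_padic p"
proof -
  have "continuous_on Zp (f \<circ> (\<lambda>x. x \<otimes>\<^bsub>padic p\<^esub> inv\<^bsub>padic p\<^esub> t))"
  proof (rule continuous_on_compose[OF continuous_on_padic_mult[OF p_pos]])
    show "continuous_on ((\<lambda>x. x \<otimes>\<^bsub>padic p\<^esub> inv\<^bsub>padic p\<^esub> t) ` Zp) f"
    proof (rule continuous_on_subset)
      show "continuous_on Zp f" using f by (simp add: cont_padic_def)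
      show "(\<lambda>x. x \<otimes>\<^bsub>padic p\<^esub> inv\<^bsub>padic p\<^esub> t) ` Zp \<subseteq> Zp"
        using Z.m_closed[OF _ Z.Units_inv_closed[OF t]] by blast
    qed
  qed
  then have "continuous_on Zp (dilate p t f)"
    by (rule continuous_on_eq) (simp add: dilate_def)
  then show ?thesis by (simp add: cont_padic_def dilate_def)
qed

text \<open>Makes every continuous function a dilation by \<open>r\<close>, which lets the
  covariance relation be read from right to left.\<close>

lemma dilate_dilate_inv:
  assumes f: "f \<in> cont_padic p" and t: "t \<in> Units (padic p)"
  shows "dilate p t (dilate p (inv\<^bsub>padic p\<^esub> t) f) = f"
proof
  fix x
  show "dilate p t (dilate p (inv\<^bsub>padic p\<^esub> t) f) x = f x"
    using f t by (cases "x \<in> Zp") (auto simp: dilate_def cont_padic_def Z.m_assoc Z.Units_closed)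
qed

lemma dilate_point:
  assumes "(k, L, c) \<in> Idx"
  shows "dilate p r f (pt (k, L, c)) = f (pt (k - 1, L, c))"
  using point_mem[OF assms] point_shift[OF assms] by (simp add: dilate_def)

lemma dilate_inv_point:
  assumes "(k, L, c) \<in> Idx"
  shows "dilate p s f (pt (k, L, c)) = f (pt (k + 1, L, c))"
proof -
  have i: "(k + 1, L, c) \<in> Idx" using assms by (simp add: orbit_indices_def)
  have "pt (k, L, c) = pt (k + 1, L, c) \<otimes>\<^bsub>padic p\<^esub> s" using point_shift[OF i] by simp
  then have "pt (k, L, c) \<otimes>\<^bsub>padic p\<^esub> r = pt (k + 1, L, c)"
    using point_mem[OF i] by (simp add: Z.m_assoc)
  then show ?thesis using point_mem[OF assms] by (simp add: dilate_def)
qed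

lemma dilate_indicator:
  assumes "t \<in> Units (padic p)"
  shows "dilate p t (indicator Zp) = indicator Zp"
  using assms by (auto simp: dilate_def fun_eq_iff indicator_def)

end

section \<open>The orbit representation of the free *-algebra\<close>

context orbit_section
begin

text \<open>The operators act on all families, not only on square-summable ones, so linearity and
  multiplicativity carry no side conditions. The letter \<open>Adj GenV\<close> is read as the
  inverse shift; that this is the Hilbert adjoint is the content of
  \<open>letter_op_adjoint\<close>.\<close>

fun letter_op :: "crossed_gen letter \<Rightarrow> (orbit_index \<Rightarrow> complex) \<Rightarrow> orbit_index \<Rightarrow> complex" where
  "letter_op (Gen GenV) \<phi> = (\<lambda>(k, L, c). \<phi> (k - 1, L, c))"
| "letter_op (Adj GenV) \<phi> = (\<lambda>(k, L, c). \<phi> (k + 1, L, c))"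
| "letter_op (Gen (GenM f)) \<phi> = (\<lambda>i. f (pt i) * \<phi> i)"
| "letter_op (Adj (GenM f)) \<phi> = (\<lambda>i. cnj (f (pt i)) * \<phi> i)"

definition word_op :: "crossed_gen word \<Rightarrow> (orbit_index \<Rightarrow> complex) \<Rightarrow> orbit_index \<Rightarrow> complex" where
  "word_op w = foldr letter_op (letters w)"

definition rep :: "crossed_gen free_alg \<Rightarrow> (orbit_index \<Rightarrow> complex) \<Rightarrow> orbit_index \<Rightarrow> complex" where
  "rep x \<phi> = (\<lambda>i. \<Sum>w\<in>Poly_Mapping.keys x. Poly_Mapping.lookup x w * word_op w \<phi> i)"

lemma letter_op_add: "letter_op l (\<lambda>i. \<phi> i + \<psi> i) = (\<lambda>i. letter_op l \<phi> i + letter_op l \<psi> i)"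
  by (induction l \<phi> rule: letter_op.induct) (auto simp: algebra_simps)

lemma letter_op_scale: "letter_op l (\<lambda>i. c * \<phi> i) = (\<lambda>i. c * letter_op l \<phi> i)"
  by (induction l \<phi> rule: letter_op.induct) auto

lemma word_op_add: "word_op w (\<lambda>i. \<phi> i + \<psi> i) = (\<lambda>i. word_op w \<phi> i + word_op w \<psi> i)"
proof -
  have "foldr letter_op ls (\<lambda>i. \<phi> i + \<psi> i) = (\<lambda>i. foldr letter_op ls \<phi> i + foldr letter_op ls \<psi> i)" for ls
    by (induction ls) (simp_all add: letter_op_add)
  then show ?thesis by (simp add: word_op_def)
qed

lemma word_op_scale: "word_op w (\<lambda>i. c * \<phi> i) = (\<lambda>i. c * word_op w \<phi> i)"
proof -
  have "foldr letter_op ls (\<lambda>i. c * \<phi> i) = (\<lambda>i. c * foldr letter_op ls \<phi> i)" for ls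
    by (induction ls) (simp_all add: letter_op_scale)
  then show ?thesis by (simp add: word_op_def)
qed

lemma word_op_plus: "word_op (u + v) \<phi> = word_op u (word_op v \<phi>)"
  by (simp add: word_op_def)

text \<open>Cancellation can shrink the key set of a sum, so additivity is computed over a common
  finite superset.\<close>

lemma rep_superset:
  assumes "finite A" "Poly_Mapping.keys x \<subseteq> A"
  shows "rep x \<phi> i = (\<Sum>w\<in>A. Poly_Mapping.lookup x w * word_op w \<phi> i)"
  unfolding rep_def using assms by (intro sum.mono_neutral_left) (auto simp: in_keys_iff)

lemma rep_add: "rep (x + y) \<phi> = (\<lambda>i. rep x \<phi> i + rep y \<phi> i)"
proof
  fix i
  let ?A = "Poly_Mapping.keys x \<union> Poly_Mapping.keys y"
  show "rep (x + y) \<phi> i = rep x \<phi> i + rep y \<phi> i"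
    using keys_add[of x y]
    by (simp add: rep_superset[of ?A] lookup_add distrib_right sum.distrib)
qed

lemma rep_single: "rep (Poly_Mapping.single w c) \<phi> = (\<lambda>i. c * word_op w \<phi> i)"
  by (rule ext, subst rep_superset[of "{w}"]) auto

lemma rep_zero [simp]: "rep 0 \<phi> = (\<lambda>i. 0)"
  by (simp add: rep_def)

lemma rep_one [simp]: "rep 1 = (\<lambda>\<phi>. \<phi>)"
  using rep_single[of 0 1] by (simp add: word_op_def fun_eq_iff)

lemma rep_fscale: "rep (fscale c x) \<phi> = (\<lambda>i. c * rep x \<phi> i)"
proof
  fix i
  have "Poly_Mapping.keys (fscale c x) \<subseteq> Poly_Mapping.keys x" by (auto simp: in_keys_iff)
  then show "rep (fscale c x) \<phi> i = c * rep x \<phi> i"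
    by (simp add: rep_superset[of "Poly_Mapping.keys x"] sum_distrib_left mult.assoc)
qed

lemma rep_diff: "rep (x - y) \<phi> = (\<lambda>i. rep x \<phi> i - rep y \<phi> i)"
  using rep_add[of x "fscale (- 1) y"] by (simp add: fscale_minus_one[symmetric] rep_fscale)
    (simp add: fscale_minus_one)

lemma rep_fgen: "rep (fgen g) \<phi> = letter_op (Gen g) \<phi>"
  by (simp add: fgen_def rep_single word_op_def)

lemma rep_fstar_fgen: "rep (fstar (fgen g)) \<phi> = letter_op (Adj g) \<phi>"
  by (simp add: fstar_fgen rep_single word_op_def)

lemma rep_arg_add: "rep x (\<lambda>i. \<phi> i + \<psi> i) = (\<lambda>i. rep x \<phi> i + rep x \<psi> i)"
  by (simp add: rep_def word_op_add distrib_left sum.distrib)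

lemma rep_arg_scale: "rep x (\<lambda>i. c * \<phi> i) = (\<lambda>i. c * rep x \<phi> i)"
  by (simp add: rep_def word_op_scale sum_distrib_left mult.left_commute)

lemma rep_mult: "rep (x * y) \<phi> = rep x (rep y \<phi>)"
proof (induction x rule: free_alg_induct)
  case (single w c)
  show ?case
  proof (induction y rule: free_alg_induct)
    case zero
    show ?case using word_op_scale[of w 0 \<phi>] by (simp add: rep_single)
  next
    case (single v d)
    show ?case by (simp add: mult_single rep_single word_op_plus word_op_scale mult.assoc)
  next
    case (add y z)
    then show ?case by (simp add: distrib_left rep_add rep_arg_add)
  qed
qed (simp_all add: distrib_right rep_add)

lemma letter_op_bound:
  assumes "l \<in> Gen ` crossed_gens p \<union> Adj ` crossed_gens p"
  shows "\<exists>C. op_bound Idx (letter_op l) C"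
proof -
  have shift: "op_bound Idx (\<lambda>\<phi> (k, L, c). \<phi> (k + m, L, c)) 1" for m :: int
  proof (rule op_boundI)
    fix \<phi> :: "orbit_index \<Rightarrow> complex" assume \<phi>: "\<phi> \<in> ell2 Idx"
    let ?s = "\<lambda>(k, L, c). (k + m, L, c) :: orbit_index"
    let ?f = "\<lambda>(k, L, c). \<phi> (k + m, L, c)"
    have 0: "?f i = 0" if "i \<notin> Idx" for i
      using that by (cases i) (auto simp: orbit_indices_def intro!: ell2_outside[OF \<phi>])
    have *: "L2_set (\<lambda>i. cmod (?f i)) F \<le> ell2_norm Idx \<phi>" if F: "finite F" "F \<subseteq> Idx" for F
    proof -
      have inj: "inj_on ?s F" by (auto simp: inj_on_def)
      have "L2_set (\<lambda>i. cmod (?f i)) F = L2_set (\<lambda>i. cmod (\<phi> i)) (?s ` F)"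
        unfolding L2_set_def sum.reindex[OF inj] by (simp add: case_prod_unfold)
      also have "\<dots> \<le> ell2_norm Idx \<phi>"
        using F by (intro ell2_L2_set_le \<phi>) (auto simp: orbit_indices_def)
      finally show ?thesis .
    qed
    show "?f \<in> ell2 Idx" by (rule ell2_memI_mem[OF 0 ell2_norm_nonneg *])
    show "ell2_norm Idx ?f \<le> 1 * ell2_norm Idx \<phi>"
      using ell2_norm_leI[OF 0 ell2_norm_nonneg *] by simp
  qed simp
  have mult: "op_bound Idx (\<lambda>\<phi> i. f i * \<phi> i) C" if "0 \<le> C" "\<And>i. cmod (f i) \<le> C" for f C
  proof (rule op_boundI[OF that(1)])
    fix \<phi> assume \<phi>: "\<phi> \<in> ell2 Idx"
    have 0: "f i * \<phi> i = 0" if "i \<notin> Idx" for i using ell2_outside[OF \<phi> that] by simp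
    have le: "cmod (f i * \<phi> i) \<le> C * cmod (\<phi> i)" for i
      by (simp add: norm_mult that mult_right_mono)
    show "(\<lambda>i. f i * \<phi> i) \<in> ell2 Idx" by (rule ell2_dominated_mem[OF \<phi> 0 that(1) le])
    show "ell2_norm Idx (\<lambda>i. f i * \<phi> i) \<le> C * ell2_norm Idx \<phi>"
      by (rule ell2_dominated_norm[OF \<phi> 0 that(1) le])
  qed
  have M: "\<exists>C. op_bound Idx (letter_op (Gen (GenM f))) C \<and> op_bound Idx (letter_op (Adj (GenM f))) C"
    if f: "f \<in> cont_padic p" for f
  proof -
    obtain C where C: "0 \<le> C" "\<And>x. cmod (f x) \<le> C" using cont_padic_bounded[OF f] by blast
    show ?thesis
      using mult[OF C(1), of "\<lambda>i. f (pt i)"] mult[OF C(1), of "\<lambda>i. cnj (f (pt i))"] C(2)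
      by (intro exI[of _ C]) (simp add: fun_eq_iff[symmetric] op_bound_def)
  qed
  have V: "op_bound Idx (letter_op (Gen GenV)) 1" "op_bound Idx (letter_op (Adj GenV)) 1"
    using shift[of "-1"] shift[of 1] by (simp_all add: op_bound_def)
  show ?thesis using assms M V by (fastforce simp: crossed_gens_def)
qed

lemma letter_op_adjoint:
  assumes "\<phi> \<in> ell2 Idx" "\<psi> \<in> ell2 Idx"
  shows "ell2_inner Idx (letter_op (Gen g) \<phi>) \<psi> = ell2_inner Idx \<phi> (letter_op (Adj g) \<psi>)"
proof (cases g)
  case (GenM f)
  then show ?thesis by (simp add: ell2_inner_def mult_ac)
next
  case GenV
  \<comment> \<open>Replacing \<open>k\<close> by \<open>k + 1\<close> permutes the index set
    because \<open>k\<close> ranges over all integers; the reindexed sum is the one for the inverse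
    shift.\<close>
  have "bij_betw (\<lambda>(k, L, c). (k + 1, L, c) :: orbit_index) Idx Idx"
    by (rule bij_betwI[where g="\<lambda>(k, L, c). (k - 1, L, c)"]) (auto simp: orbit_indices_def)
  from infsum_reindex_bij_betw[OF this, of "\<lambda>i. letter_op (Gen GenV) \<phi> i * cnj (\<psi> i)"]
  show ?thesis by (simp add: GenV ell2_inner_def case_prod_unfold)
qed

text \<open>The claims are proved together: the case \<open>fstar\<close> exchanges \<open>x\<close>
  with its adjoint, so bounds for both must be available, and for products the intermediate vectors
  must be square summable before the adjoint identity applies to them.\<close>

lemma rep_bounded_adjoint:
  assumes "x \<in> free_carrier (crossed_gens p)"
  shows "(\<exists>C. op_bound Idx (rep x) C) \<and> (\<exists>C. op_bound Idx (rep (fstar x)) C) \<and>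
    (\<forall>\<phi>\<in>ell2 Idx. \<forall>\<psi>\<in>ell2 Idx. ell2_inner Idx (rep x \<phi>) \<psi> = ell2_inner Idx \<phi> (rep (fstar x) \<psi>))"
  using assms
proof (induction rule: free_carrier_induct)
  case one
  have "op_bound Idx (\<lambda>\<phi>. \<phi>) 1" by (simp add: op_bound_def)
  then show ?case by auto
next
  case (fgen g)
  then have g: "Gen g \<in> Gen ` crossed_gens p \<union> Adj ` crossed_gens p"
    "Adj g \<in> Gen ` crossed_gens p \<union> Adj ` crossed_gens p" by auto
  have "rep (fgen g) = letter_op (Gen g)" "rep (fstar (fgen g)) = letter_op (Adj g)"
    by (simp_all add: fun_eq_iff rep_fgen rep_fstar_fgen)
  with letter_op_bound[OF g(1)] letter_op_bound[OF g(2)] letter_op_adjoint show ?case by simp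
next
  case (add x y)
  from add obtain C D C' D' where b: "op_bound Idx (rep x) C" "op_bound Idx (rep y) D"
    "op_bound Idx (rep (fstar x)) C'" "op_bound Idx (rep (fstar y)) D'" by blast
  have "op_bound Idx (rep (x + y)) (C + D)" "op_bound Idx (rep (fstar (x + y))) (C' + D')"
    using op_bound_add[OF b(1,2)] op_bound_add[OF b(3,4)] by (simp_all add: rep_add fstar_add op_bound_def)
  moreover have "\<forall>\<phi>\<in>ell2 Idx. \<forall>\<psi>\<in>ell2 Idx. ell2_inner Idx (rep (x + y) \<phi>) \<psi> = ell2_inner Idx \<phi> (rep (fstar (x + y)) \<psi>)"
    using add b by (simp add: rep_add fstar_add ell2_inner_add_left ell2_inner_add_right op_bound_mem)
  ultimately show ?case by blast
next
  case (mult x y)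
  from mult obtain C D C' D' where b: "op_bound Idx (rep x) C" "op_bound Idx (rep y) D"
    "op_bound Idx (rep (fstar x)) C'" "op_bound Idx (rep (fstar y)) D'" by blast
  have "op_bound Idx (rep (x * y)) (C * D)" "op_bound Idx (rep (fstar (x * y))) (D' * C')"
    using op_bound_comp[OF b(1,2)] op_bound_comp[OF b(4,3)] by (simp_all add: rep_mult fstar_mult op_bound_def)
  moreover have "\<forall>\<phi>\<in>ell2 Idx. \<forall>\<psi>\<in>ell2 Idx. ell2_inner Idx (rep (x * y) \<phi>) \<psi> = ell2_inner Idx \<phi> (rep (fstar (x * y)) \<psi>)"
    using mult b by (simp add: rep_mult fstar_mult op_bound_mem)
  ultimately show ?case by blast
next
  case (fscale c x)
  from fscale obtain C C' where b: "op_bound Idx (rep x) C" "op_bound Idx (rep (fstar x)) C'" by blast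
  have "op_bound Idx (rep (fscale c x)) (cmod c * C)"
    "op_bound Idx (rep (fstar (fscale c x))) (cmod (cnj c) * C')"
    using op_bound_scale[OF b(1), of c] op_bound_scale[OF b(2), of "cnj c"]
    by (simp_all add: rep_fscale fstar_fscale op_bound_def)
  moreover have "\<forall>\<phi>\<in>ell2 Idx. \<forall>\<psi>\<in>ell2 Idx. ell2_inner Idx (rep (fscale c x) \<phi>) \<psi> = ell2_inner Idx \<phi> (rep (fstar (fscale c x)) \<psi>)"
    using fscale by (simp add: rep_fscale fstar_fscale ell2_inner_scale_left ell2_inner_scale_right)
  ultimately show ?case by blast
next
  case (fstar x)
  have "ell2_inner Idx (rep (fstar x) \<phi>) \<psi> = ell2_inner Idx \<phi> (rep x \<psi>)"
    if "\<phi> \<in> ell2 Idx" "\<psi> \<in> ell2 Idx" for \<phi> \<psi>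
    using fstar that by (simp add: ell2_inner_commute[of _ _ \<psi>] ell2_inner_commute[of _ \<phi>])
  then show ?case using fstar by simp
qed

definition rep_norm :: "crossed_gen free_alg \<Rightarrow> real" where
  "rep_norm x = op_norm Idx (rep x)"

lemma rep_bound:
  "x \<in> free_carrier (crossed_gens p) \<Longrightarrow> op_bound Idx (rep x) (rep_norm x)"
  unfolding rep_norm_def using rep_bounded_adjoint op_bound_op_norm by blast

lemma rep_norm_le: "op_bound Idx (rep x) C \<Longrightarrow> rep_norm x \<le> C"
  unfolding rep_norm_def by (rule op_norm_le)

lemma rep_adjoint:
  "x \<in> free_carrier (crossed_gens p) \<Longrightarrow> \<phi> \<in> ell2 Idx \<Longrightarrow> \<psi> \<in> ell2 Idx \<Longrightarrow>
   ell2_inner Idx (rep x \<phi>) \<psi> = ell2_inner Idx \<phi> (rep (fstar x) \<psi>)"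
  using rep_bounded_adjoint by blast

lemma rep_norm_fscale_le:
  assumes "x \<in> free_carrier (crossed_gens p)"
  shows "rep_norm (fscale c x) \<le> cmod c * rep_norm x"
  using op_bound_scale[OF rep_bound[OF assms], of c]
  by (intro rep_norm_le) (simp add: op_bound_def rep_fscale)

lemma cstar_seminorm_rep_norm: "cstar_seminorm (crossed_gens p) rep_norm"
  unfolding cstar_seminorm_def
proof (intro conjI ballI allI)
  fix x y assume x: "x \<in> free_carrier (crossed_gens p)" and y: "y \<in> free_carrier (crossed_gens p)"
  show "rep_norm (x + y) \<le> rep_norm x + rep_norm y"
    using op_bound_add[OF rep_bound[OF x] rep_bound[OF y]]
    by (intro rep_norm_le) (simp add: op_bound_def rep_add)
  show "rep_norm (x * y) \<le> rep_norm x * rep_norm y"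
    using op_bound_comp[OF rep_bound[OF x] rep_bound[OF y]]
    by (intro rep_norm_le) (simp add: op_bound_def rep_mult)
next
  fix x assume x: "x \<in> free_carrier (crossed_gens p)"
  show 0: "0 \<le> rep_norm x" by (rule op_bound_nonneg[OF rep_bound[OF x]])
  show "rep_norm (fstar x * x) = (rep_norm x)\<^sup>2"
    using op_norm_cstar[OF rep_bound[OF x] rep_bound[OF free_carrier_fstar[OF x]] rep_adjoint[OF x]]
    by (simp add: rep_norm_def rep_mult cong: op_norm_cong)
  fix c
  show "rep_norm (fscale c x) = cmod c * rep_norm x"
  proof (cases "c = 0")
    case True
    have "rep_norm 0 \<le> 0" by (rule rep_norm_le) (simp add: op_bound_def)
    then show ?thesis
      using True op_bound_nonneg[OF rep_bound[OF free_carrier_zero]] by simp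
  next
    case False
    have "rep_norm x \<le> cmod (inverse c) * rep_norm (fscale c x)"
      using rep_norm_fscale_le[OF free_carrier_fscale[OF x], of "inverse c" c] False by simp
    then have "cmod c * rep_norm x \<le> rep_norm (fscale c x)"
      using False by (simp add: norm_divide field_simps)
    with rep_norm_fscale_le[OF x, of c] show ?thesis by simp
  qed
qed

text \<open>Outside the index set nothing is known about \<open>pt\<close>, so the unit and
  covariance relations rely there on the vanishing of the vector.\<close>

lemma rep_crossed_rels:
  assumes "y \<in> crossed_rels p r" and \<phi>: "\<phi> \<in> ell2 Idx"
  shows "rep y \<phi> = (\<lambda>i. 0)"
proof -
  note simps = rep_diff rep_add rep_mult rep_fscale rep_fgen rep_fstar_fgen fun_eq_iff
  have out: "\<phi> i = 0" if "i \<notin> Idx" for i by (rule ell2_outside[OF \<phi> that])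
  have one: "indicator Zp (pt i) * \<phi> i = \<phi> i" for i
    using point_mem[of i] out[of i] by (cases "i \<in> Idx") auto
  have dil: "f (pt (k - 1, L, c)) * \<phi> (k, L, c) = dilate p r f (pt (k, L, c)) * \<phi> (k, L, c)" for f k L c
    using dilate_point[of k L c f] out[of "(k, L, c)"] by (cases "(k, L, c) \<in> Idx") auto
  show ?thesis
    using assms(1) unfolding crossed_rels_def
    by (elim UnE) (auto simp: simps one dil distrib_right mult.assoc)
qed

lemma rep_norm_crossed_rels:
  assumes "y \<in> crossed_rels p r" shows "rep_norm y = 0"
proof (rule antisym)
  have b: "op_bound Idx (rep y) 0" using rep_crossed_rels[OF assms] by (simp add: op_bound_def)
  then show "rep_norm y \<le> 0" by (rule rep_norm_le)
  show "0 \<le> rep_norm y"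
    unfolding rep_norm_def by (rule op_bound_nonneg[OF op_bound_op_norm[OF b]])
qed

end

section \<open>The universal seminorm\<close>

context orbit_section
begin

text \<open>
  Modulo the relations, a word equals \<open>M\<^sub>f V\<^sup>n\<close>, where \<open>f\<close> and \<open>n\<close> are computed by pushing the
  letters \<open>V\<close> and \<open>V\<^sup>*\<close> to the right.
\<close>

fun nf_fun :: "crossed_gen letter list \<Rightarrow> padic_seq \<Rightarrow> complex" where
  "nf_fun [] = indicator Zp"
| "nf_fun (Gen GenV # ls) = dilate p r (nf_fun ls)"
| "nf_fun (Adj GenV # ls) = dilate p s (nf_fun ls)"
| "nf_fun (Gen (GenM f) # ls) = (\<lambda>x. f x * nf_fun ls x)"
| "nf_fun (Adj (GenM f) # ls) = (\<lambda>x. cnj (f x) * nf_fun ls x)"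

fun nf_exp :: "crossed_gen letter list \<Rightarrow> int" where
  "nf_exp [] = 0"
| "nf_exp (Gen GenV # ls) = nf_exp ls + 1"
| "nf_exp (Adj GenV # ls) = nf_exp ls - 1"
| "nf_exp (Gen (GenM f) # ls) = nf_exp ls"
| "nf_exp (Adj (GenM f) # ls) = nf_exp ls"

lemma nf_exp_le: "\<bar>nf_exp ls\<bar> \<le> int (length ls)"
  by (induction ls rule: nf_exp.induct) auto

lemma nf_fun_cont:
  assumes "set ls \<subseteq> Gen ` crossed_gens p \<union> Adj ` crossed_gens p"
  shows "nf_fun ls \<in> cont_padic p"
  using assms
proof (induction ls rule: nf_fun.induct)
  case 1
  show ?case by (simp add: cont_padic_indicator)
next
  case (2 ls)
  then show ?case by (simp add: cont_padic_dilate)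
next
  case (3 ls)
  then show ?case by (simp add: cont_padic_dilate)
next
  case (4 f ls)
  then show ?case by (auto simp: crossed_gens_def intro!: cont_padic_mult)
next
  case (5 f ls)
  then show ?case by (auto simp: crossed_gens_def intro!: cont_padic_mult cont_padic_cnj)
qed

text \<open>The recursions for \<open>nf_fun\<close> and \<open>nf_exp\<close> mirror the letters: a
  shift of \<open>k\<close> turns evaluation at the orbit point into evaluation of a dilated
  function. On a unit vector the formula isolates the words of one given exponent.\<close>

lemma foldr_letter_op_nf:
  assumes "(k, L, c) \<in> Idx"
  shows "foldr letter_op ls \<phi> (k, L, c) = nf_fun ls (pt (k, L, c)) * \<phi> (k - nf_exp ls, L, c)"
  using assms
proof (induction ls arbitrary: k rule: nf_fun.induct)
  case 1
  then show ?case by (simp add: point_mem)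
next
  case (2 ls)
  have "(k - 1, L, c) \<in> Idx" using 2(2) by (simp add: orbit_indices_def)
  from 2(1)[OF this] show ?case using dilate_point[OF 2(2)] by (simp add: algebra_simps)
next
  case (3 ls)
  have "(k + 1, L, c) \<in> Idx" using 3(2) by (simp add: orbit_indices_def)
  from 3(1)[OF this] show ?case using dilate_inv_point[OF 3(2)] by (simp add: algebra_simps)
qed simp_all

text \<open>The coefficient function of the \<open>n\<close>-th power of \<open>V\<close> once all
  words of \<open>x\<close> are in normal form.\<close>

definition nf_coeff :: "crossed_gen free_alg \<Rightarrow> int \<Rightarrow> padic_seq \<Rightarrow> complex" where
  "nf_coeff x n = (\<lambda>t. \<Sum>w\<in>{w \<in> Poly_Mapping.keys x. nf_exp (letters w) = n}.
     Poly_Mapping.lookup x w * nf_fun (letters w) t)"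

lemma nf_coeff_cont:
  assumes "x \<in> free_carrier (crossed_gens p)" shows "nf_coeff x n \<in> cont_padic p"
  unfolding nf_coeff_def using assms
  by (auto intro!: cont_padic_sum cont_padic_scale nf_fun_cont simp: free_carrier_def)

text \<open>The values of the coefficient functions on the orbits are matrix coefficients.\<close>

lemma nf_coeff_le:
  assumes x: "x \<in> free_carrier (crossed_gens p)" and t: "t \<in> Zp"
  shows "cmod (nf_coeff x n t) \<le> rep_norm x"
proof (rule cont_padic_bound_of_points[OF nf_coeff_cont[OF x] _ t])
  fix i assume i: "i \<in> Idx"
  obtain k L c where klc: "i = (k, L, c)" by (cases i)
  have i': "(k - n, L, c) \<in> Idx" using i klc by (simp add: orbit_indices_def)
  let ?u = "ell2_unit (k - n, L, c)"
  have "rep x ?u (k, L, c)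
      = (\<Sum>w\<in>Poly_Mapping.keys x. if nf_exp (letters w) = n
          then Poly_Mapping.lookup x w * nf_fun (letters w) (pt (k, L, c)) else 0)"
    unfolding rep_def word_op_def foldr_letter_op_nf[OF i[unfolded klc]]
    by (intro sum.cong) (auto simp: ell2_unit_def)
  also have "\<dots> = nf_coeff x n (pt i)"
    unfolding nf_coeff_def klc by (intro sum.inter_filter[symmetric]) simp
  finally have "cmod (nf_coeff x n (pt i)) \<le> ell2_norm Idx (rep x ?u)"
    using ell2_coord_le[OF op_bound_mem[OF rep_bound[OF x] ell2_unit_mem[OF i']], of "(k, L, c)"] by simp
  also have "\<dots> \<le> rep_norm x * ell2_norm Idx ?u"
    by (rule op_bound_le[OF rep_bound[OF x] ell2_unit_mem[OF i']])
  finally show "cmod (nf_coeff x n (pt i)) \<le> rep_norm x" using ell2_norm_unit[OF i'] by simp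
qed

end

text \<open>An arbitrary competitor in the supremum defining the universal seminorm; only the
  C*-axioms and the vanishing on the relations are available.\<close>

locale crossed_seminorm = orbit_section + cstar_seminorm_on "crossed_gens p" \<rho> for \<rho> +
  assumes rels: "\<And>y. y \<in> crossed_rels p r \<Longrightarrow> \<rho> y = 0"
begin

abbreviation "FC \<equiv> free_carrier (crossed_gens p)"
abbreviation "V \<equiv> fgen GenV"
abbreviation "M f \<equiv> fgen (GenM f)"

text \<open>Equality in the quotient by the null space of \<open>\<rho>\<close>, without forming
  that quotient. Membership in \<open>FC\<close> is built in, so the congruence rules for sums and
  products carry no side conditions.\<close>

definition eqv :: "crossed_gen free_alg \<Rightarrow> crossed_gen free_alg \<Rightarrow> bool" (infix \<open>\<simeq>\<close> 50) where
  "x \<simeq> y \<longleftrightarrow> x \<in> FC \<and> y \<in> FC \<and> \<rho> (x - y) = 0"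

lemma eqvI: "x \<in> FC \<Longrightarrow> y \<in> FC \<Longrightarrow> \<rho> (x - y) \<le> 0 \<Longrightarrow> x \<simeq> y"
  unfolding eqv_def by (intro conjI antisym nonneg free_carrier_diff)

lemma eqv_refl [simp]: "x \<in> FC \<Longrightarrow> x \<simeq> x"
  by (simp add: eqv_def)

lemma eqv_sym: "x \<simeq> y \<Longrightarrow> y \<simeq> x"
  by (auto simp: eqv_def minus_commute)

lemma eqv_trans [trans]: assumes "x \<simeq> y" "y \<simeq> z" shows "x \<simeq> z"
proof -
  have "\<rho> (x - z) \<le> 0" using triangle_diff[of x y z] assms by (simp add: eqv_def)
  then show ?thesis using assms by (intro eqvI) (auto simp: eqv_def)
qed

lemma eqv_add: assumes "x \<simeq> x'" "y \<simeq> y'" shows "x + y \<simeq> x' + y'"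
proof -
  have "\<rho> ((x - x') + (y - y')) \<le> 0"
    using triangle[of "x - x'" "y - y'"] assms by (simp add: eqv_def)
  then have "\<rho> ((x + y) - (x' + y')) \<le> 0" by (simp add: algebra_simps)
  then show ?thesis using assms by (intro eqvI) (auto simp: eqv_def)
qed

lemma eqv_mult: assumes "x \<simeq> x'" "y \<simeq> y'" shows "x * y \<simeq> x' * y'"
proof -
  have "\<rho> (x * y - x' * y') \<le> 0" using mult_diff_le[of x y x' y'] assms by (simp add: eqv_def)
  then show ?thesis using assms by (intro eqvI) (auto simp: eqv_def)
qed

lemma eqv_fscale: "x \<simeq> y \<Longrightarrow> fscale c x \<simeq> fscale c y"
  by (auto simp: eqv_def scale simp flip: fscale_diff)

lemma eqv_sum: "(\<And>a. a \<in> A \<Longrightarrow> f a \<simeq> g a) \<Longrightarrow> (\<Sum>a\<in>A. f a) \<simeq> (\<Sum>a\<in>A. g a)"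
  by (induction A rule: infinite_finite_induct) (auto intro: eqv_add)

lemma eqv_norm: assumes "x \<simeq> y" shows "\<rho> x = \<rho> y"
  using triangle_diff[of x y 0] triangle_diff[of y x 0] assms minus_commute[of x y]
  by (auto simp: eqv_def)

section \<open>Consequences of the crossed product relations\<close>

lemma V_FC [simp]: "V \<in> FC"
  by (simp add: crossed_gens_def)

lemma M_FC [simp]: "f \<in> cont_padic p \<Longrightarrow> M f \<in> FC"
  by (simp add: crossed_gens_def)

lemma eqv_relI: "x - y \<in> crossed_rels p r \<Longrightarrow> x \<in> FC \<Longrightarrow> y \<in> FC \<Longrightarrow> x \<simeq> y"
  by (simp add: eqv_def rels)

lemma M_add:
  assumes "f \<in> cont_padic p" "g \<in> cont_padic p"
  shows "M (\<lambda>x. f x + g x) \<simeq> M f + M g"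
proof (rule eqv_relI)
  show "M (\<lambda>x. f x + g x) - (M f + M g) \<in> crossed_rels p r"
    unfolding crossed_rels_def
    by (rule UnI1, rule UnI1, rule UnI1, rule UnI1, rule UnI1, rule UnI1, rule CollectI, rule exI[of _ f], rule exI[of _ g], intro conjI refl assms)
qed (use assms in \<open>simp_all add: cont_padic_add\<close>)

lemma M_scale:
  assumes "f \<in> cont_padic p"
  shows "M (\<lambda>x. c * f x) \<simeq> fscale c (M f)"
proof (rule eqv_relI)
  show "M (\<lambda>x. c * f x) - (fscale c (M f)) \<in> crossed_rels p r"
    unfolding crossed_rels_def
    by (rule UnI1, rule UnI1, rule UnI1, rule UnI1, rule UnI1, rule UnI2, rule CollectI, rule exI[of _ c], rule exI[of _ f], intro conjI refl assms)
qed (use assms in \<open>simp_all add: cont_padic_scale\<close>)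

lemma M_mult:
  assumes "f \<in> cont_padic p" "g \<in> cont_padic p"
  shows "M (\<lambda>x. f x * g x) \<simeq> M f * M g"
proof (rule eqv_relI)
  show "M (\<lambda>x. f x * g x) - (M f * M g) \<in> crossed_rels p r"
    unfolding crossed_rels_def
    by (rule UnI1, rule UnI1, rule UnI1, rule UnI1, rule UnI2, rule CollectI, rule exI[of _ f], rule exI[of _ g], intro conjI refl assms)
qed (use assms in \<open>simp_all add: cont_padic_mult\<close>)

lemma M_cnj:
  assumes "f \<in> cont_padic p"
  shows "M (\<lambda>x. cnj (f x)) \<simeq> fstar (M f)"
proof (rule eqv_relI)
  show "M (\<lambda>x. cnj (f x)) - (fstar (M f)) \<in> crossed_rels p r"
    unfolding crossed_rels_def
    by (rule UnI1, rule UnI1, rule UnI1, rule UnI2, rule CollectI, rule exI[of _ f], intro conjI refl assms)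
qed (use assms in \<open>simp_all add: cont_padic_cnj\<close>)

lemma M_one: "M (indicator Zp) \<simeq> 1"
proof (rule eqv_relI)
  show "M (indicator Zp) - (1) \<in> crossed_rels p r"
    unfolding crossed_rels_def
    by (rule UnI1, rule UnI1, rule UnI2, rule singletonI)
qed (simp_all add: cont_padic_indicator)

lemma V_isometry: "fstar V * V \<simeq> 1"
proof (rule eqv_relI)
  show "fstar V * V - (1) \<in> crossed_rels p r"
    unfolding crossed_rels_def
    by (rule UnI1, rule UnI2, rule singletonI)
qed (simp_all)

lemma V_covariance:
  assumes "f \<in> cont_padic p"
  shows "V * M f * fstar V \<simeq> M (dilate p r f)"
proof (rule eqv_relI)
  show "V * M f * fstar V - (M (dilate p r f)) \<in> crossed_rels p r"
    unfolding crossed_rels_def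
    by (rule UnI2, rule CollectI, rule exI[of _ f], intro conjI refl assms)
qed (use assms in \<open>simp_all add: cont_padic_dilate\<close>)

lemma V_coisometry: "V * fstar V \<simeq> 1"
proof -
  have "V * fstar V = V * 1 * fstar V" by simp
  also have "V * 1 * fstar V \<simeq> V * M (indicator Zp) * fstar V"
    by (intro eqv_mult eqv_refl eqv_sym[OF M_one]) auto
  also have "\<dots> \<simeq> M (indicator Zp)"
    using V_covariance[OF cont_padic_indicator] by (simp add: dilate_indicator)
  also note M_one
  finally show ?thesis .
qed

lemma V_M_commute:
  assumes f: "f \<in> cont_padic p" shows "V * M f \<simeq> M (dilate p r f) * V"
proof -
  have "V * M f = V * M f * 1" by simp
  also have "V * M f * 1 \<simeq> V * M f * (fstar V * V)"
    using f by (intro eqv_mult eqv_refl eqv_sym[OF V_isometry]) auto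
  also have "V * M f * (fstar V * V) = V * M f * fstar V * V" by (simp add: mult.assoc)
  also have "\<dots> \<simeq> M (dilate p r f) * V"
    by (intro eqv_mult V_covariance f) simp
  finally show ?thesis .
qed

text \<open>Covariance, read backwards, turns \<open>M f\<close> into
  \<open>V * M g * fstar V\<close> with \<open>g\<close> the dilation of \<open>f\<close> by the
  inverse of \<open>r\<close>; the isometry relation cancels the leading
  \<open>fstar V * V\<close>.\<close>

lemma V_star_M_commute:
  assumes f: "f \<in> cont_padic p" shows "fstar V * M f \<simeq> M (dilate p s f) * fstar V"
proof -
  let ?g = "dilate p s f"
  have g: "?g \<in> cont_padic p" by (rule cont_padic_dilate[OF f]) simp
  have "fstar V * M f \<simeq> fstar V * (V * M ?g * fstar V)"
    using V_covariance[OF g] dilate_dilate_inv[OF f r_Units]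
    by (intro eqv_mult eqv_refl eqv_sym[of "V * M ?g * fstar V" "M f"]) simp_all
  also have "\<dots> = fstar V * V * M ?g * fstar V" by (simp add: mult.assoc)
  also have "\<dots> \<simeq> 1 * M ?g * fstar V"
    using g by (intro eqv_mult V_isometry eqv_refl) auto
  also have "1 * M ?g * fstar V = M ?g * fstar V" by simp
  finally show ?thesis .
qed

text \<open>The generator has no inverse in the free algebra, so negative powers are spelled with
  its formal adjoint; modulo the null space they are the powers of a unitary.\<close>

definition Vpow :: "int \<Rightarrow> crossed_gen free_alg" where
  "Vpow n = (if 0 \<le> n then V ^ nat n else fstar V ^ nat (- n))"

lemma Vpow_FC [simp]: "Vpow n \<in> FC"
  by (simp add: Vpow_def)

lemma V_Vpow: "V * Vpow n \<simeq> Vpow (n + 1)"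
proof (cases "0 \<le> n")
  case True
  then have "V * Vpow n = Vpow (n + 1)" by (simp add: Vpow_def nat_add_distrib)
  then show ?thesis by simp
next
  case False
  \<comment> \<open>For a negative exponent one factor \<open>fstar V\<close> is split off on the
    left and absorbed by coisometry; \<open>m\<close> counts the remaining factors.\<close>
  define m where "m = nat (- n - 1)"
  have m: "n = - int m - 1" using False by (simp add: m_def)
  have "nat (- n) = Suc m" using m by simp
  then have "V * Vpow n = V * fstar V * fstar V ^ m" using m by (simp add: Vpow_def mult.assoc)
  also have "\<dots> \<simeq> 1 * fstar V ^ m" by (intro eqv_mult V_coisometry) simp
  also have "1 * fstar V ^ m = Vpow (n + 1)" using m by (simp add: Vpow_def)
  finally show ?thesis .
qed

lemma V_star_Vpow: "fstar V * Vpow n \<simeq> Vpow (n - 1)"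
proof (cases "0 < n")
  case True
  define m where "m = nat (n - 1)"
  have m: "n = int m + 1" using True by (simp add: m_def)
  have "nat n = Suc m" using m by simp
  then have "fstar V * Vpow n = fstar V * V * V ^ m" using m by (simp add: Vpow_def mult.assoc)
  also have "\<dots> \<simeq> 1 * V ^ m" by (intro eqv_mult V_isometry) simp
  also have "1 * V ^ m = Vpow (n - 1)" using m by (simp add: Vpow_def)
  finally show ?thesis .
next
  case False
  then have "nat (- (n - 1)) = Suc (nat (- n))" by simp
  then have "fstar V * Vpow n = Vpow (n - 1)" using False by (cases "n = 0") (simp_all add: Vpow_def)
  then show ?thesis by simp
qed

lemma word_nf:
  assumes "set ls \<subseteq> Gen ` crossed_gens p \<union> Adj ` crossed_gens p"
  shows "Poly_Mapping.single (Word ls) 1 \<simeq> M (nf_fun ls) * Vpow (nf_exp ls)"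
  using assms
proof (induction ls)
  case Nil
  have "1 * 1 \<simeq> M (indicator Zp) * Vpow 0"
    by (intro eqv_mult eqv_sym[OF M_one]) (simp add: Vpow_def)
  then show ?case by (simp add: single_Nil del: single_one)
next
  case (Cons l ls)
  let ?f = "nf_fun ls" and ?n = "nf_exp ls"
  from Cons.prems have ls: "set ls \<subseteq> Gen ` crossed_gens p \<union> Adj ` crossed_gens p" by simp
  note f = nf_fun_cont[OF ls]
  have l: "Poly_Mapping.single (Word [l]) 1 \<in> FC"
    using Cons.prems by (intro free_carrier_single) simp
  have "Poly_Mapping.single (Word (l # ls)) 1 \<simeq> Poly_Mapping.single (Word [l]) 1 * (M ?f * Vpow ?n)"
    using Cons.IH[OF ls] l by (subst single_Cons) (intro eqv_mult eqv_refl)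
  also have "Poly_Mapping.single (Word [l]) 1 * (M ?f * Vpow ?n) = Poly_Mapping.single (Word [l]) 1 * M ?f * Vpow ?n"
    by (simp add: mult.assoc)
  also have "\<dots> \<simeq> M (nf_fun (l # ls)) * Vpow (nf_exp (l # ls))"
  proof (cases l)
    case (Gen g)
    then have lg: "Poly_Mapping.single (Word [l]) 1 = fgen g" by (simp add: fgen_def)
    show ?thesis
    proof (cases g)
      case (GenM h)
      then have "h \<in> cont_padic p" using Cons.prems Gen by (auto simp: crossed_gens_def)
      then show ?thesis using f unfolding lg by (simp add: Gen GenM eqv_mult eqv_sym[OF M_mult])
    next
      case GenV
      have "V * M ?f * Vpow ?n \<simeq> M (dilate p r ?f) * V * Vpow ?n"
        by (intro eqv_mult V_M_commute f) simp
      also have "\<dots> = M (dilate p r ?f) * (V * Vpow ?n)" by (simp add: mult.assoc)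
      also have "\<dots> \<simeq> M (dilate p r ?f) * Vpow (?n + 1)"
        using f by (intro eqv_mult V_Vpow) (simp add: cont_padic_dilate)
      finally show ?thesis unfolding lg by (simp add: Gen GenV)
    qed
  next
    case (Adj g)
    then have lg: "Poly_Mapping.single (Word [l]) 1 = fstar (fgen g)" by (simp add: fstar_fgen)
    show ?thesis
    proof (cases g)
      case (GenM h)
      then have h: "h \<in> cont_padic p" using Cons.prems Adj by (auto simp: crossed_gens_def)
      have "fstar (M h) * M ?f \<simeq> M (\<lambda>x. cnj (h x)) * M ?f"
        using f h by (intro eqv_mult eqv_sym[OF M_cnj]) auto
      also have "\<dots> \<simeq> M (\<lambda>x. cnj (h x) * ?f x)"
        by (intro eqv_sym[OF M_mult] cont_padic_cnj f h)
      finally show ?thesis unfolding lg by (simp add: Adj GenM eqv_mult)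
    next
      case GenV
      have "fstar V * M ?f * Vpow ?n \<simeq> M (dilate p s ?f) * fstar V * Vpow ?n"
        by (intro eqv_mult V_star_M_commute f) simp
      also have "\<dots> = M (dilate p s ?f) * (fstar V * Vpow ?n)" by (simp add: mult.assoc)
      also have "\<dots> \<simeq> M (dilate p s ?f) * Vpow (?n - 1)"
        using f by (intro eqv_mult V_star_Vpow) (simp add: cont_padic_dilate)
      finally show ?thesis unfolding lg by (simp add: Adj GenV)
    qed
  qed
  finally show ?case .
qed

section \<open>Norm estimates for the terms of the normal form\<close>

lemma M_zero: "M (\<lambda>x. 0) \<simeq> 0"
  using M_scale[OF cont_padic_indicator, of 0] by simp

lemma M_sum:
  assumes "finite A" "\<And>a. a \<in> A \<Longrightarrow> f a \<in> cont_padic p"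
  shows "M (\<lambda>x. \<Sum>a\<in>A. f a x) \<simeq> (\<Sum>a\<in>A. M (f a))"
  using assms
proof (induction A)
  case (insert a A)
  have "M (\<lambda>x. f a x + (\<Sum>b\<in>A. f b x)) \<simeq> M (f a) + M (\<lambda>x. \<Sum>b\<in>A. f b x)"
    using insert.prems by (intro M_add cont_padic_sum) auto
  also have "\<dots> \<simeq> M (f a) + (\<Sum>b\<in>A. M (f b))"
    using insert by (intro eqv_add) auto
  finally show ?case using insert.hyps by simp
qed (simp add: M_zero)

text \<open>Such a function gives an isometry in the quotient, since \<open>cnj (u x) * u x\<close>
  is the indicator of the p-adic integers, which represents 1; the C*-identity does the
  rest.\<close>

lemma norm_M_unimodular:
  assumes u: "u \<in> cont_padic p" and 1: "\<And>x. x \<in> Zp \<Longrightarrow> cmod (u x) = 1"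
  shows "\<rho> (M u) \<le> 1"
proof -
  have "cnj (u x) * u x = indicator Zp x" for x
  proof (cases "x \<in> Zp")
    case True
    then show ?thesis using 1[OF True] complex_norm_square[of "u x"] by (simp add: mult.commute)
  next
    case False
    then show ?thesis using u by (simp add: cont_padic_def)
  qed
  then have eq: "(\<lambda>x. cnj (u x) * u x) = indicator Zp" by auto
  have "fstar (M u) * M u \<simeq> M (\<lambda>x. cnj (u x)) * M u"
    using u by (intro eqv_mult eqv_sym[OF M_cnj]) auto
  also have "\<dots> \<simeq> M (\<lambda>x. cnj (u x) * u x)" by (intro eqv_sym[OF M_mult] cont_padic_cnj u)
  also have "M (\<lambda>x. cnj (u x) * u x) \<simeq> 1" unfolding eq by (rule M_one)
  finally have "(\<rho> (M u))\<^sup>2 = \<rho> 1" using cstar[OF M_FC[OF u]] eqv_norm by metis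
  then have "(\<rho> (M u))\<^sup>2 \<le> 1\<^sup>2" using one_le by simp
  then show ?thesis by (rule power2_le_imp_le) simp
qed

text \<open>A real function of modulus at most 1 is the mean of two unimodular functions.\<close>

lemma norm_M_real:
  assumes g: "(\<lambda>x. complex_of_real (g x)) \<in> cont_padic p" and 1: "\<And>x. \<bar>g x\<bar> \<le> 1"
  shows "\<rho> (M (\<lambda>x. complex_of_real (g x))) \<le> 1"
proof -
  \<comment> \<open>The point of the upper unit semicircle with real part \<open>g x\<close>.
    Outside the p-adic integers \<open>g\<close> vanishes and this point would be
    \<open>Complex 0 1\<close>; the indicator restores the extension by zero.\<close>
  define u where "u = (\<lambda>x. indicator Zp x * Complex (g x) (sqrt (1 - (g x)\<^sup>2)))"
  have cg: "continuous_on Zp g"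
    using continuous_on_Re[of Zp "\<lambda>x. complex_of_real (g x)"] g by (simp add: cont_padic_def)
  have "continuous_on Zp (\<lambda>x. Complex (g x) (sqrt (1 - (g x)\<^sup>2)))"
    unfolding Complex_eq by (intro continuous_intros cg)
  then have "continuous_on Zp u" by (rule continuous_on_eq) (simp add: u_def)
  then have u: "u \<in> cont_padic p" by (simp add: cont_padic_def u_def)
  have un: "cmod (u x) = 1" if "x \<in> Zp" for x
    using 1[of x] that by (simp add: u_def cmod_def abs_square_le_1)
  have eq: "complex_of_real (g x) = (1/2) * u x + (1/2) * cnj (u x)" for x
  proof (cases "x \<in> Zp")
    case True
    then show ?thesis by (simp add: u_def complex_eq_iff)
  next
    case False
    then show ?thesis using g by (simp add: u_def cont_padic_def)
  qed
  have "M (\<lambda>x. (1/2) * u x + (1/2) * cnj (u x)) \<simeq> M (\<lambda>x. (1/2) * u x) + M (\<lambda>x. (1/2) * cnj (u x))"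
    by (intro M_add cont_padic_scale cont_padic_cnj u)
  also have "\<dots> \<simeq> fscale (1/2) (M u) + fscale (1/2) (M (\<lambda>x. cnj (u x)))"
    by (intro eqv_add M_scale cont_padic_cnj u)
  finally have "\<rho> (M (\<lambda>x. complex_of_real (g x))) = \<rho> (fscale (1/2) (M u) + fscale (1/2) (M (\<lambda>x. cnj (u x))))"
    unfolding eq by (rule eqv_norm)
  also have "\<dots> \<le> \<rho> (fscale (1/2) (M u)) + \<rho> (fscale (1/2) (M (\<lambda>x. cnj (u x))))"
    using u by (intro triangle) (auto simp: cont_padic_cnj)
  also have "\<dots> \<le> 1/2 * 1 + 1/2 * 1"
    using norm_M_unimodular[OF u un] norm_M_unimodular[OF cont_padic_cnj[OF u]] un u
    by (simp add: scale cont_padic_cnj)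
  finally show ?thesis by simp
qed

text \<open>The factor 2 comes from estimating real and imaginary parts separately, each normalised
  by \<open>C\<close>; it is absorbed when roots are taken in
  \<open>cstar_seminorm_le_of_linear_bound\<close>.\<close>

lemma norm_M_le:
  assumes f: "f \<in> cont_padic p" and C: "0 \<le> C" "\<And>x. x \<in> Zp \<Longrightarrow> cmod (f x) \<le> C"
  shows "\<rho> (M f) \<le> 2 * C"
proof (cases "C = 0")
  case True
  have "f x = 0" for x
    using C(2)[of x] f True by (cases "x \<in> Zp") (auto simp: cont_padic_def)
  then have "f = (\<lambda>x. 0)" by (rule ext)
  then show ?thesis using eqv_norm[OF M_zero] True by simp
next
  case False
  then have pos: "0 < C" using C by simp
  have le: "cmod (f x) \<le> C" for x using C f by (cases "x \<in> Zp") (auto simp: cont_padic_def)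
  define g where "g = (\<lambda>x. Re (f x) / C)"
  define h where "h = (\<lambda>x. Im (f x) / C)"
  have g: "(\<lambda>x. complex_of_real (g x)) \<in> cont_padic p" and h: "(\<lambda>x. complex_of_real (h x)) \<in> cont_padic p"
    using f pos by (auto simp: cont_padic_def g_def h_def intro!: continuous_intros)
  have g1: "\<bar>g x\<bar> \<le> 1" and h1: "\<bar>h x\<bar> \<le> 1" for x
    using le[of x] abs_Re_le_cmod[of "f x"] abs_Im_le_cmod[of "f x"] pos by (auto simp: g_def h_def)
  have eq: "f = (\<lambda>x. of_real C * of_real (g x) + (\<i> * of_real C) * of_real (h x))"
    using pos by (auto simp: g_def h_def complex_eq_iff)
  have "M f \<simeq> M (\<lambda>x. of_real C * of_real (g x)) + M (\<lambda>x. (\<i> * of_real C) * of_real (h x))"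
    by (subst eq) (intro M_add cont_padic_scale g h)
  also have "\<dots> \<simeq> fscale (of_real C) (M (\<lambda>x. of_real (g x))) + fscale (\<i> * of_real C) (M (\<lambda>x. of_real (h x)))"
    by (intro eqv_add M_scale g h)
  finally have "\<rho> (M f) = \<rho> (fscale (of_real C) (M (\<lambda>x. of_real (g x))) + fscale (\<i> * of_real C) (M (\<lambda>x. of_real (h x))))"
    by (rule eqv_norm)
  also have "\<dots> \<le> \<rho> (fscale (of_real C) (M (\<lambda>x. of_real (g x)))) + \<rho> (fscale (\<i> * of_real C) (M (\<lambda>x. of_real (h x))))"
    using g h by (intro triangle) auto
  also have "\<dots> = C * \<rho> (M (\<lambda>x. of_real (g x))) + C * \<rho> (M (\<lambda>x. of_real (h x)))"
    using g h pos by (simp add: scale norm_mult)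
  also have "\<dots> \<le> C * 1 + C * 1"
    using pos by (intro add_mono mult_left_mono norm_M_real g h g1 h1) auto
  finally show ?thesis by simp
qed

lemma norm_Vpow_le: "\<rho> (Vpow n) \<le> 1"
proof -
  have "(\<rho> V)\<^sup>2 = \<rho> 1" using cstar[OF V_FC] eqv_norm[OF V_isometry] by simp
  then have "(\<rho> V)\<^sup>2 \<le> 1\<^sup>2" using one_le by simp
  then have V1: "\<rho> V \<le> 1" by (rule power2_le_imp_le) simp
  have pow: "\<rho> (x ^ m) \<le> 1" if "x \<in> FC" "\<rho> x \<le> 1" for x m
  proof (induction m)
    case (Suc m)
    have "\<rho> (x * x ^ m) \<le> \<rho> x * \<rho> (x ^ m)" using that by (intro submult) auto
    also have "\<dots> \<le> 1 * 1" using that Suc by (intro mult_mono) auto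
    finally show ?case by simp
  qed (simp add: one_le)
  show ?thesis using V1 by (simp add: Vpow_def pow)
qed

text \<open>Words are collected by net exponent, which their length bounds. The estimate for
  \<open>x\<close> thus depends on the number of exponents, however many words occur.\<close>

lemma nf_sum:
  assumes x: "x \<in> FC" and N: "degree_le N x"
  shows "x \<simeq> (\<Sum>n\<in>{- int N..int N}. M (nf_coeff x n) * Vpow n)"
proof -
  let ?K = "Poly_Mapping.keys x" and ?c = "Poly_Mapping.lookup x"
  let ?f = "\<lambda>w. nf_fun (letters w)" and ?n = "\<lambda>w. nf_exp (letters w)"
  have w: "set (letters w) \<subseteq> Gen ` crossed_gens p \<union> Adj ` crossed_gens p" if "w \<in> ?K" for w
    using x that by (auto simp: free_carrier_def)
  note fw = nf_fun_cont[OF w]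
  have "x = (\<Sum>w\<in>?K. fscale (?c w) (Poly_Mapping.single (Word (letters w)) 1))"
    using poly_mapping_sum_single[of x] by (simp add: fscale_single)
  also have "\<dots> \<simeq> (\<Sum>w\<in>?K. fscale (?c w) (M (?f w) * Vpow (?n w)))"
    by (intro eqv_sum eqv_fscale word_nf w)
  also have "\<dots> \<simeq> (\<Sum>w\<in>?K. M (\<lambda>t. ?c w * ?f w t) * Vpow (?n w))"
    unfolding fscale_mult_left[symmetric]
    by (intro eqv_sum eqv_mult eqv_sym[OF M_scale] fw) simp_all
  also have "\<dots> = (\<Sum>n\<in>{- int N..int N}. \<Sum>w\<in>{w\<in>?K. ?n w = n}. M (\<lambda>t. ?c w * ?f w t) * Vpow (?n w))"
  proof (rule sum.group[symmetric])
    show "?n ` ?K \<subseteq> {- int N..int N}"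
    proof
      fix m assume "m \<in> ?n ` ?K"
      then obtain w where "w \<in> ?K" "m = ?n w" by auto
      then show "m \<in> {- int N..int N}"
        using nf_exp_le[of "letters w"] N by (fastforce simp: degree_le_def)
    qed
  qed auto
  also have "\<dots> \<simeq> (\<Sum>n\<in>{- int N..int N}. M (nf_coeff x n) * Vpow n)"
  proof (rule eqv_sum)
    fix n
    have "(\<Sum>w\<in>{w\<in>?K. ?n w = n}. M (\<lambda>t. ?c w * ?f w t) * Vpow (?n w))
        = (\<Sum>w\<in>{w\<in>?K. ?n w = n}. M (\<lambda>t. ?c w * ?f w t)) * Vpow n"
      by (simp add: sum_distrib_right)
    also have "\<dots> \<simeq> M (nf_coeff x n) * Vpow n"
      unfolding nf_coeff_def
      by (intro eqv_mult eqv_sym[OF M_sum] cont_padic_scale fw) auto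
    finally show "(\<Sum>w\<in>{w\<in>?K. ?n w = n}. M (\<lambda>t. ?c w * ?f w t) * Vpow (?n w)) \<simeq> M (nf_coeff x n) * Vpow n" .
  qed
  finally show ?thesis .
qed

lemma norm_le_linear:
  assumes x: "x \<in> FC" and N: "degree_le N x"
  shows "\<rho> x \<le> 2 * (2 * real N + 1) * rep_norm x"
proof -
  have pos: "0 \<le> rep_norm x" by (rule op_bound_nonneg[OF rep_bound[OF x]])
  have "\<rho> x = \<rho> (\<Sum>n\<in>{- int N..int N}. M (nf_coeff x n) * Vpow n)"
    by (rule eqv_norm[OF nf_sum[OF x N]])
  also have "\<dots> \<le> (\<Sum>n\<in>{- int N..int N}. \<rho> (M (nf_coeff x n) * Vpow n))"
    by (rule sum_le) (simp add: nf_coeff_cont[OF x])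
  also have "\<dots> \<le> (\<Sum>n\<in>{- int N..int N}. 2 * rep_norm x)"
  proof (rule sum_mono)
    fix n
    have "\<rho> (M (nf_coeff x n) * Vpow n) \<le> \<rho> (M (nf_coeff x n)) * \<rho> (Vpow n)"
      by (rule submult) (simp_all add: nf_coeff_cont[OF x])
    also have "\<dots> \<le> (2 * rep_norm x) * 1"
      using pos by (intro mult_mono norm_M_le norm_Vpow_le nf_coeff_cont nf_coeff_le x) auto
    finally show "\<rho> (M (nf_coeff x n) * Vpow n) \<le> 2 * rep_norm x" by simp
  qed
  also have "\<dots> = 2 * (2 * real N + 1) * rep_norm x" by simp
  finally show ?thesis .
qed

end

context orbit_section
begin

lemma seminorm_le_rep_norm:
  assumes "cstar_seminorm (crossed_gens p) \<rho>" "\<And>y. y \<in> crossed_rels p r \<Longrightarrow> \<rho> y = 0"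
    and "x \<in> free_carrier (crossed_gens p)"
  shows "\<rho> x \<le> rep_norm x"
proof -
  interpret crossed_seminorm p r \<gamma> \<rho> by unfold_locales (fact assms)+
  show ?thesis
    by (rule cstar_seminorm_le_of_linear_bound[OF assms(1) cstar_seminorm_rep_norm norm_le_linear assms(3)])
qed

text \<open>The representation norm is itself one of the competing seminorms, so the supremum is a
  maximum and in particular finite.\<close>

lemma univ_seminorm_eq_rep_norm:
  assumes "x \<in> free_carrier (crossed_gens p)"
  shows "univ_seminorm (crossed_gens p) (crossed_rels p r) x = rep_norm x"
  unfolding univ_seminorm_def
proof (rule cSup_eq_maximum)
  show "rep_norm x \<in> (\<lambda>\<rho>. \<rho> x) ` {\<rho>. cstar_seminorm (crossed_gens p) \<rho> \<and> (\<forall>y\<in>crossed_rels p r. \<rho> y = 0)}"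
    using cstar_seminorm_rep_norm rep_norm_crossed_rels by blast
qed (use seminorm_le_rep_norm assms in blast)

end

section \<open>The Hausdorff completion\<close>

lemma star_homD:
  assumes "h \<in> star_hom A B"
  shows star_hom_closed: "\<And>a. a \<in> carrier A \<Longrightarrow> h a \<in> carrier B"
    and star_hom_mult: "\<And>a b. a \<in> carrier A \<Longrightarrow> b \<in> carrier A \<Longrightarrow> h (a \<otimes>\<^bsub>A\<^esub> b) = h a \<otimes>\<^bsub>B\<^esub> h b"
    and star_hom_add: "\<And>a b. a \<in> carrier A \<Longrightarrow> b \<in> carrier A \<Longrightarrow> h (a \<oplus>\<^bsub>A\<^esub> b) = h a \<oplus>\<^bsub>B\<^esub> h b"
    and star_hom_one: "h \<one>\<^bsub>A\<^esub> = \<one>\<^bsub>B\<^esub>"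
    and star_hom_smult: "\<And>a c. a \<in> carrier A \<Longrightarrow> h (c \<odot>\<^bsub>A\<^esub> a) = c \<odot>\<^bsub>B\<^esub> h a"
    and star_hom_star: "\<And>a. a \<in> carrier A \<Longrightarrow> h (star A a) = star B (h a)"
  using assms by (auto simp: star_hom_def ring_hom_def)

lemma bounded_op_alg_simps [simp]:
  "carrier (bounded_op_alg I) = bounded_ops I"
  "S \<otimes>\<^bsub>bounded_op_alg I\<^esub> T = (\<lambda>\<phi>\<in>ell2 I. S (T \<phi>))"
  "\<one>\<^bsub>bounded_op_alg I\<^esub> = (\<lambda>\<phi>\<in>ell2 I. \<phi>)"
  "S \<oplus>\<^bsub>bounded_op_alg I\<^esub> T = (\<lambda>\<phi>\<in>ell2 I. \<lambda>i. S \<phi> i + T \<phi> i)"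
  "c \<odot>\<^bsub>bounded_op_alg I\<^esub> T = (\<lambda>\<phi>\<in>ell2 I. \<lambda>i. c * T \<phi> i)"
  "star (bounded_op_alg I) T = hilbert_adjoint I T"
  by (simp_all add: bounded_op_alg_def)

text \<open>For arbitrary relations the defining supremum may run over an unbounded set, where its
  value carries no information. The C*-axioms are therefore assumed; the crossed product obtains
  them from \<open>rep_norm\<close>.\<close>

locale universal_cstar =
  fixes G :: "'g set" and R :: "'g free_alg set"
  assumes univ: "cstar_seminorm G (univ_seminorm G R)"
begin

abbreviation "U \<equiv> univ_seminorm G R"
abbreviation "FA \<equiv> free_carrier G"
abbreviation "Alg \<equiv> univ_cstar G R"

sublocale cstar_seminorm_on G U
  by unfold_locales (rule univ)

definition cls :: "(nat \<Rightarrow> 'g free_alg) \<Rightarrow> (nat \<Rightarrow> 'g free_alg) set" where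
  "cls X = univ_rel G R `` {X}"

lemma cauchyI:
  "(\<And>n. X n \<in> FA) \<Longrightarrow> (\<And>e. e > 0 \<Longrightarrow> \<exists>N. \<forall>m\<ge>N. \<forall>n\<ge>N. U (X m - X n) < e) \<Longrightarrow>
   X \<in> univ_cauchy G R"
  by (simp add: univ_cauchy_def)

lemma cauchy_FA: "X \<in> univ_cauchy G R \<Longrightarrow> X n \<in> FA"
  by (simp add: univ_cauchy_def)

lemma cauchyE:
  assumes "X \<in> univ_cauchy G R" "e > 0"
  obtains N where "\<And>m n. m \<ge> N \<Longrightarrow> n \<ge> N \<Longrightarrow> U (X m - X n) < e"
  using assms unfolding univ_cauchy_def by blast

lemma cauchy_const: "x \<in> FA \<Longrightarrow> (\<lambda>_. x) \<in> univ_cauchy G R"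
  by (auto intro: cauchyI)

lemma cauchy_add:
  assumes X: "X \<in> univ_cauchy G R" and Y: "Y \<in> univ_cauchy G R"
  shows "(\<lambda>n. X n + Y n) \<in> univ_cauchy G R"
proof (rule cauchyI)
  fix e :: real assume "e > 0"
  then have e: "e / 2 > 0" by simp
  obtain N where N: "\<And>m n. m \<ge> N \<Longrightarrow> n \<ge> N \<Longrightarrow> U (X m - X n) < e / 2" using cauchyE[OF X e] by blast
  obtain N' where N': "\<And>m n. m \<ge> N' \<Longrightarrow> n \<ge> N' \<Longrightarrow> U (Y m - Y n) < e / 2" using cauchyE[OF Y e] by blast
  have "U (X m + Y m - (X n + Y n)) < e" if "m \<ge> max N N'" "n \<ge> max N N'" for m n
  proof -
    have "U ((X m - X n) + (Y m - Y n)) \<le> U (X m - X n) + U (Y m - Y n)"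
      by (intro triangle free_carrier_diff cauchy_FA X Y)
    also have "\<dots> < e" using N[of m n] N'[of m n] that by simp
    finally show ?thesis by (simp add: algebra_simps)
  qed
  then show "\<exists>N. \<forall>m\<ge>N. \<forall>n\<ge>N. U (X m + Y m - (X n + Y n)) < e" by blast
qed (simp add: cauchy_FA X Y)

lemma cauchy_fscale:
  assumes X: "X \<in> univ_cauchy G R"
  shows "(\<lambda>n. fscale c (X n)) \<in> univ_cauchy G R"
proof (rule cauchyI)
  fix e :: real assume e: "e > 0"
  have "e / (cmod c + 1) > 0" using e norm_ge_zero[of c] by (intro divide_pos_pos) linarith+
  then obtain N where N: "\<And>m n. m \<ge> N \<Longrightarrow> n \<ge> N \<Longrightarrow> U (X m - X n) < e / (cmod c + 1)"
    using cauchyE[OF X] by blast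
  have "U (fscale c (X m) - fscale c (X n)) < e" if "m \<ge> N" "n \<ge> N" for m n
  proof -
    have p: "0 < cmod c + 1" using norm_ge_zero[of c] by linarith
    have nn: "0 \<le> U (X m - X n)" by (intro nonneg free_carrier_diff cauchy_FA X)
    have "U (fscale c (X m) - fscale c (X n)) = cmod c * U (X m - X n)"
      unfolding fscale_diff[symmetric] by (intro scale free_carrier_diff cauchy_FA X)
    also have "\<dots> \<le> (cmod c + 1) * U (X m - X n)" using nn by (intro mult_right_mono) auto
    also have "\<dots> < e" using N[OF that] p by (simp add: pos_less_divide_eq mult.commute)
    finally show ?thesis .
  qed
  then show "\<exists>N. \<forall>m\<ge>N. \<forall>n\<ge>N. U (fscale c (X m) - fscale c (X n)) < e" by blast
qed (simp add: cauchy_FA X)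

lemma cauchy_fstar:
  assumes X: "X \<in> univ_cauchy G R"
  shows "(\<lambda>n. fstar (X n)) \<in> univ_cauchy G R"
  using X by (auto simp: univ_cauchy_def simp flip: fstar_diff)

lemma cauchy_bounded:
  assumes X: "X \<in> univ_cauchy G R"
  obtains B where "0 < B" "\<And>n. U (X n) \<le> B"
proof -
  obtain N where N: "\<And>m n. m \<ge> N \<Longrightarrow> n \<ge> N \<Longrightarrow> U (X m - X n) < 1"
    using cauchyE[OF X zero_less_one] by blast
  define B where "B = Max ((\<lambda>n. U (X n)) ` {..N}) + 1"
  have small: "U (X n) \<le> B - 1" if "n \<le> N" for n
    using that by (auto simp: B_def)
  have "U (X n) \<le> B" for n
  proof (cases "n \<le> N")
    case False
    have "U (X n - 0) \<le> U (X n - X N) + U (X N - 0)"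
      by (rule triangle_diff) (simp_all add: cauchy_FA X)
    then show ?thesis using N[of n N] small[of N] False by simp
  qed (use small in fastforce)
  moreover have "0 < B" using small[of 0] nonneg[OF cauchy_FA[OF X, of 0]] by linarith
  ultimately show thesis by (rule that[rotated])
qed

lemma cauchy_mult:
  assumes X: "X \<in> univ_cauchy G R" and Y: "Y \<in> univ_cauchy G R"
  shows "(\<lambda>n. X n * Y n) \<in> univ_cauchy G R"
proof (rule cauchyI)
  fix e :: real assume e0: "e > 0"
  obtain B where B: "0 < B" "\<And>n. U (X n) \<le> B" using cauchy_bounded[OF X] by blast
  obtain C where C: "0 < C" "\<And>n. U (Y n) \<le> C" using cauchy_bounded[OF Y] by blast
  define d where "d = e / (B + C)"
  have d: "d > 0" using e0 B C by (simp add: d_def)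
  obtain N where N: "\<And>m n. m \<ge> N \<Longrightarrow> n \<ge> N \<Longrightarrow> U (X m - X n) < d" using cauchyE[OF X d] by blast
  obtain N' where N': "\<And>m n. m \<ge> N' \<Longrightarrow> n \<ge> N' \<Longrightarrow> U (Y m - Y n) < d" using cauchyE[OF Y d] by blast
  have "U (X m * Y m - X n * Y n) < e" if "m \<ge> max N N'" "n \<ge> max N N'" for m n
  proof -
    have "U (X m * Y m - X n * Y n) \<le> U (X m) * U (Y m - Y n) + U (X m - X n) * U (Y n)"
      by (intro mult_diff_le cauchy_FA X Y)
    also have "\<dots> \<le> B * U (Y m - Y n) + U (X m - X n) * C"
      by (intro add_mono mult_right_mono mult_left_mono B C nonneg free_carrier_diff cauchy_FA X Y)
    also have "\<dots> < B * d + d * C"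
      using N[of m n] N'[of m n] that B C by (intro add_strict_mono) auto
    also have "\<dots> = d * (B + C)" by (simp add: algebra_simps)
    also have "\<dots> = e" using B C by (simp add: d_def)
    finally show ?thesis .
  qed
  then show "\<exists>N. \<forall>m\<ge>N. \<forall>n\<ge>N. U (X m * Y m - X n * Y n) < e" by blast
qed (simp add: cauchy_FA X Y)

lemma cauchy_shift:
  assumes X: "X \<in> univ_cauchy G R" shows "(\<lambda>n. X (n + k)) \<in> univ_cauchy G R"
proof (rule cauchyI)
  fix e :: real assume "e > 0"
  then obtain N where "\<And>m n. m \<ge> N \<Longrightarrow> n \<ge> N \<Longrightarrow> U (X m - X n) < e" using cauchyE[OF X] by blast
  then show "\<exists>N. \<forall>m\<ge>N. \<forall>n\<ge>N. U (X (m + k) - X (n + k)) < e"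
    by (intro exI[of _ N]) auto
qed (simp add: cauchy_FA X)

lemma null_add:
  assumes "\<And>n. X n \<in> FA" "\<And>n. Y n \<in> FA" "(\<lambda>n. U (X n)) \<longlonglongrightarrow> 0" "(\<lambda>n. U (Y n)) \<longlonglongrightarrow> 0"
  shows "(\<lambda>n. U (X n + Y n)) \<longlonglongrightarrow> 0"
proof (rule tendsto_sandwich[OF _ _ tendsto_const])
  show "(\<lambda>n. U (X n) + U (Y n)) \<longlonglongrightarrow> 0" using tendsto_add[OF assms(3,4)] by simp
  show "\<forall>\<^sub>F n in sequentially. 0 \<le> U (X n + Y n)"
    by (intro always_eventually allI nonneg free_carrier_add assms(1,2))
  show "\<forall>\<^sub>F n in sequentially. U (X n + Y n) \<le> U (X n) + U (Y n)"
    by (intro always_eventually allI triangle assms(1,2))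
qed

section \<open>Classes of Cauchy sequences and their algebra\<close>

lemma univ_rel_iff:
  "(X, Y) \<in> univ_rel G R \<longleftrightarrow> X \<in> univ_cauchy G R \<and> Y \<in> univ_cauchy G R \<and> (\<lambda>n. U (X n - Y n)) \<longlonglongrightarrow> 0"
  by (auto simp: univ_rel_def)

lemma equiv_univ_rel: "equiv (univ_cauchy G R) (univ_rel G R)"
proof (rule equivI)
  show "univ_rel G R \<subseteq> univ_cauchy G R \<times> univ_cauchy G R" by (auto simp: univ_rel_iff)
  show "refl_on (univ_cauchy G R) (univ_rel G R)" by (auto simp: refl_on_def univ_rel_iff)
  show "sym (univ_rel G R)"
  proof (rule symI)
    fix X Y assume XY: "(X, Y) \<in> univ_rel G R"
    then have "U (Y n - X n) = U (X n - Y n)" for n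
      by (intro minus_commute cauchy_FA) (auto simp: univ_rel_iff)
    with XY show "(Y, X) \<in> univ_rel G R" by (simp add: univ_rel_iff)
  qed
  show "trans (univ_rel G R)"
  proof (rule transI)
    fix X Y Z assume XY: "(X, Y) \<in> univ_rel G R" and YZ: "(Y, Z) \<in> univ_rel G R"
    then have FA: "X n \<in> FA" "Y n \<in> FA" "Z n \<in> FA" for n
      by (auto simp: univ_rel_iff intro: cauchy_FA)
    have "(\<lambda>n. U ((X n - Y n) + (Y n - Z n))) \<longlonglongrightarrow> 0"
      using XY YZ FA by (intro null_add) (auto simp: univ_rel_iff)
    then show "(X, Z) \<in> univ_rel G R" using XY YZ by (simp add: univ_rel_iff)
  qed
qed

lemma cls_eq_iff:
  assumes "X \<in> univ_cauchy G R" "Y \<in> univ_cauchy G R"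
  shows "cls X = cls Y \<longleftrightarrow> (\<lambda>n. U (X n - Y n)) \<longlonglongrightarrow> 0"
  unfolding cls_def using eq_equiv_class_iff[OF equiv_univ_rel assms] assms by (simp add: univ_rel_iff)

lemma mem_cls: "Y \<in> cls X \<Longrightarrow> X \<in> univ_cauchy G R \<and> Y \<in> univ_cauchy G R \<and> cls Y = cls X"
  unfolding cls_def using equiv_class_eq[OF equiv_univ_rel] by (auto simp: univ_rel_iff)

lemma cls_self: "X \<in> univ_cauchy G R \<Longrightarrow> X \<in> cls X"
  by (simp add: cls_def univ_rel_iff)

lemma carrier_Alg: "carrier Alg = cls ` univ_cauchy G R"
  by (auto simp: univ_cstar_def quotient_def cls_def)

lemma univ_emb_eq: "univ_emb G R x = cls (\<lambda>_. x)"
  by (simp add: univ_emb_def cls_def)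

text \<open>The operations of \<open>univ_cstar\<close> are unions over all representatives.
  Independence of the representatives makes all members of such a union the same class, and the
  union collapses.\<close>

lemma cls_cong_add:
  assumes "X' \<in> cls X" "Y' \<in> cls Y"
  shows "cls (\<lambda>n. X' n + Y' n) = cls (\<lambda>n. X n + Y n)"
proof (subst cls_eq_iff)
  have *: "X \<in> univ_cauchy G R" "X' \<in> univ_cauchy G R" "Y \<in> univ_cauchy G R" "Y' \<in> univ_cauchy G R"
    "cls X' = cls X" "cls Y' = cls Y" using assms mem_cls by blast+
  have "(\<lambda>n. U ((X' n - X n) + (Y' n - Y n))) \<longlonglongrightarrow> 0"
    using * by (intro null_add) (auto simp: cauchy_FA cls_eq_iff)
  then show "(\<lambda>n. U (X' n + Y' n - (X n + Y n))) \<longlonglongrightarrow> 0" by (simp add: algebra_simps)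
qed (use assms mem_cls in \<open>blast intro: cauchy_add\<close>)+

lemma cls_cong_fscale:
  assumes "X' \<in> cls X"
  shows "cls (\<lambda>n. fscale c (X' n)) = cls (\<lambda>n. fscale c (X n))"
proof (subst cls_eq_iff)
  have *: "X \<in> univ_cauchy G R" "X' \<in> univ_cauchy G R" "cls X' = cls X" using assms mem_cls by blast+
  then have "(\<lambda>n. cmod c * U (X' n - X n)) \<longlonglongrightarrow> cmod c * 0"
    by (intro tendsto_mult tendsto_const) (simp add: cls_eq_iff)
  moreover have "U (fscale c (X' n) - fscale c (X n)) = cmod c * U (X' n - X n)" for n
    unfolding fscale_diff[symmetric] using * by (intro scale free_carrier_diff cauchy_FA)
  ultimately show "(\<lambda>n. U (fscale c (X' n) - fscale c (X n))) \<longlonglongrightarrow> 0" by simp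
qed (use assms mem_cls in \<open>blast intro: cauchy_fscale\<close>)+

lemma cls_cong_fstar:
  assumes "X' \<in> cls X"
  shows "cls (\<lambda>n. fstar (X' n)) = cls (\<lambda>n. fstar (X n))"
proof (subst cls_eq_iff)
  have *: "X \<in> univ_cauchy G R" "X' \<in> univ_cauchy G R" "cls X' = cls X" using assms mem_cls by blast+
  then have "U (fstar (X' n) - fstar (X n)) = U (X' n - X n)" for n
    unfolding fstar_diff[symmetric] by (intro star free_carrier_diff cauchy_FA)
  with * show "(\<lambda>n. U (fstar (X' n) - fstar (X n))) \<longlonglongrightarrow> 0" by (simp add: cls_eq_iff)
qed (use assms mem_cls in \<open>blast intro: cauchy_fstar\<close>)+

lemma cls_cong_mult:
  assumes "X' \<in> cls X" "Y' \<in> cls Y"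
  shows "cls (\<lambda>n. X' n * Y' n) = cls (\<lambda>n. X n * Y n)"
proof (subst cls_eq_iff)
  have *: "X \<in> univ_cauchy G R" "X' \<in> univ_cauchy G R" "Y \<in> univ_cauchy G R" "Y' \<in> univ_cauchy G R"
    "cls X' = cls X" "cls Y' = cls Y" using assms mem_cls by blast+
  obtain B where B: "0 < B" "\<And>n. U (X' n) \<le> B" using cauchy_bounded[OF *(2)] by blast
  obtain C where C: "0 < C" "\<And>n. U (Y n) \<le> C" using cauchy_bounded[OF *(3)] by blast
  show "(\<lambda>n. U (X' n * Y' n - X n * Y n)) \<longlonglongrightarrow> 0"
  proof (rule tendsto_sandwich[OF _ _ tendsto_const])
    have "(\<lambda>n. B * U (Y' n - Y n) + U (X' n - X n) * C) \<longlonglongrightarrow> B * 0 + 0 * C"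
      using * by (intro tendsto_intros) (simp_all add: cls_eq_iff)
    then show "(\<lambda>n. B * U (Y' n - Y n) + U (X' n - X n) * C) \<longlonglongrightarrow> 0" by simp
    show "\<forall>\<^sub>F n in sequentially. 0 \<le> U (X' n * Y' n - X n * Y n)"
      by (intro always_eventually allI nonneg free_carrier_diff free_carrier_mult cauchy_FA *)
    show "\<forall>\<^sub>F n in sequentially. U (X' n * Y' n - X n * Y n) \<le> B * U (Y' n - Y n) + U (X' n - X n) * C"
    proof (intro always_eventually allI)
      fix n
      have "U (X' n * Y' n - X n * Y n) \<le> U (X' n) * U (Y' n - Y n) + U (X' n - X n) * U (Y n)"
        by (intro mult_diff_le cauchy_FA *)
      also have "\<dots> \<le> B * U (Y' n - Y n) + U (X' n - X n) * C"
        by (intro add_mono mult_right_mono mult_left_mono B C nonneg free_carrier_diff cauchy_FA *)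
      finally show "U (X' n * Y' n - X n * Y n) \<le> B * U (Y' n - Y n) + U (X' n - X n) * C" .
    qed
  qed
qed (use assms mem_cls in \<open>blast intro: cauchy_mult\<close>)+

lemma cls_add:
  assumes "X \<in> univ_cauchy G R" "Y \<in> univ_cauchy G R"
  shows "cls X \<oplus>\<^bsub>Alg\<^esub> cls Y = cls (\<lambda>n. X n + Y n)"
proof -
  have "cls X \<oplus>\<^bsub>Alg\<^esub> cls Y = (\<Union>X'\<in>cls X. \<Union>Y'\<in>cls Y. cls (\<lambda>n. X' n + Y' n))"
    by (simp add: univ_cstar_def cls_def)
  also have "\<dots> = cls (\<lambda>n. X n + Y n)"
    using assms by (auto simp: cls_cong_add cls_self dest: cls_self)
  finally show ?thesis .
qed

lemma cls_mult:
  assumes "X \<in> univ_cauchy G R" "Y \<in> univ_cauchy G R"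
  shows "cls X \<otimes>\<^bsub>Alg\<^esub> cls Y = cls (\<lambda>n. X n * Y n)"
proof -
  have "cls X \<otimes>\<^bsub>Alg\<^esub> cls Y = (\<Union>X'\<in>cls X. \<Union>Y'\<in>cls Y. cls (\<lambda>n. X' n * Y' n))"
    by (simp add: univ_cstar_def cls_def)
  also have "\<dots> = cls (\<lambda>n. X n * Y n)"
    using assms by (auto simp: cls_cong_mult cls_self dest: cls_self)
  finally show ?thesis .
qed

lemma cls_smult:
  assumes "X \<in> univ_cauchy G R"
  shows "c \<odot>\<^bsub>Alg\<^esub> cls X = cls (\<lambda>n. fscale c (X n))"
proof -
  have "c \<odot>\<^bsub>Alg\<^esub> cls X = (\<Union>X'\<in>cls X. cls (\<lambda>n. fscale c (X' n)))"
    by (simp add: univ_cstar_def cls_def)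
  also have "\<dots> = cls (\<lambda>n. fscale c (X n))"
    using assms by (auto simp: cls_cong_fscale dest: cls_self)
  finally show ?thesis .
qed

lemma cls_star:
  assumes "X \<in> univ_cauchy G R"
  shows "star Alg (cls X) = cls (\<lambda>n. fstar (X n))"
proof -
  have "star Alg (cls X) = (\<Union>X'\<in>cls X. cls (\<lambda>n. fstar (X' n)))"
    by (simp add: univ_cstar_def cls_def)
  also have "\<dots> = cls (\<lambda>n. fstar (X n))"
    using assms by (auto simp: cls_cong_fstar dest: cls_self)
  finally show ?thesis .
qed

lemma one_Alg: "\<one>\<^bsub>Alg\<^esub> = cls (\<lambda>_. 1)"
  by (simp add: univ_cstar_def univ_emb_eq)

lemma cls_mem: "X \<in> univ_cauchy G R \<Longrightarrow> cls X \<in> carrier Alg"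
  by (simp add: carrier_Alg)

text \<open>
  For \<open>\<parallel>a\<parallel> \<le> 1/2\<close> the iteration \<open>y \<mapsto> (a\<^sup>* a + y\<^sup>2)/2\<close>, carried out along a Cauchy sequence
  representing \<open>a\<close>, is a contraction of the ball of radius \<open>1/2\<close>; with its fixed point \<open>y\<close>,
  the self-adjoint element \<open>1 - y\<close> is a square root of \<open>1 - a\<^sup>* a\<close>.
\<close>

lemma sqrt_one_minus:
  assumes X: "X \<in> univ_cauchy G R" and half: "\<And>n. U (X n) \<le> 1/2"
  obtains C where "C \<in> univ_cauchy G R" "\<And>n. fstar (C n) = C n"
    "cls (\<lambda>n. C n * C n + fstar (X n) * X n) = cls (\<lambda>_. 1)"
proof -
  define b where "b = (\<lambda>n. fstar (X n) * X n)"
  have b: "b \<in> univ_cauchy G R" unfolding b_def by (intro cauchy_mult cauchy_fstar X)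
  have Ub: "U (b n) \<le> 1/4" for n
  proof -
    have "U (b n) = (U (X n))\<^sup>2" unfolding b_def by (rule cstar[OF cauchy_FA[OF X]])
    also have "\<dots> \<le> (1/2)\<^sup>2" by (intro power_mono half nonneg cauchy_FA X)
    finally show ?thesis by (simp add: power2_eq_square)
  qed
  have sb: "fstar (b n) = b n" for n by (simp add: b_def fstar_mult)
  \<comment> \<open>Stage \<open>n\<close> uses \<open>b n\<close> in place of its limit: the
    iterates stay in the free algebra, and \<open>y\<close> becomes a single diagonal
    sequence.\<close>
  define y where "y = rec_nat 0 (\<lambda>n z. fscale (1/2) (b n + z * z))"
  have y0: "y 0 = 0" and yS: "y (Suc n) = fscale (1/2) (b n + y n * y n)" for n
    by (simp_all add: y_def)
  have y: "y n \<in> FA" for n by (induction n) (simp_all add: y0 yS cauchy_FA b)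
  have sy: "fstar (y n) = y n" for n
    by (induction n) (simp_all add: y0 yS fstar_fscale fstar_add fstar_mult sb)
  have Uy: "U (y n) \<le> 1/2" for n
  proof (induction n)
    case (Suc n)
    have "U (y n * y n) \<le> U (y n) * U (y n)" by (intro submult y)
    also have "\<dots> \<le> 1/2 * (1/2)" using Suc by (intro mult_mono) (auto simp: y)
    finally have "U (b n + y n * y n) \<le> 1/4 + 1/4"
      using triangle[of "b n" "y n * y n"] Ub[of n] y cauchy_FA[OF b] by simp
    then show ?case by (simp add: yS scale y cauchy_FA[OF b])
  qed (simp add: y0)
  \<comment> \<open>On the ball of radius 1/2 squaring is 1-Lipschitz, so the outer factor 1/2 is
    the contraction constant; the first summand accounts for the moving target
    \<open>b\<close>.\<close>
  have step: "U (y (Suc m) - y (Suc n)) \<le> 1/2 * U (b m - b n) + 1/2 * U (y m - y n)" for m n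
  proof -
    have "U (y m * y m - y n * y n) \<le> U (y m) * U (y m - y n) + U (y m - y n) * U (y n)"
      by (intro mult_diff_le y)
    also have "\<dots> \<le> 1/2 * U (y m - y n) + U (y m - y n) * (1/2)"
      by (intro add_mono mult_right_mono mult_left_mono Uy nonneg free_carrier_diff y)
    finally have sq: "U (y m * y m - y n * y n) \<le> U (y m - y n)" by simp
    have "U (y (Suc m) - y (Suc n)) = 1/2 * U ((b m - b n) + (y m * y m - y n * y n))"
    proof -
      have "y (Suc m) - y (Suc n) = fscale (1/2) ((b m - b n) + (y m * y m - y n * y n))"
        by (simp add: yS algebra_simps flip: fscale_diff)
      then show ?thesis using y cauchy_FA[OF b] by (simp add: scale)
    qed
    also have "\<dots> \<le> 1/2 * (U (b m - b n) + U (y m * y m - y n * y n))"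
      using y cauchy_FA[OF b] by (intro mult_left_mono triangle) auto
    finally show ?thesis using sq by simp
  qed
  have yc: "y \<in> univ_cauchy G R"
  proof (rule cauchyI[OF y])
    fix e :: real assume "e > 0"
    then have e: "e / 2 > 0" by simp
    obtain M where M: "\<And>m n. m \<ge> M \<Longrightarrow> n \<ge> M \<Longrightarrow> U (b m - b n) < e / 2"
      using cauchyE[OF b e] by blast
    \<comment> \<open>The value \<open>e / 2\<close> is the fixed point of the affine map sending t
      to e/4 + t/2; the excess over it is at most 1 at the start and is halved at each
      stage.\<close>
    have decay: "U (y m - y n) \<le> e / 2 + (1/2) ^ k" if "m \<ge> M + k" "n \<ge> M + k" for m n k
      using that
    proof (induction k arbitrary: m n)
      case 0
      have "U (y m - y n) \<le> U (y m) + U (y n)"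
        using triangle[of "y m" "- y n"] y by simp
      then show ?case using Uy[of m] Uy[of n] e by simp
    next
      case (Suc k)
      obtain m' n' where mn: "m = Suc m'" "n = Suc n'" using Suc.prems by (cases m; cases n) auto
      have "U (y m' - y n') \<le> e / 2 + (1/2) ^ k" using Suc mn by auto
      moreover have "U (b m' - b n') < e / 2" using Suc.prems mn by (intro M) auto
      ultimately show ?case using step[of m' n'] by (simp add: mn)
    qed
    obtain k where "(1/2 :: real) ^ k < e / 2" using real_arch_pow_inv[OF e, of "1/2"] by auto
    then have "\<forall>m\<ge>M + k. \<forall>n\<ge>M + k. U (y m - y n) < e" using decay[of k] by fastforce
    then show "\<exists>N. \<forall>m\<ge>N. \<forall>n\<ge>N. U (y m - y n) < e" by blast
  qed
  define C where "C = (\<lambda>n. 1 + fscale (- 1) (y n))"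
  have C: "C \<in> univ_cauchy G R"
    unfolding C_def by (intro cauchy_add cauchy_const cauchy_fscale yc) simp
  have sC: "fstar (C n) = C n" for n by (simp add: C_def fstar_add fstar_fscale sy)
  have "(\<lambda>n. U (y (Suc n) - y n)) \<longlonglongrightarrow> 0"
  proof (rule LIMSEQ_I)
    fix e :: real assume "e > 0"
    then obtain N where N: "\<And>m n. m \<ge> N \<Longrightarrow> n \<ge> N \<Longrightarrow> U (y m - y n) < e" using cauchyE[OF yc] by blast
    show "\<exists>N. \<forall>n\<ge>N. norm (U (y (Suc n) - y n) - 0) < e"
      by (rule exI[of _ N]) (simp add: N y)
  qed
  then have "(\<lambda>n. 2 * U (y (Suc n) - y n)) \<longlonglongrightarrow> 0" by (rule tendsto_mult_right_zero)
  \<comment> \<open>Expanding the square of 1 - y and adding b - 1 leaves b + y^2 - 2y, and the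
    recursion rewrites b + y^2 as twice the next iterate.\<close>
  moreover have "U (C n * C n + b n - 1) = 2 * U (y (Suc n) - y n)" for n
  proof -
    have "fscale 2 (y (Suc n)) = b n + y n * y n" by (simp add: yS)
    moreover have "fscale 2 (y n) = y n + y n" by (rule poly_mapping_eqI) (simp add: lookup_add)
    ultimately have "C n * C n + b n - 1 = fscale 2 (y (Suc n) - y n)"
      by (simp add: C_def fscale_minus_one fscale_diff algebra_simps)
    then show ?thesis using y by (simp add: scale)
  qed
  ultimately have "cls (\<lambda>n. C n * C n + b n) = cls (\<lambda>_. 1)"
    by (subst cls_eq_iff) (simp_all add: cauchy_add cauchy_mult C b cauchy_const)
  then show thesis using that[OF C sC] by (simp add: b_def)
qed

text \<open>The image \<open>S\<close> of the square root is self-adjoint, and together with the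
  image \<open>T\<close> of the given element it satisfies S^2 + T^* T = 1; hence the squared norm
  of \<open>\<phi>\<close> is the sum of those of \<open>S \<phi>\<close> and
  \<open>T \<phi>\<close>. The bound 1/2 is asked of every term because the root is built term by
  term.\<close>

lemma star_hom_contraction:
  assumes h: "h \<in> star_hom Alg (bounded_op_alg I)"
    and X: "X \<in> univ_cauchy G R" and half: "\<And>n. U (X n) \<le> 1/2" and \<phi>: "\<phi> \<in> ell2 I"
  shows "ell2_norm I (h (cls X) \<phi>) \<le> ell2_norm I \<phi>"
proof -
  obtain C where C: "C \<in> univ_cauchy G R" and sC: "\<And>n. fstar (C n) = C n"
    and eq: "cls (\<lambda>n. C n * C n + fstar (X n) * X n) = cls (\<lambda>_. 1)"
    using sqrt_one_minus[OF X half] by blast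
  define S where "S = h (cls C)"
  define T where "T = h (cls X)"
  have S: "S \<in> bounded_ops I" and T: "T \<in> bounded_ops I"
    using star_hom_closed[OF h cls_mem[OF C]] star_hom_closed[OF h cls_mem[OF X]]
    by (simp_all add: S_def T_def)
  have "hilbert_adjoint I S = h (star Alg (cls C))"
    unfolding S_def star_hom_star[OF h cls_mem[OF C]] by simp
  also have "\<dots> = S" by (simp only: cls_star[OF C] sC S_def)
  finally have adjS: "hilbert_adjoint I S = S" .
  have T': "h (cls (\<lambda>n. fstar (X n))) = hilbert_adjoint I T"
    unfolding T_def cls_star[OF X, symmetric] star_hom_star[OF h cls_mem[OF X]] by simp
  have Tb: "hilbert_adjoint I T \<in> bounded_ops I"
    using star_hom_closed[OF h cls_mem[OF cauchy_fstar[OF X]]] by (simp add: T')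
  note [simp] = star_hom_mult[OF h] cls_mem C X cauchy_fstar cauchy_mult
  have "cls (\<lambda>n. C n * C n + fstar (X n) * X n)
      = (cls C \<otimes>\<^bsub>Alg\<^esub> cls C) \<oplus>\<^bsub>Alg\<^esub> (cls (\<lambda>n. fstar (X n)) \<otimes>\<^bsub>Alg\<^esub> cls X)"
    by (simp add: cls_mult cls_add)
  then have "\<one>\<^bsub>Alg\<^esub> = (cls C \<otimes>\<^bsub>Alg\<^esub> cls C) \<oplus>\<^bsub>Alg\<^esub> (cls (\<lambda>n. fstar (X n)) \<otimes>\<^bsub>Alg\<^esub> cls X)"
    using eq by (simp add: one_Alg)
  then have "h \<one>\<^bsub>Alg\<^esub> = h ((cls C \<otimes>\<^bsub>Alg\<^esub> cls C) \<oplus>\<^bsub>Alg\<^esub> (cls (\<lambda>n. fstar (X n)) \<otimes>\<^bsub>Alg\<^esub> cls X))"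
    by (rule arg_cong)
  also have "\<dots> = h (cls C \<otimes>\<^bsub>Alg\<^esub> cls C) \<oplus>\<^bsub>bounded_op_alg I\<^esub> h (cls (\<lambda>n. fstar (X n)) \<otimes>\<^bsub>Alg\<^esub> cls X)"
    by (intro star_hom_add[OF h]) (simp_all add: cls_mult)
  finally have "(\<lambda>\<phi>\<in>ell2 I. \<phi>) = (\<lambda>\<phi>\<in>ell2 I. \<lambda>i. S (S \<phi>) i + hilbert_adjoint I T (T \<phi>) i)"
    by (simp add: star_hom_one[OF h] T' flip: S_def T_def cong: restrict_cong)
  from fun_cong[OF this, of \<phi>] have dec: "\<phi> = (\<lambda>i. S (S \<phi>) i + hilbert_adjoint I T (T \<phi>) i)"
    using \<phi> by simp
  have S\<phi>: "S \<phi> \<in> ell2 I" and T\<phi>: "T \<phi> \<in> ell2 I" using S T \<phi> by (simp_all add: bounded_ops_mem)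
  have "ell2_inner I \<phi> \<phi> = ell2_inner I \<phi> (\<lambda>i. S (S \<phi>) i + hilbert_adjoint I T (T \<phi>) i)"
    using dec by simp
  also have "\<dots> = ell2_inner I \<phi> (S (S \<phi>)) + ell2_inner I \<phi> (hilbert_adjoint I T (T \<phi>))"
    using S S\<phi> Tb T\<phi> \<phi> by (intro ell2_inner_add_right) (simp_all add: bounded_ops_mem)
  also have "\<dots> = ell2_inner I (S \<phi>) (S \<phi>) + ell2_inner I (T \<phi>) (T \<phi>)"
    using hilbert_adjoint[OF S \<phi> S\<phi>] hilbert_adjoint[OF T \<phi> T\<phi>] by (simp add: adjS)
  finally have "complex_of_real ((ell2_norm I \<phi>)\<^sup>2)
      = complex_of_real ((ell2_norm I (S \<phi>))\<^sup>2 + (ell2_norm I (T \<phi>))\<^sup>2)"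
    by (simp add: ell2_inner_self \<phi> S\<phi> T\<phi>)
  then have "(ell2_norm I \<phi>)\<^sup>2 = (ell2_norm I (S \<phi>))\<^sup>2 + (ell2_norm I (T \<phi>))\<^sup>2"
    unfolding of_real_eq_iff .
  then have "(ell2_norm I (T \<phi>))\<^sup>2 \<le> (ell2_norm I \<phi>)\<^sup>2" by simp
  then show ?thesis unfolding T_def by (rule power2_le_imp_le) simp
qed

section \<open>Homomorphisms determined by the generators\<close>

lemma emb_hom:
  shows "x \<in> FA \<Longrightarrow> y \<in> FA \<Longrightarrow> univ_emb G R (x + y) = univ_emb G R x \<oplus>\<^bsub>Alg\<^esub> univ_emb G R y"
    and "x \<in> FA \<Longrightarrow> y \<in> FA \<Longrightarrow> univ_emb G R (x * y) = univ_emb G R x \<otimes>\<^bsub>Alg\<^esub> univ_emb G R y"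
    and "x \<in> FA \<Longrightarrow> univ_emb G R (fscale c x) = c \<odot>\<^bsub>Alg\<^esub> univ_emb G R x"
    and "x \<in> FA \<Longrightarrow> univ_emb G R (fstar x) = star Alg (univ_emb G R x)"
    and "univ_emb G R 1 = \<one>\<^bsub>Alg\<^esub>"
    and "x \<in> FA \<Longrightarrow> univ_emb G R x \<in> carrier Alg"
  by (simp_all add: univ_emb_eq cls_add cls_mult cls_smult cls_star one_Alg cauchy_const cls_mem)

lemma star_hom_eqI:
  assumes h: "h \<in> star_hom Alg (bounded_op_alg I)" and h': "h' \<in> star_hom Alg (bounded_op_alg I)"
    and gen: "\<And>g. g \<in> G \<Longrightarrow> h (univ_emb G R (fgen g)) = h' (univ_emb G R (fgen g))"
    and a: "a \<in> carrier Alg"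
  shows "h a = h' a"
proof -
  have emb: "h (univ_emb G R x) = h' (univ_emb G R x)" if "x \<in> FA" for x
    using that
    by (induction rule: free_carrier_induct)
      (simp_all add: emb_hom gen star_homD[OF h] star_homD[OF h'])
  obtain X where X: "X \<in> univ_cauchy G R" and aX: "a = cls X" using a by (auto simp: carrier_Alg)
  have ha: "h a \<in> bounded_ops I" and ha': "h' a \<in> bounded_ops I"
    using star_hom_closed[OF h a] star_hom_closed[OF h' a] by simp_all
  show ?thesis
  proof (rule bounded_ops_eqI[OF ha ha'])
    fix \<phi> assume \<phi>: "\<phi> \<in> ell2 I"
    let ?d = "\<lambda>i. h a \<phi> i - h' a \<phi> i"
    \<comment> \<open>The constant 4 is the factor 2 in the scaling \<open>2 * e\<close> of the
      remainder, times 2 for the two homomorphisms.\<close>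
    have le: "ell2_norm I ?d \<le> e * (4 * ell2_norm I \<phi>)" if e: "e > 0" for e
    proof -
      obtain N where N: "\<And>m n. m \<ge> N \<Longrightarrow> n \<ge> N \<Longrightarrow> U (X m - X n) < e" using cauchyE[OF X e] by blast
      \<comment> \<open>Starting the sequence at \<open>N\<close>, subtracting \<open>X N\<close>
        and dividing by \<open>2 * e\<close> brings every term, not only the late ones, below 1/2,
        as the contraction lemma demands.\<close>
      define D where "D = (\<lambda>n. fscale (complex_of_real (1 / (2 * e))) (X (n + N) + fscale (- 1) (X N)))"
      have D: "D \<in> univ_cauchy G R"
        unfolding D_def
        by (intro cauchy_fscale[of "\<lambda>n. X (n + N) + fscale (- 1) (X N)"] cauchy_add
            cauchy_shift[OF X] cauchy_const free_carrier_fscale cauchy_FA[OF X])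
      have half: "U (D n) \<le> 1/2" for n
      proof -
        have "U (D n) = 1 / (2 * e) * U (X (n + N) - X N)"
          unfolding D_def using e by (subst scale) (simp_all add: cauchy_FA X fscale_minus_one norm_divide)
        also have "\<dots> \<le> 1 / (2 * e) * e" using N[of "n + N" N] e by (intro mult_left_mono) auto
        finally show ?thesis using e by simp
      qed
      let ?c = "complex_of_real (2 * e)"
      have "a = univ_emb G R (X N) \<oplus>\<^bsub>Alg\<^esub> (?c \<odot>\<^bsub>Alg\<^esub> cls D)"
      proof -
        have sh: "(\<lambda>n. X N + fscale ?c (D n)) = (\<lambda>n. X (n + N))"
          using e by (simp add: D_def fscale_minus_one flip: of_real_mult)
        have "(\<lambda>n. U (X n - X (n + N))) \<longlonglongrightarrow> 0"
        proof (rule LIMSEQ_I)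
          fix e' :: real assume "e' > 0"
          then obtain M where M: "\<And>m n. m \<ge> M \<Longrightarrow> n \<ge> M \<Longrightarrow> U (X m - X n) < e'"
            using cauchyE[OF X] by blast
          show "\<exists>M. \<forall>n\<ge>M. norm (U (X n - X (n + N)) - 0) < e'"
            by (rule exI[of _ M]) (simp add: M X cauchy_FA)
        qed
        then have "a = cls (\<lambda>n. X (n + N))"
          unfolding aX by (subst cls_eq_iff) (simp_all add: X cauchy_shift)
        also have "\<dots> = univ_emb G R (X N) \<oplus>\<^bsub>Alg\<^esub> (?c \<odot>\<^bsub>Alg\<^esub> cls D)"
          unfolding univ_emb_eq cls_smult[OF D] sh[symmetric]
          by (rule cls_add[symmetric]) (intro cauchy_const cauchy_FA[OF X] cauchy_fscale[OF D])+
        finally show ?thesis .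
      qed
      then have "g a = g (univ_emb G R (X N)) \<oplus>\<^bsub>bounded_op_alg I\<^esub> (?c \<odot>\<^bsub>bounded_op_alg I\<^esub> g (cls D))"
        if "g \<in> star_hom Alg (bounded_op_alg I)" for g
        using star_hom_add[OF that, of "univ_emb G R (X N)" "?c \<odot>\<^bsub>Alg\<^esub> cls D"]
          star_hom_smult[OF that cls_mem[OF D]]
        by (simp add: cls_smult cls_mem D cauchy_fscale emb_hom cauchy_FA X)
      then have ga: "g a \<phi> = (\<lambda>i. g (univ_emb G R (X N)) \<phi> i + ?c * g (cls D) \<phi> i)"
        if "g \<in> star_hom Alg (bounded_op_alg I)" for g
        using that \<phi> by simp
      have m: "g (cls D) \<phi> \<in> ell2 I" if "g \<in> star_hom Alg (bounded_op_alg I)" for g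
        using star_hom_closed[OF that cls_mem[OF D]] bounded_ops_mem \<phi> by simp
      have "?d = (\<lambda>i. ?c * (h (cls D) \<phi> i - h' (cls D) \<phi> i))"
        unfolding ga[OF h] ga[OF h'] emb[OF cauchy_FA[OF X]] by (simp add: algebra_simps)
      then have "ell2_norm I ?d = 2 * e * ell2_norm I (\<lambda>i. h (cls D) \<phi> i - h' (cls D) \<phi> i)"
        using e by (simp add: ell2_norm_scale norm_mult)
      also have "\<dots> \<le> 2 * e * (ell2_norm I (h (cls D) \<phi>) + ell2_norm I (h' (cls D) \<phi>))"
        using ell2_norm_triangle_diff[OF m[OF h] ell2_zero_mem m[OF h']] e
          ell2_norm_minus_commute[of I "\<lambda>i. 0" "h' (cls D) \<phi>"]
        by (intro mult_left_mono) simp_all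
      also have "\<dots> \<le> 2 * e * (ell2_norm I \<phi> + ell2_norm I \<phi>)"
        using e by (intro mult_left_mono add_mono star_hom_contraction h h' D half \<phi>) auto
      finally show ?thesis by simp
    qed
    have "ell2_norm I ?d \<le> 0"
    proof (rule ccontr)
      assume "\<not> ell2_norm I ?d \<le> 0"
      then have p: "0 < ell2_norm I ?d" by simp
      \<comment> \<open>Adding 1 keeps the divisor positive when \<open>\<phi>\<close> is zero and
        makes the comparison strict.\<close>
      define q where "q = 4 * ell2_norm I \<phi> + 1"
      have q: "0 < q" "4 * ell2_norm I \<phi> < q" unfolding q_def using ell2_norm_nonneg[of I \<phi>] by linarith+
      have "ell2_norm I ?d \<le> ell2_norm I ?d / q * (4 * ell2_norm I \<phi>)" using p q by (intro le) simp
      also have "\<dots> < ell2_norm I ?d / q * q" using p q by (intro mult_strict_left_mono) auto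
      finally show False using q by simp
    qed
    then have "ell2_norm I ?d = 0" by (intro antisym ell2_norm_nonneg)
    then have "?d = (\<lambda>i. 0)"
      by (rule ell2_norm_eq_0[OF ell2_diff_mem[OF bounded_ops_mem[OF ha \<phi>] bounded_ops_mem[OF ha' \<phi>]]])
    then show "h a \<phi> = h' a \<phi>" by (simp add: fun_eq_iff)
  qed
qed

end

section \<open>The representation of the crossed product\<close>

lemma ell2_inner_lim:
  assumes \<phi>: "\<And>n. \<phi> n \<in> ell2 I" and \<psi>: "\<psi> \<in> ell2 I" and \<xi>: "\<xi> \<in> ell2 I"
    and lim: "(\<lambda>n. ell2_norm I (\<lambda>i. \<phi> n i - \<psi> i)) \<longlonglongrightarrow> 0"
  shows "(\<lambda>n. ell2_inner I (\<phi> n) \<xi>) \<longlonglongrightarrow> ell2_inner I \<psi> \<xi>"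
proof -
  have null: "(\<lambda>n. ell2_norm I (\<lambda>i. \<phi> n i - \<psi> i) * ell2_norm I \<xi>) \<longlonglongrightarrow> 0"
    using lim by (rule tendsto_mult_left_zero)
  have "(\<lambda>n. ell2_inner I (\<phi> n) \<xi> - ell2_inner I \<psi> \<xi>) \<longlonglongrightarrow> 0"
  proof (rule Lim_null_comparison[OF always_eventually null], rule allI)
    fix n
    show "norm (ell2_inner I (\<phi> n) \<xi> - ell2_inner I \<psi> \<xi>)
      \<le> ell2_norm I (\<lambda>i. \<phi> n i - \<psi> i) * ell2_norm I \<xi>"
      using ell2_Cauchy_Schwarz[OF ell2_diff_mem[OF \<phi> \<psi>] \<xi>, of n]
      unfolding ell2_inner_diff_left[OF \<phi> \<psi> \<xi>] .
  qed
  then show ?thesis by (rule LIM_zero_cancel)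
qed

context orbit_section
begin

sublocale univ: universal_cstar "crossed_gens p" "crossed_rels p r"
proof
  show "cstar_seminorm (crossed_gens p) (univ_seminorm (crossed_gens p) (crossed_rels p r))"
    using cstar_seminorm_rep_norm unfolding cstar_seminorm_def
    by (simp add: univ_seminorm_eq_rep_norm)
qed

abbreviation "Cau \<equiv> univ_cauchy (crossed_gens p) (crossed_rels p r)"

text \<open>The restriction is forced by the extensionality built into
  \<open>bounded_ops\<close>.\<close>

definition rep_op :: "crossed_gen free_alg \<Rightarrow> (orbit_index \<Rightarrow> complex) \<Rightarrow> orbit_index \<Rightarrow> complex" where
  "rep_op x = restrict (rep x) (ell2 Idx)"

lemma rep_op_apply: "\<phi> \<in> ell2 Idx \<Longrightarrow> rep_op x \<phi> = rep x \<phi>"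
  by (simp add: rep_op_def)

lemma rep_op_bounded:
  assumes "x \<in> univ.FA" shows "rep_op x \<in> bounded_ops Idx"
proof (rule bounded_opsI)
  show "op_bound Idx (rep_op x) (rep_norm x)"
    using rep_bound[OF assms] by (rule op_bound_cong) (simp add: rep_op_def)
qed (simp_all add: rep_op_def ell2_add_mem ell2_scale_mem rep_arg_add rep_arg_scale)

text \<open>Equality of the universal seminorm with the operator norm turns Cauchy sequences in the
  free algebra into Cauchy sequences of operators.\<close>

lemma rep_op_diff_bound:
  assumes "x \<in> univ.FA" "y \<in> univ.FA" "univ.U (x - y) \<le> e"
  shows "op_bound Idx (\<lambda>\<phi> i. rep_op x \<phi> i - rep_op y \<phi> i) e"
proof -
  have b: "op_bound Idx (rep (x - y)) (univ.U (x - y))"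
    using rep_bound[of "x - y"] assms by (simp add: univ_seminorm_eq_rep_norm)
  have "op_bound Idx (rep (x - y)) e"
  proof (rule op_boundI)
    show "0 \<le> e" using op_bound_nonneg[OF b] assms(3) by simp
    fix \<phi> assume \<phi>: "\<phi> \<in> ell2 Idx"
    show "rep (x - y) \<phi> \<in> ell2 Idx" by (rule op_bound_mem[OF b \<phi>])
    have "ell2_norm Idx (rep (x - y) \<phi>) \<le> univ.U (x - y) * ell2_norm Idx \<phi>"
      by (rule op_bound_le[OF b \<phi>])
    also have "\<dots> \<le> e * ell2_norm Idx \<phi>" using assms(3) by (intro mult_right_mono) auto
    finally show "ell2_norm Idx (rep (x - y) \<phi>) \<le> e * ell2_norm Idx \<phi>" .
  qed
  then show ?thesis by (rule op_bound_cong) (simp add: rep_op_apply rep_diff)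
qed

text \<open>The limit may be taken along any representative: \<open>op_lim_cong_cls\<close>
  transfers it to the others, and completeness supplies its existence.\<close>

definition crossed_rep :: "(nat \<Rightarrow> crossed_gen free_alg) set \<Rightarrow> (orbit_index \<Rightarrow> complex) \<Rightarrow> orbit_index \<Rightarrow> complex" where
  "crossed_rep a = (SOME T. T \<in> bounded_ops Idx \<and> (\<exists>X\<in>a. op_lim Idx (\<lambda>n. rep_op (X n)) T))"

lemma op_lim_cong_cls:
  assumes X: "X \<in> Cau" and Y: "Y \<in> univ.cls X" and lim: "op_lim Idx (\<lambda>n. rep_op (Y n)) T"
  shows "op_lim Idx (\<lambda>n. rep_op (X n)) T"
  unfolding op_lim_def
proof (intro allI impI)
  fix e :: real assume "e > 0"
  then have e: "e / 2 > 0" by simp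
  have Yc: "Y \<in> Cau" and eq: "univ.cls X = univ.cls Y" using univ.mem_cls[OF Y] by auto
  have "(\<lambda>n. univ.U (X n - Y n)) \<longlonglongrightarrow> 0" using eq by (simp add: univ.cls_eq_iff X Yc)
  from LIMSEQ_D[OF this e] obtain N where N: "\<And>n. n \<ge> N \<Longrightarrow> \<bar>univ.U (X n - Y n)\<bar> < e / 2" by auto
  obtain M where M: "\<And>n. n \<ge> M \<Longrightarrow> op_bound Idx (\<lambda>\<phi> i. rep_op (Y n) \<phi> i - T \<phi> i) (e / 2)"
    using lim e unfolding op_lim_def by blast
  show "\<exists>N. \<forall>n\<ge>N. op_bound Idx (\<lambda>\<phi> i. rep_op (X n) \<phi> i - T \<phi> i) e"
  proof (intro exI allI impI)
    fix n assume n: "n \<ge> max M N"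
    have "op_bound Idx (\<lambda>\<phi> i. rep_op (X n) \<phi> i - rep_op (Y n) \<phi> i) (e / 2)"
      using N[of n] n by (intro rep_op_diff_bound univ.cauchy_FA X Yc) auto
    from op_bound_add[OF this M[of n]] n
    show "op_bound Idx (\<lambda>\<phi> i. rep_op (X n) \<phi> i - T \<phi> i) e" by simp
  qed
qed

lemma crossed_rep_cls:
  assumes X: "X \<in> Cau"
  shows crossed_rep_bounded: "crossed_rep (univ.cls X) \<in> bounded_ops Idx"
    and crossed_rep_lim: "op_lim Idx (\<lambda>n. rep_op (X n)) (crossed_rep (univ.cls X))"
proof -
  have "\<exists>N. \<forall>m\<ge>N. \<forall>n\<ge>N. op_bound Idx (\<lambda>\<phi> i. rep_op (X m) \<phi> i - rep_op (X n) \<phi> i) e" if e: "e > 0" for e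
  proof -
    obtain N where N: "\<And>m n. m \<ge> N \<Longrightarrow> n \<ge> N \<Longrightarrow> univ.U (X m - X n) < e"
      using univ.cauchyE[OF X e] by blast
    show ?thesis
      by (intro exI[of _ N] allI impI rep_op_diff_bound univ.cauchy_FA[OF X] less_imp_le[OF N])
  qed
  then obtain T where "T \<in> bounded_ops Idx" "op_lim Idx (\<lambda>n. rep_op (X n)) T"
    using bounded_ops_complete[of "\<lambda>n. rep_op (X n)" Idx] rep_op_bounded[OF univ.cauchy_FA[OF X]] by blast
  then have "\<exists>T. T \<in> bounded_ops Idx \<and> (\<exists>Y\<in>univ.cls X. op_lim Idx (\<lambda>n. rep_op (Y n)) T)"
    using univ.cls_self[OF X] by blast
  from someI_ex[OF this, folded crossed_rep_def]
  show "crossed_rep (univ.cls X) \<in> bounded_ops Idx"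
    "op_lim Idx (\<lambda>n. rep_op (X n)) (crossed_rep (univ.cls X))"
    using op_lim_cong_cls[OF X] by blast+
qed

lemma crossed_rep_norm_lim:
  assumes X: "X \<in> Cau" and \<phi>: "\<phi> \<in> ell2 Idx"
  shows "(\<lambda>n. ell2_norm Idx (\<lambda>i. rep (X n) \<phi> i - crossed_rep (univ.cls X) \<phi> i)) \<longlonglongrightarrow> 0"
  using op_lim_apply[OF crossed_rep_lim[OF X] crossed_rep_bounded[OF X] rep_op_bounded[OF univ.cauchy_FA[OF X]],
      of "\<lambda>_. \<phi>" \<phi>] \<phi>
  by (simp add: rep_op_apply)

lemma crossed_rep_coord:
  assumes X: "X \<in> Cau" and \<phi>: "\<phi> \<in> ell2 Idx"
  shows "(\<lambda>n. rep (X n) \<phi> i) \<longlonglongrightarrow> crossed_rep (univ.cls X) \<phi> i"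
  using op_lim_coord[OF crossed_rep_lim[OF X] crossed_rep_bounded[OF X] rep_op_bounded[OF univ.cauchy_FA[OF X]] \<phi>]
  by (simp add: rep_op_apply \<phi>)

lemma rep_mem: "x \<in> univ.FA \<Longrightarrow> \<phi> \<in> ell2 Idx \<Longrightarrow> rep x \<phi> \<in> ell2 Idx"
  by (rule op_bound_mem[OF rep_bound])

lemma crossed_rep_emb:
  assumes x: "x \<in> univ.FA"
  shows "crossed_rep (univ_emb (crossed_gens p) (crossed_rels p r) x) = rep_op x"
proof -
  have X: "(\<lambda>_. x) \<in> Cau" by (rule univ.cauchy_const[OF x])
  show ?thesis
    unfolding univ.univ_emb_eq
  proof (rule bounded_ops_eqI[OF crossed_rep_bounded[OF X] rep_op_bounded[OF x]], rule ext)
    fix \<phi> i assume "\<phi> \<in> ell2 Idx"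
    then show "crossed_rep (univ.cls (\<lambda>_. x)) \<phi> i = rep_op x \<phi> i"
      using crossed_rep_coord[OF X, of \<phi> i] by (simp add: rep_op_apply LIMSEQ_const_iff)
  qed
qed

lemma crossed_rep_star_hom: "crossed_rep \<in> star_hom (crossed_alg p r) (bounded_op_alg Idx)"
proof -
  \<comment> \<open>Operators are determined by their coordinates, so the laws for the unit, sums,
    scalars and products reduce to identifying coordinatewise limits of \<open>rep\<close>.\<close>
  have eqI: "crossed_rep (univ.cls Z) = (\<lambda>\<phi>\<in>ell2 Idx. \<lambda>i. t \<phi> i)"
    if Z: "Z \<in> Cau" and lim: "\<And>\<phi> i. \<phi> \<in> ell2 Idx \<Longrightarrow> (\<lambda>n. rep (Z n) \<phi> i) \<longlonglongrightarrow> t \<phi> i" for Z t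
  proof (rule extensionalityI)
    show "crossed_rep (univ.cls Z) \<in> extensional (ell2 Idx)"
      by (rule bounded_ops_ext[OF crossed_rep_bounded[OF Z]])
    fix \<phi> assume \<phi>: "\<phi> \<in> ell2 Idx"
    then show "crossed_rep (univ.cls Z) \<phi> = (\<lambda>\<phi>\<in>ell2 Idx. \<lambda>i. t \<phi> i) \<phi>"
      using LIMSEQ_unique[OF crossed_rep_coord[OF Z \<phi>] lim[OF \<phi>]] by auto
  qed simp
  have one: "crossed_rep \<one>\<^bsub>univ.Alg\<^esub> = \<one>\<^bsub>bounded_op_alg Idx\<^esub>"
    unfolding univ.one_Alg by (subst eqI[of _ "\<lambda>\<phi>. \<phi>"]) (simp_all add: univ.cauchy_const)
  have add: "crossed_rep (univ.cls X \<oplus>\<^bsub>univ.Alg\<^esub> univ.cls Y)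
      = crossed_rep (univ.cls X) \<oplus>\<^bsub>bounded_op_alg Idx\<^esub> crossed_rep (univ.cls Y)"
    if X: "X \<in> Cau" and Y: "Y \<in> Cau" for X Y
    unfolding univ.cls_add[OF X Y]
    by (subst eqI[OF univ.cauchy_add[OF X Y],
          of "\<lambda>\<phi> i. crossed_rep (univ.cls X) \<phi> i + crossed_rep (univ.cls Y) \<phi> i"])
      (simp_all add: rep_add tendsto_add crossed_rep_coord X Y)
  have smult: "crossed_rep (c \<odot>\<^bsub>univ.Alg\<^esub> univ.cls X) = c \<odot>\<^bsub>bounded_op_alg Idx\<^esub> crossed_rep (univ.cls X)"
    if X: "X \<in> Cau" for X c
    unfolding univ.cls_smult[OF X]
    by (subst eqI[OF univ.cauchy_fscale[OF X], of c "\<lambda>\<phi> i. c * crossed_rep (univ.cls X) \<phi> i"])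
      (simp_all add: rep_fscale tendsto_mult_left crossed_rep_coord X)
  have mult: "crossed_rep (univ.cls X \<otimes>\<^bsub>univ.Alg\<^esub> univ.cls Y)
      = crossed_rep (univ.cls X) \<otimes>\<^bsub>bounded_op_alg Idx\<^esub> crossed_rep (univ.cls Y)"
    if X: "X \<in> Cau" and Y: "Y \<in> Cau" for X Y
  proof -
    have "(\<lambda>n. rep (X n * Y n) \<phi> i) \<longlonglongrightarrow> crossed_rep (univ.cls X) (crossed_rep (univ.cls Y) \<phi>) i"
      if \<phi>: "\<phi> \<in> ell2 Idx" for \<phi> i
    proof -
      have m: "rep (Y n) \<phi> \<in> ell2 Idx" for n by (rule rep_mem[OF univ.cauchy_FA[OF Y] \<phi>])
      have m': "crossed_rep (univ.cls Y) \<phi> \<in> ell2 Idx"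
        by (rule bounded_ops_mem[OF crossed_rep_bounded[OF Y] \<phi>])
      \<comment> \<open>Both the operators and the vectors they act on vary with \<open>n\<close>,
        so convergence on a fixed vector would not be enough; joint continuity is used.\<close>
      have "(\<lambda>n. ell2_norm Idx (\<lambda>i. rep_op (X n) (rep (Y n) \<phi>) i
          - crossed_rep (univ.cls X) (crossed_rep (univ.cls Y) \<phi>) i)) \<longlonglongrightarrow> 0"
        by (rule op_lim_apply[OF crossed_rep_lim[OF X] crossed_rep_bounded[OF X]
              rep_op_bounded[OF univ.cauchy_FA[OF X]] m m' crossed_rep_norm_lim[OF Y \<phi>]])
      then have "(\<lambda>n. rep_op (X n) (rep (Y n) \<phi>) i) \<longlonglongrightarrow> crossed_rep (univ.cls X) (crossed_rep (univ.cls Y) \<phi>) i"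
        by (rule ell2_norm_conv_coord[rotated 2])
          (intro bounded_ops_mem[OF rep_op_bounded[OF univ.cauchy_FA[OF X]]] m
            bounded_ops_mem[OF crossed_rep_bounded[OF X]] m')+
      then show ?thesis by (simp add: rep_mult rep_op_apply m)
    qed
    then show ?thesis
      unfolding univ.cls_mult[OF X Y]
      by (subst eqI[OF univ.cauchy_mult[OF X Y],
            of "\<lambda>\<phi> i. crossed_rep (univ.cls X) (crossed_rep (univ.cls Y) \<phi>) i"]) simp_all
  qed
  have star: "crossed_rep (star univ.Alg (univ.cls X)) = star (bounded_op_alg Idx) (crossed_rep (univ.cls X))"
    if X: "X \<in> Cau" for X
  proof -
    note Xs = univ.cauchy_fstar[OF X]
    have "hilbert_adjoint Idx (crossed_rep (univ.cls X)) = crossed_rep (univ.cls (\<lambda>n. fstar (X n)))"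
    proof (rule hilbert_adjoint_eqI[OF crossed_rep_bounded[OF Xs]])
      fix \<phi> \<psi> assume \<phi>: "\<phi> \<in> ell2 Idx" and \<psi>: "\<psi> \<in> ell2 Idx"
      have "(\<lambda>n. ell2_inner Idx (rep (X n) \<phi>) \<psi>) \<longlonglongrightarrow> ell2_inner Idx (crossed_rep (univ.cls X) \<phi>) \<psi>"
        by (intro ell2_inner_lim crossed_rep_norm_lim rep_mem univ.cauchy_FA
            bounded_ops_mem[OF crossed_rep_bounded] X \<phi> \<psi>)
      moreover have "(\<lambda>n. cnj (ell2_inner Idx (rep (fstar (X n)) \<psi>) \<phi>))
          \<longlonglongrightarrow> cnj (ell2_inner Idx (crossed_rep (univ.cls (\<lambda>n. fstar (X n))) \<psi>) \<phi>)"
        by (intro tendsto_cnj ell2_inner_lim crossed_rep_norm_lim[OF Xs] rep_mem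
            free_carrier_fstar univ.cauchy_FA[OF X] bounded_ops_mem[OF crossed_rep_bounded[OF Xs]] \<phi> \<psi>)
      moreover have "ell2_inner Idx (rep (X n) \<phi>) \<psi> = cnj (ell2_inner Idx (rep (fstar (X n)) \<psi>) \<phi>)" for n
        using rep_adjoint[OF univ.cauchy_FA[OF X] \<phi> \<psi>] by (simp flip: ell2_inner_commute)
      ultimately show "ell2_inner Idx (crossed_rep (univ.cls X) \<phi>) \<psi>
          = ell2_inner Idx \<phi> (crossed_rep (univ.cls (\<lambda>n. fstar (X n))) \<psi>)"
        using LIMSEQ_unique by (simp flip: ell2_inner_commute)
    qed
    then show ?thesis by (simp add: univ.cls_star[OF X])
  qed
  show ?thesis
    unfolding star_hom_def crossed_alg_def
  proof (intro CollectI conjI ring_hom_memI ballI allI)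
    fix a assume "a \<in> carrier univ.Alg"
    then obtain X where a: "a = univ.cls X" and X: "X \<in> Cau" unfolding univ.carrier_Alg by blast
    show "crossed_rep a \<in> carrier (bounded_op_alg Idx)" by (simp add: a crossed_rep_bounded X)
    show "crossed_rep (c \<odot>\<^bsub>univ.Alg\<^esub> a) = c \<odot>\<^bsub>bounded_op_alg Idx\<^esub> crossed_rep a" for c
      unfolding a by (rule smult[OF X])
    show "crossed_rep (star univ.Alg a) = star (bounded_op_alg Idx) (crossed_rep a)"
      unfolding a by (rule star[OF X])
    fix b assume "b \<in> carrier univ.Alg"
    then obtain Y where b: "b = univ.cls Y" and Y: "Y \<in> Cau" unfolding univ.carrier_Alg by blast
    show "crossed_rep (a \<otimes>\<^bsub>univ.Alg\<^esub> b) = crossed_rep a \<otimes>\<^bsub>bounded_op_alg Idx\<^esub> crossed_rep b"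
      unfolding a b by (rule mult[OF X Y])
    show "crossed_rep (a \<oplus>\<^bsub>univ.Alg\<^esub> b) = crossed_rep a \<oplus>\<^bsub>bounded_op_alg Idx\<^esub> crossed_rep b"
      unfolding a b by (rule add[OF X Y])
  qed (rule one)
qed

text \<open>If two classes have the same image, the operators of their representing sequences
  approach one limit; since the universal seminorm is the operator norm on the free algebra, the
  sequences differ by a null sequence.\<close>

lemma crossed_rep_inj: "inj_on crossed_rep (carrier (crossed_alg p r))"
proof (rule inj_onI)
  fix a b assume ab: "a \<in> carrier (crossed_alg p r)" "b \<in> carrier (crossed_alg p r)"
    and eq: "crossed_rep a = crossed_rep b"
  then obtain X Y where X: "X \<in> Cau" "a = univ.cls X" and Y: "Y \<in> Cau" "b = univ.cls Y"
    unfolding crossed_alg_def univ.carrier_Alg by blast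
  have "(\<lambda>n. univ.U (X n - Y n)) \<longlonglongrightarrow> 0"
  proof (rule LIMSEQ_I)
    fix e :: real assume "e > 0"
    then have e: "e / 3 > 0" by simp
    obtain N where N: "\<And>n. n \<ge> N \<Longrightarrow> op_bound Idx (\<lambda>\<phi> i. rep_op (X n) \<phi> i - crossed_rep a \<phi> i) (e / 3)"
      using crossed_rep_lim[OF X(1)] e unfolding op_lim_def X(2) by blast
    obtain M where M: "\<And>n. n \<ge> M \<Longrightarrow> op_bound Idx (\<lambda>\<phi> i. rep_op (Y n) \<phi> i - crossed_rep a \<phi> i) (e / 3)"
      using crossed_rep_lim[OF Y(1)] e unfolding op_lim_def eq Y(2) by blast
    have "univ.U (X n - Y n) < e" if n: "n \<ge> max M N" for n
    proof -
      have FA: "X n \<in> univ.FA" "Y n \<in> univ.FA" using X Y univ.cauchy_FA by auto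
      have "op_bound Idx (rep (X n - Y n)) (e / 3 + cmod (- 1) * (e / 3))"
        using n by (intro op_bound_cong[OF op_bound_add[OF N op_bound_scale[OF M, of n "- 1"]]])
          (auto simp: rep_op_apply rep_diff)
      from rep_norm_le[OF this] have "univ.U (X n - Y n) \<le> 2 * e / 3"
        using FA by (simp add: univ_seminorm_eq_rep_norm)
      then show ?thesis using \<open>e > 0\<close> by simp
    qed
    moreover have "0 \<le> univ.U (X n - Y n)" for n
      using X Y by (intro univ.nonneg free_carrier_diff univ.cauchy_FA)
    ultimately show "\<exists>N. \<forall>n\<ge>N. norm (univ.U (X n - Y n) - 0) < e"
      by (intro exI[of _ "max M N"]) auto
  qed
  then show "a = b" by (simp add: X Y univ.cls_eq_iff)
qed

lemma crossed_rep_V: "crossed_rep (crossed_V p r) = shift_op p r"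
  unfolding crossed_V_def shift_op_def
  by (subst crossed_rep_emb[OF free_carrier_fgen]) (auto simp: crossed_gens_def rep_op_def rep_fgen fun_eq_iff restrict_def)

lemma crossed_rep_M:
  "f \<in> cont_padic p \<Longrightarrow> crossed_rep (crossed_M p r f) = mult_op p r \<gamma> f"
  unfolding crossed_M_def mult_op_def
  by (subst crossed_rep_emb[OF free_carrier_fgen])
    (auto simp: crossed_gens_def rep_op_def rep_fgen fun_eq_iff restrict_def)

lemma crossed_hom_unique:
  assumes h: "h \<in> star_hom (crossed_alg p r) (bounded_op_alg I)"
    and h': "h' \<in> star_hom (crossed_alg p r) (bounded_op_alg I)"
    and V: "h (crossed_V p r) = h' (crossed_V p r)"
    and M: "\<And>f. f \<in> cont_padic p \<Longrightarrow> h (crossed_M p r f) = h' (crossed_M p r f)"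
    and a: "a \<in> carrier (crossed_alg p r)"
  shows "h a = h' a"
proof (rule univ.star_hom_eqI[OF h[unfolded crossed_alg_def] h'[unfolded crossed_alg_def] _ a[unfolded crossed_alg_def]])
  fix g assume "g \<in> crossed_gens p"
  then show "h (univ_emb (crossed_gens p) (crossed_rels p r) (fgen g))
      = h' (univ_emb (crossed_gens p) (crossed_rels p r) (fgen g))"
    using V M unfolding crossed_gens_def crossed_V_def crossed_M_def by blast
qed

end

theorem theorem5p3:
  fixes p :: nat and r :: padic_seq and \<gamma> :: "padic_seq set \<Rightarrow> padic_seq"
  assumes "prime p" and "odd p"
    and "r \<in> carrier (padic_units p)"
    and "\<forall>n::nat. n > 0 \<longrightarrow> r [^]\<^bsub>padic p\<^esub> n \<noteq> \<one>\<^bsub>padic p\<^esub>"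
    and "\<gamma> \<in> carrier (padic_units p Mod orbit_closure p r) \<rightarrow> carrier (padic_units p)"
    and "\<forall>c\<in>carrier (padic_units p Mod orbit_closure p r).
           orbit_closure p r #>\<^bsub>padic_units p\<^esub> \<gamma> c = c"
  shows "\<exists>\<pi>\<in>star_hom (crossed_alg p r) (bounded_op_alg (orbit_indices p r)).
           \<pi> (crossed_V p r) = shift_op p r \<and>
           (\<forall>f\<in>cont_padic p. \<pi> (crossed_M p r f) = mult_op p r \<gamma> f) \<and>
           inj_on \<pi> (carrier (crossed_alg p r)) \<and>
           (\<forall>\<pi>'\<in>star_hom (crossed_alg p r) (bounded_op_alg (orbit_indices p r)).
              \<pi>' (crossed_V p r) = shift_op p r \<and>
              (\<forall>f\<in>cont_padic p. \<pi>' (crossed_M p r f) = mult_op p r \<gamma> f) \<longrightarrow>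
              (\<forall>a\<in>carrier (crossed_alg p r). \<pi>' a = \<pi> a))"
proof -
  interpret orbit_section p r \<gamma>
    by (rule orbit_section.intro[OF assms(1,3,5) bspec[OF assms(6)]])
  show ?thesis
  proof (rule bexI[OF _ crossed_rep_star_hom], intro conjI ballI impI)
    fix \<pi>' a assume \<pi>': "\<pi>' \<in> star_hom (crossed_alg p r) (bounded_op_alg (orbit_indices p r))"
      and gens: "\<pi>' (crossed_V p r) = shift_op p r \<and> (\<forall>f\<in>cont_padic p. \<pi>' (crossed_M p r f) = mult_op p r \<gamma> f)"
      and a: "a \<in> carrier (crossed_alg p r)"
    show "\<pi>' a = crossed_rep a"
      by (rule crossed_hom_unique[OF \<pi>' crossed_rep_star_hom _ _ a])
        (use gens in \<open>simp_all add: crossed_rep_V crossed_rep_M\<close>)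
  qed (simp_all only: crossed_rep_V crossed_rep_M crossed_rep_inj)
qed

end
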